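(* Let $\epsilon>0$ be a fixed, arbitrarily small number. Let $\Delta\in(0,1/6]$ and suppose there is a constant $A(\Delta)>0$ such that $$\Big|\sum_{a\le n<b} n^{it}\Big|<A(\Delta)\,\sqrt{a}\,t^{\Delta}$$ for all $t>0$ and all $a,b$ with $1\le a<b\le 2a$ and $b\le\sqrt{t/(2\pi)}$. Then, as $T\to\infty$, for $H\in(0,T^{1/6+\epsilon}]$, $$\sum_{T\le t_{2\nu}\le T+H}\{Z[t_{2\nu}(\tau)]-Z(t_{2\nu})\}=-\frac1\pi H\ln\frac{T}{2\pi}\,\sin^2\frac{\tau}{2}+\mathcal{O}(T^{\Delta}\ln T),$$ $$\sum_{T\le t_{2\nu+1}\le T+H}\{Z[t_{2\nu+1}(\tau)]-Z(t_{2\nu+1})\}=\frac1\pi H\ln\frac{T}{2\pi}\,\sin^2\frac{\tau}{2}+\mathcal{O}(T^{\Delta}\ln T),$$ where the $\mathcal{O}$-estimates hold uniformly for $\tau\in[-\pi,\pi]$.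
   Context: $Z(t)=e^{i\vartheta(t)}\zeta(\tfrac12+it)$ is the (real-valued) Riemann–Siegel (Hardy) function, where $\vartheta(t)=-\frac t2\ln\pi+\operatorname{Im}\ln\Gamma\left(\frac14+i\frac t2\right)$ (continuous branch with $\vartheta(0)=0$). For integers $\nu\ge\nu_0$ ($\nu_0$ a fixed sufficiently large integer) and $\tau\in[-\pi,\pi]$, $t_\nu(\tau)$ is the (large) solution of $\vartheta[t_\nu(\tau)]=\pi\nu+\tau$, and $t_\nu=t_\nu(0)$. The sum over $T\le t_{2\nu}\le T+H$ (resp. $T\le t_{2\nu+1}\le T+H$) runs over all integers $\nu$ with $t_{2\nu}\in[T,T+H]$ (resp. $t_{2\nu+1}\in[T,T+H]$). The implied constants do not depend on $T$ or $H$. *)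

theory Defs
  imports "HOL-Complex_Analysis.Complex_Analysis"
begin

section \<open>The Riemann zeta function on the right half-plane\<close>

text \<open>
  The analytic continuation of the Dirichlet series to \<open>Re s > 0\<close>, \<open>s \<noteq> 1\<close>, a region containing
  the critical line. The region is open and connected, so the values there are uniquely
  determined by the two conditions; existence is proved below. Values outside the region are
  unspecified.
\<close>

definition is_zeta_continuation :: "(complex \<Rightarrow> complex) \<Rightarrow> bool" where
  "is_zeta_continuation f \<longleftrightarrow>
     f holomorphic_on {s. Re s > 0 \<and> s \<noteq> 1} \<and>
     (\<forall>s. Re s > 1 \<longrightarrow> (\<lambda>n. 1 / of_nat (Suc n) powr s) sums f s)"

definition zeta :: "complex \<Rightarrow> complex" where
  "zeta = (SOME f. is_zeta_continuation f)"

text \<open>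
  Existence: for \<open>Re s > 1\<close>, subtracting a telescoping series gives
  \<open>\<zeta>(s) = 1 / (s - 1) + (\<Sum>n\<ge>1. n powr (-s) - \<integral>x=n..n+1. x powr (-s))\<close>, and the right-hand side
  converges locally uniformly for \<open>Re s > 0\<close>.
\<close>

context
begin

private definition b :: "nat \<Rightarrow> complex \<Rightarrow> complex" where
  "b n s = of_nat (Suc n) powr (-s)
     - (of_nat (Suc (Suc n)) powr (1 - s) - of_nat (Suc n) powr (1 - s)) / (1 - s)"

private lemma norm_b_le:
  assumes "Re s > 0" "s \<noteq> 1"
  shows "norm (b n s) \<le> norm s * real (Suc n) powr (- Re s - 1)"
proof -
  define N where "N = real (Suc n)"
  define S where "S = closed_segment (complex_of_real N) (of_real (N + 1))"
  define M where "M = norm s * N powr (- Re s - 1)"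
  have N: "N \<ge> 1" by (simp add: N_def)
  have S: "\<exists>y. z = of_real y \<and> y \<ge> N \<and> y \<le> N + 1" if "z \<in> S" for z
  proof -
    from that obtain u where u: "0 \<le> u" "u \<le> 1"
      "z = (1 - u) *\<^sub>R complex_of_real N + u *\<^sub>R of_real (N + 1)"
      unfolding S_def in_segment by blast
    have "z = of_real (N + u)"
      using u(3) by (simp add: scaleR_conv_of_real algebra_simps)
    with u show ?thesis by (intro exI[of _ "N + u"]) auto
  qed
  have nz: "z \<notin> \<real>\<^sub>\<le>\<^sub>0" if "z \<in> S" for z
    using S[OF that] N by auto
  have NS: "of_real N \<in> S" "of_real (N + 1) \<in> S" unfolding S_def by simp_all
  have cS: "convex S" unfolding S_def by simp
  have M: "M \<ge> 0" by (simp add: M_def)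
  have inner: "norm (z powr (-s) - of_real N powr (-s)) \<le> M" if z: "z \<in> S" for z
  proof -
    have "norm (z powr (-s) - of_real N powr (-s)) \<le> M * norm (z - of_real N)"
    proof (rule field_differentiable_bound[OF cS _ _ z NS(1)])
      fix w assume w: "w \<in> S"
      show "((\<lambda>w. w powr (-s)) has_field_derivative (-s) * w powr (-s - 1)) (at w within S)"
        using has_field_derivative_powr[OF nz[OF w]] by (rule has_field_derivative_at_within)
      obtain y where y: "w = of_real y" "y \<ge> N" using S[OF w] by blast
      have "norm (w powr (-s - 1)) = y powr (- Re s - 1)"
        using y N by (simp add: norm_powr_real_powr)
      also have "\<dots> \<le> N powr (- Re s - 1)"
        using y N assms by (intro powr_mono2') auto
      finally show "norm ((-s) * w powr (-s - 1)) \<le> M"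
        unfolding M_def norm_mult by (simp add: mult_left_mono)
    qed
    also have "\<dots> \<le> M * 1"
    proof (intro mult_left_mono M)
      obtain y where y: "z = of_real y" "y \<ge> N" "y \<le> N + 1" using S[OF z] by blast
      have "z - of_real N = of_real (y - N)" using y by simp
      then show "norm (z - of_real N) \<le> 1" using y by (simp only: norm_of_real)
    qed
    finally show ?thesis by simp
  qed
  let ?F = "\<lambda>z. z powr (1 - s) / (1 - s) - z * of_real N powr (-s)"
  have "norm (?F (of_real N) - ?F (of_real (N + 1))) \<le> M * norm (complex_of_real N - of_real (N + 1))"
  proof (rule field_differentiable_bound[OF cS _ _ NS])
    fix w assume w: "w \<in> S"
    have "(?F has_field_derivative ((1 - s) * w powr (1 - s - 1)) / (1 - s) - 1 * of_real N powr (-s))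
            (at w)"
      by (intro DERIV_diff DERIV_cdivide has_field_derivative_powr nz[OF w] DERIV_cmult_right DERIV_ident)
    then have "(?F has_field_derivative w powr (-s) - of_real N powr (-s)) (at w)"
      using assms by simp
    then show "(?F has_field_derivative w powr (-s) - of_real N powr (-s)) (at w within S)"
      by (rule has_field_derivative_at_within)
    show "norm (w powr (-s) - of_real N powr (-s)) \<le> M" by (rule inner[OF w])
  qed
  also have "norm (complex_of_real N - of_real (N + 1)) = 1" by simp
  also have "?F (of_real N) - ?F (of_real (N + 1)) = b n s"
    by (simp add: b_def N_def diff_divide_distrib distrib_right add_ac)
  finally show ?thesis by (simp add: M_def N_def)
qed

private lemma holomorphic_sum_b:
  "(\<lambda>s. \<Sum>n. b n s) holomorphic_on {s. Re s > 0 \<and> s \<noteq> 1}" (is "_ holomorphic_on ?D")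
proof (rule holomorphic_uniform_sequence)
  have D: "?D = {s. Re s > 0} - {1}" by auto
  show op: "open ?D" unfolding D by (intro open_Diff open_halfspace_Re_gt) simp
  show "(\<lambda>s. \<Sum>i<n. b i s) holomorphic_on ?D" for n
    unfolding b_def by (intro holomorphic_intros) auto
  fix z assume z: "z \<in> ?D"
  obtain e where e: "e > 0" "cball z e \<subseteq> ?D"
    using op z open_contains_cball by blast
  define d where "d = min e (Re z / 2)"
  have d: "d > 0" "cball z d \<subseteq> ?D" "d \<le> Re z / 2"
    using e z by (auto simp: d_def)
  have "uniform_limit (cball z d) (\<lambda>n s. \<Sum>i<n. b i s) (\<lambda>s. \<Sum>n. b n s) sequentially"
  proof (rule Weierstrass_m_test)
    fix n s assume s: "s \<in> cball z d"
    then have "s \<in> ?D" using d by blast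
    then have "norm (b n s) \<le> norm s * real (Suc n) powr (- Re s - 1)"
      by (intro norm_b_le) auto
    also have "\<dots> \<le> (norm z + d) * real (Suc n) powr (- (Re z / 2) - 1)"
    proof (intro mult_mono powr_mono)
      show "norm s \<le> norm z + d"
        using s norm_triangle_ineq2[of s z] by (simp add: dist_norm norm_minus_commute)
      have "Re z - Re s \<le> norm (z - s)" using complex_Re_le_cmod[of "z - s"] by simp
      then show "- Re s - 1 \<le> - (Re z / 2) - 1" using s d by (simp add: dist_norm)
    qed (use d in auto)
    finally show "norm (b n s) \<le> (norm z + d) * real (Suc n) powr (- (Re z / 2) - 1)" .
  next
    have "summable (\<lambda>n. real n powr (- (Re z / 2) - 1))"
      using z by (subst summable_real_powr_iff) auto
    then show "summable (\<lambda>n. (norm z + d) * real (Suc n) powr (- (Re z / 2) - 1))"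
      by (intro summable_mult) (subst summable_Suc_iff)
  qed
  then show "\<exists>d>0. cball z d \<subseteq> ?D \<and>
      uniform_limit (cball z d) (\<lambda>n s. \<Sum>i<n. b i s) (\<lambda>s. \<Sum>n. b n s) sequentially"
    using d by blast
qed

private lemma dirichlet_series_sums:
  assumes "Re s > 1"
  shows "(\<lambda>n. 1 / of_nat (Suc n) powr s) sums (1 / (s - 1) + (\<Sum>n. b n s))"
proof -
  have s: "s \<noteq> 1" "Re s > 0" using assms by auto
  have "summable (\<lambda>n. real (Suc n) powr (- Re s - 1))"
    using s by (subst summable_Suc_iff[of "\<lambda>n. real n powr (- Re s - 1)"])
      (simp add: summable_real_powr_iff)
  then have "summable (\<lambda>n. norm s * real (Suc n) powr (- Re s - 1))"
    by (rule summable_mult)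
  then have "summable (\<lambda>n. b n s)"
    by (rule summable_comparison_test[rotated]) (use norm_b_le s in blast)
  then have 1: "(\<lambda>n. b n s) sums (\<Sum>n. b n s)" by (rule summable_sums)
  have "(\<lambda>n. of_nat (Suc n) powr (1 - s)) \<longlonglongrightarrow> (0 :: complex)"
    using assms by (intro tendsto_neg_powr_complex_of_nat filterlim_Suc) auto
  moreover have "- (1 / (1 - s)) = 1 / (s - 1)"
    using s by (simp add: divide_simps)
  ultimately
  have 2: "(\<lambda>n. (of_nat (Suc (Suc n)) powr (1 - s) - of_nat (Suc n) powr (1 - s)) / (1 - s))
             sums (1 / (s - 1))"
    using sums_divide[OF telescope_sums, of "\<lambda>n. of_nat (Suc n) powr (1 - s)" 0 "1 - s"] by simp
  show ?thesis
    using sums_add[OF 2 1] by (simp add: b_def powr_minus_divide)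
qed

lemma is_zeta_continuation_zeta: "is_zeta_continuation zeta"
proof -
  have "(\<lambda>s. 1 / (s - 1) + (\<Sum>n. b n s)) holomorphic_on {s. Re s > 0 \<and> s \<noteq> 1}"
    by (intro holomorphic_intros holomorphic_sum_b) auto
  then have "is_zeta_continuation (\<lambda>s. 1 / (s - 1) + (\<Sum>n. b n s))"
    unfolding is_zeta_continuation_def using dirichlet_series_sums by blast
  then show ?thesis unfolding zeta_def by (rule someI[of is_zeta_continuation])
qed

end


section \<open>The Riemann--Siegel functions\<close>

text \<open>
  \<^const>\<open>ln_Gamma\<close> is holomorphic off the non-positive reals and real on the positive reals, so
  this is the continuous branch that vanishes at 0.
\<close>

definition RS_theta :: "real \<Rightarrow> real" where
  "RS_theta t = - (t / 2) * ln pi + Im (ln_Gamma (1 / 4 + \<i> * of_real (t / 2)))"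

definition hardy_Z :: "real \<Rightarrow> complex" where
  "hardy_Z t = exp (\<i> * of_real (RS_theta t)) * zeta (1 / 2 + \<i> * of_real t)"

text \<open>
  \<open>gram_pt \<nu> \<tau>\<close> is \<open>t\<^sub>\<nu>(\<tau>)\<close>. The function \<^const>\<open>RS_theta\<close> is continuous, tends to \<open>\<plusminus>\<infinity>\<close> at \<open>\<plusminus>\<infinity>\<close>, and
  is increasing outside a bounded interval; a solution always exists, and the large one is the
  greatest.
\<close>

definition gram_pt :: "int \<Rightarrow> real \<Rightarrow> real" where
  "gram_pt \<nu> \<tau> = (GREATEST t. RS_theta t = pi * of_int \<nu> + \<tau>)"

end

theory Submission
  imports Defs "HOL-Real_Asymp.Real_Asymp"
begin

text \<open>
  Write \<open>R s\<close> for the integral of \<open>x powr (-s) * exp (\<i> * pi * x\<^sup>2) / (2 * \<i> * sin (pi * x))\<close> over a line of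
  slope 1. Mordell's evaluation of the same integral with \<open>exp (2 * pi * \<i> * u * x)\<close> in place of
  \<open>x powr (-s)\<close>, followed by a Mellin transform in \<open>u\<close>, gives the Riemann--Siegel formula
  \<open>Z t = 2 * Re (exp (\<i> * \<theta> t) * (\<Sum>n\<le>N. n powr (-s) - R s))\<close>, \<open>s = 1/2 + \<i> * t\<close>. If the line crosses the real axis
  near the saddle point \<open>sqrt (t / (2 * pi))\<close>, then \<open>R s = O(t powr (-1/4))\<close>.

  On an interval of length at most \<open>T powr (1/6 + \<epsilon>)\<close>, \<open>\<theta>\<close> is linear with slope \<open>\<omega> = ln (T / (2 * pi)) / 2\<close> up to a
  negligible error, so the Gram points of one parity form an arithmetic progression, and the sum
  over them of the \<open>n\<close>-th term of the difference is a geometric sum. For \<open>n = 1\<close> it is the main term. For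
  \<open>n \<ge> 2\<close>, with \<open>\<lambda> = 1 - ln n / \<omega>\<close>, it is \<open>n powr (-1/2) * w \<lambda>\<close> times a difference of two values of \<open>n powr (-\<i> * t)\<close>,
  where \<open>w \<lambda> = (exp (\<i> * \<tau> * \<lambda>) - 1) / (exp (2 * pi * \<i> * \<lambda>) - 1)\<close>. Because the difference of the two
  values of \<open>Z\<close> is taken, \<open>w\<close> stays smooth at \<open>\<lambda> = 0\<close>, where the geometric sum has no cancellation;
  at \<open>\<lambda> = 1\<close> it is singular, but there \<open>n\<close> is so small that trivial bounds suffice. Partial summation and
  the hypothesis on dyadic blocks finish the proof.
\<close>

section \<open>Integrals over horizontal lines and parameter integrals\<close>

text \<open>Each Gram point costs \<open>T powr (-1/4)\<close> from the remainder and, from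
  linearising \<open>\<theta>\<close>, about \<open>H^2 / T\<close> times the Lipschitz constant
  \<open>T powr (1/4) * ln T\<close> of the main sum. With about \<open>H * ln T\<close> points both
  totals are \<open>O(ln T)\<close> once \<open>H \<le> T powr (1/4)\<close> and
  \<open>H^3 * ln T \<le> T powr (3/4)\<close>, which leaves room around the exponent 1/6.

  The length \<open>N\<close> of the main sum must not vary with the Gram point, or the geometric
  sums break up. It is therefore taken from \<open>T\<close>, with the line of integration between
  \<open>N\<close> and \<open>N + 1\<close>; for \<open>\<bar>t - T\<bar> \<le> sqrt T\<close> the
  saddle point stays within 1 of that line.

  The sum over \<open>n\<close> is split at \<open>T powr (2 * \<Delta>)\<close>. Below,
  \<open>n powr (-1/2)\<close> sums to \<open>O(T powr \<Delta>)\<close> and the weight is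
  \<open>O(ln T)\<close>. Above, \<open>\<lambda> \<le> 1 - 4 * \<Delta>\<close>, the weight has
  bounded variation, and \<open>O(ln T)\<close> dyadic blocks contribute
  \<open>O(T powr \<Delta>)\<close> each. The terms \<open>N - 1\<close> and \<open>N\<close>, near
  \<open>\<lambda> = 0\<close>, are bounded trivially.

  The Riemann-Siegel formula is reached without a functional equation for zeta: Mellin transforms
  give it for real s between 2 and 3, and analytic continuation does the rest.\<close>

lemma has_contour_integral_horizontal_linepath:
  assumes "p < q"
  shows "(f has_contour_integral I) (linepath (Complex p y) (Complex q y)) \<longleftrightarrow>
         ((\<lambda>x. f (Complex x y)) has_integral I) {p..q}"
proof -
  have "((\<lambda>x. f (Complex x y)) has_integral I) (cbox p q) \<longleftrightarrow>
          ((\<lambda>x. f (Complex ((q - p) * x + p) y)) has_integral I /\<^sub>R (q - p)) {0..1}"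
    by (subst has_integral_affinity_iff [of "q - p" _ "p", symmetric])
       (insert assms, simp_all add: field_simps)
  also have "(\<lambda>x. f (Complex ((q - p) * x + p) y)) =
      (\<lambda>x. (f (linepath (Complex p y) (Complex q y) x) * (Complex q y - Complex p y)) /\<^sub>R (q - p))"
  proof
    fix x
    have 1: "linepath (Complex p y) (Complex q y) x = Complex ((q - p) * x + p) y"
      by (simp add: linepath_def complex_eq_iff algebra_simps)
    have 2: "Complex q y - Complex p y = of_real (q - p)" by (simp add: complex_eq_iff)
    show "f (Complex ((q - p) * x + p) y) =
      (f (linepath (Complex p y) (Complex q y) x) * (Complex q y - Complex p y)) /\<^sub>R (q - p)"
      unfolding 1 2 using assms by (simp add: scaleR_conv_of_real field_simps)
  qed
  also have "(\<dots> has_integral I /\<^sub>R (q - p)) {0..1} \<longleftrightarrow>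
      (f has_contour_integral I) (linepath (Complex p y) (Complex q y))"
    using assms unfolding has_contour_integral_linepath
    by (subst has_integral_cmul_iff) auto
  finally show ?thesis by simp
qed

lemma LIMSEQ_integral_symmetric:
  fixes g :: "real \<Rightarrow> complex"
  assumes "integrable lborel g"
  shows "(\<lambda>n. integral {- real n..real n} g) \<longlonglongrightarrow> (\<integral>x. g x \<partial>lborel)"
proof -
  have "(\<lambda>n. \<integral>x. indicator {- real n..real n} x *\<^sub>R g x \<partial>lborel) \<longlonglongrightarrow> (\<integral>x. g x \<partial>lborel)"
  proof (rule integral_dominated_convergence)
    show "integrable lborel (\<lambda>x. norm (g x))" using assms by simp
    show "AE x in lborel. (\<lambda>n. indicator {- real n..real n} x *\<^sub>R g x) \<longlonglongrightarrow> g x"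
    proof (rule AE_I2)
      fix x :: real
      have "\<forall>\<^sub>F n in sequentially. \<bar>x\<bar> \<le> real n"
        by (meson eventually_sequentiallyI nle_le of_nat_mono order.trans real_nat_ceiling_ge)
      then have "\<forall>\<^sub>F n in sequentially. indicator {- real n..real n} x *\<^sub>R g x = g x"
        by eventually_elim (auto simp: indicator_def)
      then show "(\<lambda>n. indicator {- real n..real n} x *\<^sub>R g x) \<longlonglongrightarrow> g x"
        by (rule tendsto_eventually)
    qed
  qed (use assms in \<open>auto simp: indicator_def\<close>)
  moreover have "(\<integral>x. indicator {- real n..real n} x *\<^sub>R g x \<partial>lborel) = integral {- real n..real n} g" for n
  proof -
    have "set_integrable lborel {- real n..real n} g"
      using assms unfolding set_integrable_def by (intro integrable_mult_indicator) auto
    from set_borel_integral_eq_integral(2)[OF this] show ?thesis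
      by (simp add: set_lebesgue_integral_def)
  qed
  ultimately show ?thesis by simp
qed

text \<open>The residue theorem on rectangles with vertical sides at \<open>-n\<close> and
  \<open>n\<close>: the vertical sides tend to 0 by the bound \<open>B\<close>, and the horizontal
  sides tend to the two line integrals. Convexity of \<open>S\<close> makes winding numbers about
  outside points vanish. The lower line carries the plus sign because the rectangle is traversed
  counterclockwise.\<close>

lemma horizontal_line_shift:
  fixes f :: "complex \<Rightarrow> complex"
  assumes ab: "a < b" and pts: "finite pts" "pts \<subseteq> {z. a < Im z \<and> Im z < b}"
    and S: "open S" "convex S" "{z. a \<le> Im z \<and> Im z \<le> b} \<subseteq> S"
    and holo: "f holomorphic_on S - pts"
    and int: "integrable lborel (\<lambda>r. f (Complex r a))" "integrable lborel (\<lambda>r. f (Complex r b))"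
    and bd: "\<And>r y. \<bar>r\<bar> \<ge> Rb \<Longrightarrow> a \<le> y \<Longrightarrow> y \<le> b \<Longrightarrow> norm (f (Complex r y)) \<le> B \<bar>r\<bar>"
    and B: "(B \<longlongrightarrow> 0) at_top"
  shows "(\<integral>r. f (Complex r a) \<partial>lborel) - (\<integral>r. f (Complex r b) \<partial>lborel)
         = 2 * pi * \<i> * (\<Sum>p\<in>pts. residue f p)"
proof -
  obtain R1 where R1: "\<And>p. p \<in> pts \<Longrightarrow> \<bar>Re p\<bar> < R1" "R1 > 0"
  proof -
    have "\<exists>R1>0. \<forall>p\<in>pts. \<bar>Re p\<bar> < R1"
    proof (intro exI[of _ "Max (insert 0 ((\<lambda>p. \<bar>Re p\<bar>) ` pts)) + 1"] conjI ballI)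
      show "0 < Max (insert 0 ((\<lambda>p. \<bar>Re p\<bar>) ` pts)) + 1"
        using pts by (smt (verit) Max_ge finite_imageI finite_insert insertI1)
      fix p assume "p \<in> pts"
      then have "\<bar>Re p\<bar> \<le> Max (insert 0 ((\<lambda>p. \<bar>Re p\<bar>) ` pts))"
        using pts by (intro Max_ge) auto
      then show "\<bar>Re p\<bar> < Max (insert 0 ((\<lambda>p. \<bar>Re p\<bar>) ` pts)) + 1" by simp
    qed
    then show ?thesis using that by blast
  qed
  \<comment> \<open>\<open>V\<close> collects the vertical sides of the rectangle and
    \<open>L\<close> the horizontal ones.\<close>
  define V where "V = (\<lambda>n::nat. contour_integral (linepath (Complex n a) (Complex n b)) f
      + contour_integral (linepath (Complex (- n) b) (Complex (- n) a)) f)"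
  define L where "L = (\<lambda>n::nat. integral {- real n..real n} (\<lambda>r. f (Complex r a))
      - integral {- real n..real n} (\<lambda>r. f (Complex r b)))"
  have conn: "connected S" using S convex_connected by blast
  have contf: "continuous_on (S - pts) f" using holo holomorphic_on_imp_continuous_on by blast
  have main: "\<forall>\<^sub>F n in sequentially. L n + V n = 2 * pi * \<i> * (\<Sum>p\<in>pts. residue f p)
     \<and> norm (V n) \<le> 2 * (b - a) * B (real n)"
  proof -
    have "\<forall>\<^sub>F n in sequentially. real n \<ge> max Rb (max R1 1)"
      by (meson eventually_sequentiallyI nle_le of_nat_mono order.trans real_nat_ceiling_ge)
    then show ?thesis
    proof eventually_elim
      case (elim n)
      let ?R = "real n"
      let ?a1 = "Complex (- ?R) a" and ?a2 = "Complex ?R a" and ?a3 = "Complex ?R b" and ?a4 = "Complex (- ?R) b"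
      have R: "?R \<ge> Rb" "?R \<ge> R1" "?R \<ge> 1" using elim by auto
      let ?g = "rectpath ?a1 ?a3"
      have pim: "path_image ?g \<subseteq> S - pts"
      proof -
        have "path_image ?g = {z. Re z \<in> {-?R, ?R} \<and> Im z \<in> {a..b}} \<union>
           {z. Im z \<in> {a, b} \<and> Re z \<in> {-?R..?R}}"
          using path_image_rectpath[of ?a1 ?a3] R ab by simp
        then show ?thesis using S(3) pts(2) R1(1) R(2) ab by fastforce
      qed
      have wn0: "\<forall>z. z \<notin> S \<longrightarrow> winding_number ?g z = 0"
      proof (intro allI impI)
        fix z assume "z \<notin> S"
        moreover have "path_image ?g \<subseteq> S" using pim by blast
        ultimately show "winding_number ?g z = 0"
          by (intro winding_number_zero_outside[of _ S]) (auto simp: S)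
      qed
      have wn1: "winding_number ?g p = 1" if "p \<in> pts" for p
        using that R1(1)[OF that] pts(2) R by (intro winding_number_rectpath) (auto simp: in_box_complex_iff)
      have res: "contour_integral ?g f = 2 * pi * \<i> * (\<Sum>p\<in>pts. winding_number ?g p * residue f p)"
        by (rule Residue_theorem[OF S(1) conn pts(1) holo _ _ pim wn0]) auto
      have seg: "f contour_integrable_on linepath u v" if "path_image (linepath u v) \<subseteq> S - pts" for u v
        using that by (intro contour_integrable_continuous_linepath continuous_on_subset[OF contf]) auto
      have pim': "path_image ?g = path_image (linepath ?a1 ?a2) \<union> path_image (linepath ?a2 ?a3)
         \<union> path_image (linepath ?a3 ?a4) \<union> path_image (linepath ?a4 ?a1)"
        by (simp add: rectpath_def Let_def path_image_join Un_assoc)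
      have I: "f contour_integrable_on linepath ?a1 ?a2" "f contour_integrable_on linepath ?a2 ?a3"
         "f contour_integrable_on linepath ?a3 ?a4" "f contour_integrable_on linepath ?a4 ?a1"
        using pim unfolding pim' by (auto intro!: seg)
      have I4: "f contour_integrable_on linepath ?a4 ?a3"
        using I(3) by (metis contour_integrable_reversepath reversepath_linepath valid_path_linepath)
      have split: "contour_integral ?g f = contour_integral (linepath ?a1 ?a2) f + (contour_integral (linepath ?a2 ?a3) f
        + (contour_integral (linepath ?a3 ?a4) f + contour_integral (linepath ?a4 ?a1) f))"
        unfolding rectpath_def Let_def using I
        by (simp add: contour_integrable_joinI)
      have h1: "contour_integral (linepath ?a1 ?a2) f = integral {-?R..?R} (\<lambda>r. f (Complex r a))"
        using has_contour_integral_integral[OF I(1)] R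
        by (subst (asm) has_contour_integral_horizontal_linepath) (auto simp: integral_unique)
      have h2: "contour_integral (linepath ?a3 ?a4) f = - integral {-?R..?R} (\<lambda>r. f (Complex r b))"
      proof -
        have "contour_integral (linepath ?a4 ?a3) f = integral {-?R..?R} (\<lambda>r. f (Complex r b))"
          using has_contour_integral_integral[OF I4] R
          by (subst (asm) has_contour_integral_horizontal_linepath) (auto simp: integral_unique)
        then show ?thesis
          using contour_integral_reversepath[of "linepath ?a4 ?a3" f] by simp
      qed
      have segb: "\<exists>y. z = Complex x y \<and> a \<le> y \<and> y \<le> b" if "z \<in> closed_segment (Complex x a) (Complex x b)" for x z
      proof -
        have "z = Complex x (Im z)" "a \<le> Im z" "Im z \<le> b"
          using that ab by (auto simp: closed_segment_same_Re closed_segment_eq_real_ivl complex_eq_iff)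
        then show ?thesis by blast
      qed
      have Bn: "B (real n) \<ge> 0"
        using bd[of "real n" a] R ab by (smt (verit) norm_ge_zero abs_of_nat)
      have v1: "norm (contour_integral (linepath ?a2 ?a3) f) \<le> B (real n) * norm (?a3 - ?a2)"
      proof (rule contour_integral_bound_linepath[OF I(2) Bn])
        fix z assume "z \<in> closed_segment ?a2 ?a3"
        then obtain y where "z = Complex ?R y" "a \<le> y" "y \<le> b" using segb by blast
        then show "norm (f z) \<le> B (real n)" using bd[of ?R y] R by simp
      qed
      have v2: "norm (contour_integral (linepath ?a4 ?a1) f) \<le> B (real n) * norm (?a1 - ?a4)"
      proof (rule contour_integral_bound_linepath[OF I(4) Bn])
        fix z assume "z \<in> closed_segment ?a4 ?a1"
        then obtain y where "z = Complex (-?R) y" "a \<le> y" "y \<le> b"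
          using segb[of z "-?R"] by (auto simp: closed_segment_commute)
        then show "norm (f z) \<le> B (real n)" using bd[of "-?R" y] R by simp
      qed
      have n1: "norm (?a3 - ?a2) = b - a" "norm (?a1 - ?a4) = b - a"
        using ab by (auto simp: complex_norm cmod_def)
      have "norm (V n) \<le> 2 * (b - a) * B (real n)"
        unfolding V_def using v1 v2 norm_triangle_ineq[of "contour_integral (linepath ?a2 ?a3) f" "contour_integral (linepath ?a4 ?a1) f"]
        unfolding n1 by (simp add: algebra_simps)
      moreover have "L n + V n = 2 * pi * \<i> * (\<Sum>p\<in>pts. residue f p)"
        using res split wn1 unfolding L_def V_def h1 h2 by (simp add: algebra_simps)
      ultimately show ?case by blast
    qed
  qed
  have Blim: "(\<lambda>n. 2 * (b - a) * B (real n)) \<longlonglongrightarrow> 0"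
    using tendsto_mult_right_zero[OF filterlim_compose[OF B filterlim_real_sequentially]] by blast
  have V0: "V \<longlonglongrightarrow> 0"
    by (rule Lim_null_comparison[OF _ Blim]) (use main in eventually_elim, auto)
  have L1: "L \<longlonglongrightarrow> (\<integral>r. f (Complex r a) \<partial>lborel) - (\<integral>r. f (Complex r b) \<partial>lborel)"
    unfolding L_def by (intro tendsto_diff LIMSEQ_integral_symmetric int)
  have "(\<lambda>n. L n + V n) \<longlonglongrightarrow> (\<integral>r. f (Complex r a) \<partial>lborel) - (\<integral>r. f (Complex r b) \<partial>lborel)"
    using tendsto_add[OF L1 V0] by simp
  moreover have "(\<lambda>n. L n + V n) \<longlonglongrightarrow> 2 * pi * \<i> * (\<Sum>p\<in>pts. residue f p)"
    by (rule tendsto_eventually) (use main in eventually_elim, auto)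
  ultimately show ?thesis by (rule LIMSEQ_unique)
qed

text \<open>Local domination of the integrand alone is enough: Cauchy's inequality on discs of
  radius \<open>d/2\<close> turns the majorant \<open>g\<close> into the bound
  \<open>2 * g / d\<close> for the derivative, hence for the difference quotients, and dominated
  convergence applies to them.\<close>

lemma holomorphic_parameter_integral:
  fixes f :: "complex \<Rightarrow> 'a \<Rightarrow> complex"
  assumes W: "open W"
    and holo: "\<And>x. x \<in> space M \<Longrightarrow> (\<lambda>w. f w x) holomorphic_on W"
    and meas: "\<And>w. w \<in> W \<Longrightarrow> f w \<in> borel_measurable M"
    and dom: "\<And>w. w \<in> W \<Longrightarrow> \<exists>d>0. \<exists>g. integrable M g \<and> cball w d \<subseteq> W \<and>
                (\<forall>v\<in>cball w d. \<forall>x\<in>space M. norm (f v x) \<le> g x)"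
  shows "(\<lambda>w. \<integral>x. f w x \<partial>M) holomorphic_on W"
proof (rule holomorphic_onI)
  fix w assume w: "w \<in> W"
  from dom[OF w] obtain d g where d: "d > 0" and g: "integrable M g" and dW: "cball w d \<subseteq> W"
    and bd: "\<And>v x. v \<in> cball w d \<Longrightarrow> x \<in> space M \<Longrightarrow> norm (f v x) \<le> g x" by blast
  define D where "D = (\<lambda>x. deriv (\<lambda>v. f v x) w)"
  have fint: "integrable M (f v)" if "v \<in> cball w d" for v
    by (rule Bochner_Integration.integrable_bound[OF g]) (use that dW meas bd in \<open>auto intro!: AE_I2 simp: abs_of_nonneg order.trans[OF _ abs_ge_self]\<close>)
  have der: "((\<lambda>v. f v x) has_field_derivative deriv (\<lambda>v. f v x) v) (at v)"
    if "v \<in> W" "x \<in> space M" for v x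
    using holomorphic_derivI[OF holo[OF that(2)] W that(1)] .
  have lip: "norm (f v x - f w x) \<le> (2 / d * g x) * norm (v - w)" if v: "v \<in> ball w (d/2)" and x: "x \<in> space M" for v x
  proof (rule field_differentiable_bound[of "ball w (d/2)" "\<lambda>v. f v x" "deriv (\<lambda>v. f v x)"])
    fix z assume z: "z \<in> ball w (d/2)"
    have sub: "cball z (d/2) \<subseteq> cball w d"
    proof
      fix y assume "y \<in> cball z (d/2)"
      then show "y \<in> cball w d" using z dist_triangle[of w y z] by (simp add: dist_commute)
    qed
    have zW: "z \<in> W" using z dW d by (auto simp: subset_iff)
    show "((\<lambda>v. f v x) has_field_derivative deriv (\<lambda>v. f v x) z) (at z within ball w (d/2))"
      by (rule has_field_derivative_at_within[OF der[OF zW x]])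
    have h: "(\<lambda>v. f v x) holomorphic_on cball z (d/2)"
      using holo[OF x] holomorphic_on_subset sub dW by (meson order_trans)
    have "norm ((deriv ^^ 1) (\<lambda>v. f v x) z) \<le> fact 1 * g x / (d/2)^1"
    proof (rule Cauchy_inequality)
      show "(\<lambda>v. f v x) holomorphic_on ball z (d/2)" using h holomorphic_on_subset ball_subset_cball by blast
      show "continuous_on (cball z (d/2)) (\<lambda>v. f v x)" using h holomorphic_on_imp_continuous_on by blast
      fix y assume "norm (z - y) = d/2"
      then have "y \<in> cball z (d/2)" by (simp add: dist_norm)
      then show "norm (f y x) \<le> g x" using bd[OF _ x] sub by blast
    qed (use d in auto)
    then show "norm (deriv (\<lambda>v. f v x) z) \<le> 2 / d * g x" by (simp add: mult.commute)
  next
    show "convex (ball w (d / 2))" by simp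
    show "v \<in> ball w (d/2)" by (rule v)
    show "w \<in> ball w (d/2)" using d by simp
  qed
  have lim: "((\<lambda>v. ((\<integral>x. f v x \<partial>M) - (\<integral>x. f w x \<partial>M)) / (v - w)) \<longlongrightarrow> (\<integral>x. D x \<partial>M)) (at w)"
  proof (subst tendsto_at_iff_sequentially, intro allI impI, unfold o_def)
    fix X :: "nat \<Rightarrow> complex" assume X: "\<forall>i. X i \<in> UNIV - {w}" "X \<longlonglongrightarrow> w"
    have "\<forall>\<^sub>F n in sequentially. X n \<in> ball w (d/2)"
      using topological_tendstoD[OF X(2) open_ball, of w "d/2"] d by simp
    \<comment> \<open>Shifting the index by \<open>n0\<close> puts every point into the half-radius
      ball, so that the domination holds for all indices and not just eventually.\<close>
    then obtain n0 where n0: "\<And>n. n \<ge> n0 \<Longrightarrow> X n \<in> ball w (d/2)"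
      unfolding eventually_sequentially by blast
    define q where "q = (\<lambda>n x. (f (X (n + n0)) x - f w x) / (X (n + n0) - w))"
    have Xb: "X (n + n0) \<in> ball w (d/2)" for n using n0 by simp
    have Xc: "X (n + n0) \<in> cball w d" for n using Xb[of n] d by simp
    have XW: "X (n + n0) \<in> W" for n using Xc dW by blast
    have wc: "w \<in> cball w d" using d by simp
    have qlim: "(\<lambda>n. q n x) \<longlonglongrightarrow> D x" if "x \<in> space M" for x
    proof -
      have "((\<lambda>v. (f v x - f w x) / (v - w)) \<longlongrightarrow> D x) (at w)"
        using der[OF w that] unfolding D_def has_field_derivative_iff .
      then have "(\<lambda>n. (f (X n) x - f w x) / (X n - w)) \<longlonglongrightarrow> D x"
        using X by (subst (asm) tendsto_at_iff_sequentially) (auto simp: o_def)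
      then show ?thesis unfolding q_def by (rule LIMSEQ_ignore_initial_segment)
    qed
    have qm: "q n \<in> borel_measurable M" for n
    proof -
      have [measurable]: "f (X (n+n0)) \<in> borel_measurable M" "f w \<in> borel_measurable M"
        using meas XW w by auto
      show ?thesis unfolding q_def by measurable
    qed
    have "(\<lambda>n. \<integral>x. q n x \<partial>M) \<longlonglongrightarrow> (\<integral>x. D x \<partial>M)"
    proof (rule integral_dominated_convergence)
      show "D \<in> borel_measurable M" by (rule borel_measurable_LIMSEQ_metric[OF qm qlim])
      show "integrable M (\<lambda>x. 2 / d * g x)" using g by simp
      show "AE x in M. (\<lambda>n. q n x) \<longlonglongrightarrow> D x" using qlim by auto
      fix n
      show "AE x in M. norm (q n x) \<le> 2 / d * g x"
      proof (rule AE_I2)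
        fix x assume x: "x \<in> space M"
        have "X (n+n0) \<noteq> w" using X by auto
        then show "norm (q n x) \<le> 2 / d * g x"
          using lip[OF Xb[of n] x] by (simp add: q_def norm_divide pos_divide_le_eq)
      qed
    qed (use qm in auto)
    moreover have "(\<integral>x. q n x \<partial>M) = ((\<integral>x. f (X (n+n0)) x \<partial>M) - (\<integral>x. f w x \<partial>M)) / (X (n+n0) - w)" for n
      unfolding q_def using fint[OF Xc[of n]] fint[OF wc] by simp
    ultimately have "(\<lambda>n. ((\<integral>x. f (X (n+n0)) x \<partial>M) - (\<integral>x. f w x \<partial>M)) / (X (n+n0) - w)) \<longlonglongrightarrow> (\<integral>x. D x \<partial>M)"
      by simp
    then show "(\<lambda>n. ((\<integral>x. f (X n) x \<partial>M) - (\<integral>x. f w x \<partial>M)) / (X n - w)) \<longlonglongrightarrow> (\<integral>x. D x \<partial>M)"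
      by (rule LIMSEQ_offset)
  qed
  then have "((\<lambda>v. \<integral>x. f v x \<partial>M) has_field_derivative (\<integral>x. D x \<partial>M)) (at w)"
    unfolding has_field_derivative_iff .
  then show "(\<lambda>v. \<integral>x. f v x \<partial>M) field_differentiable at w within W"
    using field_differentiable_at_within field_differentiable_def by blast
qed

section \<open>The Gamma integral with a complex scale\<close>

text \<open>The Mellin weight is extended by zero to the whole line, so that Fubini and affine
  substitutions can be applied over \<open>lborel\<close> without restricting to a
  half-line.\<close>

definition Gamma_kernel :: "real \<Rightarrow> real \<Rightarrow> real" where
  "Gamma_kernel s q = indicator {0<..} q * q powr (s - 1)"

lemma Gamma_kernel_nonneg [simp]: "Gamma_kernel s q \<ge> 0"
  by (simp add: Gamma_kernel_def)

lemma Gamma_kernel_measurable [measurable]: "Gamma_kernel s \<in> borel_measurable borel"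
  unfolding Gamma_kernel_def by measurable

lemma Gamma_kernel_exp_integrable_real:
  assumes "s > 0" "a > 0"
  shows "integrable lborel (\<lambda>q. Gamma_kernel s q * exp (- a * q))"
proof -
  have "(\<lambda>t. complex_of_real t powr (of_real s - 1) / of_real (exp (a * t))) absolutely_integrable_on {0<..}"
    using absolutely_integrable_Gamma_integral[of "of_real s" a] assms by simp
  then have "integrable lebesgue (\<lambda>x. norm (indicator {0<..} x *\<^sub>R (complex_of_real x powr (of_real s - 1) / of_real (exp (a * x)))))"
    unfolding set_integrable_def by (rule integrable_norm)
  also have "(\<lambda>x. norm (indicator {0<..} x *\<^sub>R (complex_of_real x powr (of_real s - 1) / of_real (exp (a * x)))))
     = (\<lambda>q. Gamma_kernel s q * exp (- a * q))"
    by (auto simp: fun_eq_iff Gamma_kernel_def indicator_def norm_divide norm_powr_real_powr exp_minus field_simps)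
  finally show ?thesis by (subst (asm) integrable_completion) auto
qed

lemma Gamma_kernel_exp_integral_real:
  assumes "s > 0" "a > 0"
  shows "(\<integral>q. Gamma_kernel s q * exp (- a * q) \<partial>lborel) = Gamma s * a powr (-s)"
proof -
  have i1: "integrable lborel (\<lambda>q. Gamma_kernel s q * exp (- q))"
    using Gamma_kernel_exp_integrable_real[OF assms(1), of 1] by simp
  have "set_integrable lborel {0<..} (\<lambda>t. t powr (s - 1) / exp t)"
    unfolding set_integrable_def using i1
    by (rule Bochner_Integration.integrable_cong[THEN iffD1, rotated 2])
       (auto simp: Gamma_kernel_def exp_minus field_simps)
  from set_borel_integral_eq_integral(2)[OF this]
  have "(\<integral>q. Gamma_kernel s q * exp (- q) \<partial>lborel) = integral {0<..} (\<lambda>t. t powr (s - 1) / exp t)"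
    by (simp add: set_lebesgue_integral_def Gamma_kernel_def exp_minus field_simps)
  also have "\<dots> = integral {0..} (\<lambda>t. t powr (s - 1) / exp t)"
    by (rule integral_spike_set; rule negligible_subset[OF negligible_sing[of 0]]) auto
  also have "\<dots> = Gamma s" using Gamma_integral_real[OF assms(1)] by (rule integral_unique)
  finally have G: "(\<integral>q. Gamma_kernel s q * exp (- q) \<partial>lborel) = Gamma s" .
  have "Gamma s = a * (\<integral>q. Gamma_kernel s (a * q) * exp (- (a * q)) \<partial>lborel)"
    unfolding G[symmetric] using assms
    by (subst lborel_integral_real_affine[of a _ 0]) (simp_all add: less_imp_neq)
  also have "(\<lambda>q. Gamma_kernel s (a * q) * exp (- (a * q))) = (\<lambda>q. a powr (s - 1) * (Gamma_kernel s q * exp (- a * q)))"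
    using assms by (auto simp: fun_eq_iff Gamma_kernel_def indicator_def powr_mult zero_less_mult_iff)
  finally have "Gamma s = a * a powr (s - 1) * (\<integral>q. Gamma_kernel s q * exp (- a * q) \<partial>lborel)"
    by simp
  moreover have "a * a powr (s - 1) = a powr s" using assms by (simp add: powr_diff)
  ultimately show ?thesis using assms by (simp add: powr_minus field_simps)
qed

lemma Gamma_kernel_exp_integrable:
  assumes "s > 0" "Re a > 0"
  shows "integrable lborel (\<lambda>q. of_real (Gamma_kernel s q) * exp (- a * of_real q))"
proof (rule Bochner_Integration.integrable_bound[OF Gamma_kernel_exp_integrable_real[OF assms]])
  show "AE x in lborel. norm (of_real (Gamma_kernel s x) * exp (- a * of_real x)) \<le> norm (Gamma_kernel s x * exp (- Re a * x))"
    by (auto simp: norm_mult norm_exp_eq_Re abs_mult)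
qed measurable

text \<open>Both sides are holomorphic in \<open>a\<close> on the right half-plane and agree for
  positive real \<open>a\<close>. The complex scale is needed because the exponentials met later
  decay along directions rotated by \<open>e8\<close>.\<close>

lemma Gamma_kernel_exp_integral:
  assumes s: "s > 0" and a: "Re a > 0"
  shows "(\<integral>q. of_real (Gamma_kernel s q) * exp (- a * of_real q) \<partial>lborel) = Gamma (of_real s) * a powr (- of_real s)"
proof -
  let ?W = "{w. Re w > 0}"
  let ?F = "\<lambda>a. \<integral>q. of_real (Gamma_kernel s q) * exp (- a * of_real q) \<partial>lborel"
  let ?G = "\<lambda>a. Gamma (of_real s) * a powr (- of_real s)"
  have W: "open ?W" "connected ?W"
    using open_halfspace_Re_gt convex_halfspace_Re_gt convex_connected by blast+
  have hF: "?F holomorphic_on ?W"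
  proof (rule holomorphic_parameter_integral[OF W(1)])
    fix w assume w: "w \<in> ?W"
    define d where "d = Re w / 2"
    have d: "d > 0" using w by (simp add: d_def)
    have Rv: "Re v \<ge> d" if "v \<in> cball w d" for v
    proof -
      have "Re w - Re v \<le> d" using that abs_Re_le_cmod[of "w - v"] by (simp add: dist_norm)
      then show ?thesis by (simp add: d_def)
    qed
    show "\<exists>d>0. \<exists>g. integrable lborel g \<and> cball w d \<subseteq> ?W \<and>
       (\<forall>v\<in>cball w d. \<forall>x\<in>space lborel. norm (of_real (Gamma_kernel s x) * exp (- v * of_real x)) \<le> g x)"
    proof (intro exI[of _ d] exI[of _ "\<lambda>q. Gamma_kernel s q * exp (- d * q)"] conjI ballI d)
      show "integrable lborel (\<lambda>q. Gamma_kernel s q * exp (- d * q))"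
        by (rule Gamma_kernel_exp_integrable_real[OF s d])
      show "cball w d \<subseteq> ?W" using Rv d by fastforce
      fix v x assume v: "v \<in> cball w d"
      show "norm (of_real (Gamma_kernel s x) * exp (- v * of_real x)) \<le> Gamma_kernel s x * exp (- d * x)"
      proof (cases "x > 0")
        case True
        then show ?thesis using Rv[OF v]
          by (auto simp: norm_mult norm_exp_eq_Re intro!: mult_left_mono)
      qed (simp add: Gamma_kernel_def)
    qed
  qed (auto intro!: holomorphic_intros)
  have hG: "?G holomorphic_on ?W"
    by (intro holomorphic_intros) (auto simp: complex_nonpos_Reals_iff)
  have "?F a - ?G a = 0"
  proof (rule analytic_continuation[of "\<lambda>a. ?F a - ?G a" ?W "complex_of_real ` {0<..}" 1])
    show "(\<lambda>a. ?F a - ?G a) holomorphic_on ?W" by (intro holomorphic_on_diff hF hG)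
    show "1 islimpt complex_of_real ` {0<..}"
    proof -
      have "(1::real) islimpt {0<..}"
        by (rule interior_limit_point) (simp add: interior_open)
      then obtain f where f: "\<forall>n. f n \<in> {0<..} - {1::real}" "f \<longlonglongrightarrow> 1"
        unfolding islimpt_sequential by blast
      show ?thesis unfolding islimpt_sequential
        using f by (intro exI[of _ "\<lambda>n. complex_of_real (f n)"]) (auto intro!: tendsto_eq_intros)
    qed
    fix z assume "z \<in> complex_of_real ` {0<..}"
    then obtain x where x: "z = of_real x" "x > 0" by auto
    have "?F z = of_real (\<integral>q. Gamma_kernel s q * exp (- x * q) \<partial>lborel)"
      unfolding integral_complex_of_real[symmetric] x by (simp add: exp_of_real[symmetric])
    also have "\<dots> = ?G z"
      unfolding Gamma_kernel_exp_integral_real[OF s x(2)] x(1) using x s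
      by (simp add: Gamma_complex_of_real powr_of_real[symmetric])
    finally show "?F z - ?G z = 0" by simp
  qed (use a W in auto)
  then show ?thesis by simp
qed

section \<open>Integrals over slanted lines\<close>

text \<open>The primitive eighth root of unity with \<open>e8 ^ 2 = \<i>\<close>: along this
  direction \<open>exp (\<i> * pi * x^2)\<close> becomes the real Gaussian
  \<open>exp (- pi * r^2)\<close>.\<close>

definition e8 :: complex where "e8 = cis (pi / 4)"

text \<open>The parameter \<open>r\<close> is arc length, and \<open>Re x - Im x\<close> recovers
  the crossing point \<open>c\<close>; regions between two such lines are therefore written as
  conditions on \<open>Re x - Im x\<close>.\<close>

definition slant :: "real \<Rightarrow> real \<Rightarrow> complex" where
  "slant c r = of_real c + e8 * of_real r"

lemma e8_eq: "e8 = Complex (1 / sqrt 2) (1 / sqrt 2)"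
  by (simp add: e8_def complex_eq_iff cos_45 sin_45 real_div_sqrt field_simps)

lemma norm_e8 [simp]: "norm e8 = 1" by (simp add: e8_def)
lemma e8_nz [simp]: "e8 \<noteq> 0" by (metis norm_e8 norm_zero zero_neq_one)
lemma e8_sq: "e8 ^ 2 = \<i>" "e8 * e8 = \<i>" by (simp_all add: e8_def DeMoivre power2_eq_square cis_mult)

lemma Re_slant: "Re (slant c r) = c + r / sqrt 2" and Im_slant: "Im (slant c r) = r / sqrt 2"
  by (simp_all add: slant_def e8_eq)

lemma slant_surj: "z = slant (Re z - Im z) (sqrt 2 * Im z)"
  by (simp add: complex_eq_iff Re_slant Im_slant)

lemma norm_slant_le: "norm (slant c r) \<le> \<bar>c\<bar> + \<bar>r\<bar>"
  unfolding slant_def by (rule norm_triangle_le) (simp add: norm_mult)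

lemma norm_slant_sq: "(norm (slant c r))^2 = c^2 + sqrt 2 * c * r + r^2"
  unfolding cmod_power2 Re_slant Im_slant by (simp add: power2_eq_square field_simps)

text \<open>The right-hand side is the distance from the origin to the line.\<close>

lemma norm_slant_ge: "norm (slant c r) \<ge> \<bar>c\<bar> / sqrt 2"
proof -
  have "(\<bar>c\<bar> / sqrt 2)^2 \<le> (norm (slant c r))^2"
    unfolding norm_slant_sq using zero_le_power2[of "r + c / sqrt 2"]
    by (simp add: power2_eq_square field_simps)
  then show ?thesis by (rule power2_le_imp_le) simp
qed

lemma slant_measurable [measurable]: "slant c \<in> borel_measurable borel"
  unfolding slant_def by measurable

lemma slant_add: "slant c r + slant d q = slant (c + d) (r + q)"
  by (simp add: slant_def algebra_simps)

lemma integrable_exp_neg_abs: "integrable lborel (\<lambda>r::real. exp (- \<bar>r\<bar>))"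
proof -
  have 1: "integrable lborel (\<lambda>q. Gamma_kernel 1 q * exp (- q))"
    using Gamma_kernel_exp_integrable_real[of 1 1] by simp
  have 2: "integrable lborel (\<lambda>q. Gamma_kernel 1 (- q) * exp q)"
    using lborel_integrable_real_affine[OF 1, of "-1" 0] by simp
  show ?thesis
  proof (rule Bochner_Integration.integrable_bound[OF Bochner_Integration.integrable_add[OF 1 2]])
    have "AE r in lborel. r \<noteq> (0::real)" by (rule AE_lborel_singleton)
    then show "AE r in lborel. norm (exp (- \<bar>r\<bar>)) \<le> norm (Gamma_kernel 1 r * exp (- r) + Gamma_kernel 1 (- r) * exp r)"
      by eventually_elim (auto simp: Gamma_kernel_def indicator_def abs_if)
  qed measurable
qed

text \<open>From \<open>(\<alpha> + 1) * \<bar>r\<bar> \<le> (\<alpha> + 1)^2 + r^2\<close> and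
  \<open>pi \<ge> 1\<close>. The \<open>- \<bar>r\<bar>\<close> kept on the right supplies the
  integrable majorant \<open>exp (- \<bar>r\<bar>)\<close> up to a constant depending on \<alpha>
  only.\<close>

lemma quadratic_le: "\<alpha> * \<bar>r\<bar> - pi * r^2 \<le> (\<alpha> + 1)^2 - \<bar>r\<bar>" for r :: real
proof -
  have "(\<alpha> + 1) * \<bar>r\<bar> \<le> (\<alpha>+1)^2 + \<bar>r\<bar>^2"
    using zero_le_power2[of "\<bar>r\<bar> - (\<alpha>+1)"] zero_le_power2[of "\<bar>r\<bar>"] zero_le_power2[of "\<alpha>+1"]
    unfolding power2_eq_square by (simp only: algebra_simps)
  moreover have "r^2 \<le> pi * r^2" using pi_ge_two by (simp add: mult_le_cancel_right1)
  ultimately show ?thesis by (simp add: algebra_simps)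
qed

lemma integrable_exp_quadratic: "integrable lborel (\<lambda>r::real. exp (\<alpha> * \<bar>r\<bar> - pi * r^2))"
proof -
  have "integrable lborel (\<lambda>r::real. exp ((\<alpha> + 1)^2) * exp (- \<bar>r\<bar>))"
    using integrable_exp_neg_abs by simp
  then show ?thesis
  proof (rule Bochner_Integration.integrable_bound)
    show "AE r in lborel. norm (exp (\<alpha> * \<bar>r\<bar> - pi * r^2)) \<le> norm (exp ((\<alpha> + 1)^2) * exp (- \<bar>r\<bar>))"
      using quadratic_le[of \<alpha>] by (simp add: exp_add[symmetric])
  qed measurable
qed

definition gauss :: "complex \<Rightarrow> complex" where
  "gauss x = exp (\<i> * pi * x ^ 2)"

lemma norm_gauss_slant: "norm (gauss (slant c r)) = exp (- pi * (r^2 + sqrt 2 * c * r))"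
proof -
  have "Re (\<i> * complex_of_real pi * (slant c r)^2) = - pi * (2 * (c + r / sqrt 2) * (r / sqrt 2))"
    by (simp add: power2_eq_square Re_slant Im_slant)
  also have "2 * (c + r / sqrt 2) * (r / sqrt 2) = r^2 + sqrt 2 * c * r"
    by (simp add: power2_eq_square field_simps)
  finally show ?thesis by (simp add: gauss_def norm_exp_eq_Re)
qed

lemma norm_gauss_slant_le: "norm (gauss (slant c r)) \<le> exp (5 * \<bar>c\<bar> * \<bar>r\<bar> - pi * r^2)"
proof -
  have s2: "sqrt 2 \<le> (1.5 :: real)" by (rule real_le_lsqrt) (auto simp: power2_eq_square)
  \<comment> \<open>Origin of the constant 5 in the statement: \<open>pi * sqrt 2\<close> is at most
    4.8.\<close>
  have "pi * sqrt 2 \<le> 3.2 * 1.5"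
    by (intro mult_mono s2) (use pi_approx in auto)
  then have "pi * sqrt 2 * \<bar>c * r\<bar> \<le> 5 * \<bar>c * r\<bar>" by (intro mult_right_mono) auto
  moreover have "- (pi * sqrt 2) * (c * r) \<le> pi * sqrt 2 * \<bar>c * r\<bar>"
    using mult_left_mono[of "- (c*r)" "\<bar>c*r\<bar>" "pi * sqrt 2"] by simp
  ultimately show ?thesis unfolding norm_gauss_slant by (simp add: abs_mult algebra_simps)
qed

text \<open>Since \<open>n^2\<close> and \<open>n\<close> have the same parity. This sign cancels
  the one of \<open>cos (pi * n)\<close> in the residue of the integrand at
  \<open>n\<close>.\<close>

lemma gauss_of_nat: "gauss (of_nat n) = (-1) ^ n"
proof -
  have "gauss (of_nat n) = exp (of_nat (n^2) * (\<i> * pi))" by (simp add: gauss_def mult_ac)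
  also have "\<dots> = (-1) ^ (n^2)" by (subst exp_of_nat_mult) simp
  also have "\<dots> = (-1) ^ n" by (cases "even n") (auto simp: power2_eq_square)
  finally show ?thesis .
qed

text \<open>Multiplication by \<open>e8\<close> carries horizontal lines to slanted ones, which
  reduces the claim to \<open>horizontal_line_shift\<close>. A larger crossing point corresponds to
  a lower horizontal line, hence the order of the two integrals. The bounds \<open>lo\<close> and
  \<open>hi\<close> provide an open neighbourhood of the closed strip.\<close>

lemma slanted_line_shift:
  fixes f :: "complex \<Rightarrow> complex"
  assumes c: "lo < c1" "c1 < c2" "c2 < hi"
    and P: "finite P" "P \<subseteq> {c1<..<c2}"
    and holo: "f holomorphic_on {x. lo < Re x - Im x \<and> Re x - Im x < hi} - of_real ` P"
    and int: "integrable lborel (\<lambda>r. f (slant c1 r))" "integrable lborel (\<lambda>r. f (slant c2 r))"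
    and bd: "\<And>r c. \<bar>r\<bar> \<ge> Rb \<Longrightarrow> c1 \<le> c \<Longrightarrow> c \<le> c2 \<Longrightarrow> norm (f (slant c r)) \<le> K / \<bar>r\<bar>"
    and res: "\<And>p. p \<in> P \<Longrightarrow> ((\<lambda>x. f x * (x - of_real p)) \<longlongrightarrow> rs p) (at (of_real p))"
  shows "e8 * (\<integral>r. f (slant c2 r) \<partial>lborel) - e8 * (\<integral>r. f (slant c1 r) \<partial>lborel) = 2 * pi * \<i> * (\<Sum>p\<in>P. rs p)"
proof -
  define g where "g = (\<lambda>z. f (e8 * z))"
  \<comment> \<open>The horizontal line at height \<open>- c / sqrt 2\<close> becomes the line
    through \<open>c\<close>. The parameter is displaced by \<open>- c / sqrt 2\<close> because its
    origin is now the foot of the perpendicular from 0.\<close>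
  have slC: "e8 * Complex r (- c / sqrt 2) = slant c (r - c / sqrt 2)" for r c
    by (simp add: slant_def e8_eq complex_eq_iff field_simps)
  have cc: "Re (e8 * z) - Im (e8 * z) = - sqrt 2 * Im z" for z
    by (simp add: e8_eq field_simps)
  define S where "S = {z. - hi / sqrt 2 < Im z \<and> Im z < - lo / sqrt 2}"
  define pts where "pts = (\<lambda>p. of_real p / e8) ` P"
  have S_iff: "z \<in> S \<longleftrightarrow> e8 * z \<in> {x. lo < Re x - Im x \<and> Re x - Im x < hi}" for z
    unfolding S_def mem_Collect_eq cc by (auto simp: field_simps)
  have S_eq: "S = {z. - hi / sqrt 2 < Im z} \<inter> {z. Im z < - lo / sqrt 2}" unfolding S_def by auto
  have "open S" "convex S" unfolding S_eq
    by (intro open_Int convex_Int open_halfspace_Im_gt open_halfspace_Im_lt convex_halfspace_Im_gt convex_halfspace_Im_lt)+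
  have Im_p: "Im (of_real p / e8) = - p / sqrt 2" for p
    using cc[of "of_real p / e8"] by (simp add: field_simps)
  have g_holo: "g holomorphic_on S - pts"
  proof -
    have "(f \<circ> (\<lambda>z. e8 * z)) holomorphic_on S - pts"
    proof (rule holomorphic_on_compose)
      show "(*) e8 holomorphic_on S - pts" by (intro holomorphic_intros)
      have "(*) e8 ` (S - pts) \<subseteq> {x. lo < Re x - Im x \<and> Re x - Im x < hi} - of_real ` P"
        using S_iff by (auto simp: pts_def image_iff field_simps)
      then show "f holomorphic_on (*) e8 ` (S - pts)" using holo holomorphic_on_subset by blast
    qed
    then show ?thesis by (simp add: g_def o_def)
  qed
  have shift: "(\<integral>r. g (Complex r (- c / sqrt 2)) \<partial>lborel) = (\<integral>r. f (slant c r) \<partial>lborel)" for c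
    unfolding g_def slC by (subst lborel_integral_real_affine[of 1 _ "- (c / sqrt 2)"]) (auto simp: algebra_simps)
  have "(\<integral>r. g (Complex r (- c2 / sqrt 2)) \<partial>lborel) - (\<integral>r. g (Complex r (- c1 / sqrt 2)) \<partial>lborel)
         = 2 * pi * \<i> * (\<Sum>p\<in>pts. residue g p)"
  proof (rule horizontal_line_shift[where S = S and Rb = "max (\<bar>Rb\<bar> + \<bar>c1\<bar> + \<bar>c2\<bar>) (2 * \<bar>c1\<bar> + 2 * \<bar>c2\<bar> + 1)" and B = "\<lambda>r. 2 * \<bar>K\<bar> / r"])
    show "- c2 / sqrt 2 < - c1 / sqrt 2" using c by (simp add: divide_strict_right_mono)
    show "finite pts" using P by (simp add: pts_def)
    show "pts \<subseteq> {z. - c2 / sqrt 2 < Im z \<and> Im z < - c1 / sqrt 2}"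
      using P(2) by (auto simp: pts_def Im_p divide_strict_right_mono)
    show "{z. - c2 / sqrt 2 \<le> Im z \<and> Im z \<le> - c1 / sqrt 2} \<subseteq> S"
      using c unfolding S_def by (auto simp: field_simps)
    show "g holomorphic_on S - pts" by (rule g_holo)
    have ig: "integrable lborel (\<lambda>r. g (Complex r (- c / sqrt 2)))" if "integrable lborel (\<lambda>r. f (slant c r))" for c
      using lborel_integrable_real_affine[OF that, of 1 "- (c / sqrt 2)"] unfolding g_def slC by (simp add: algebra_simps)
    show "integrable lborel (\<lambda>r. g (Complex r (- c2 / sqrt 2)))" "integrable lborel (\<lambda>r. g (Complex r (- c1 / sqrt 2)))"
      using ig int by auto
    show "((\<lambda>r. 2 * \<bar>K\<bar> / r) \<longlongrightarrow> 0) at_top"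
      by (intro tendsto_divide_0[OF tendsto_const] filterlim_at_top_imp_at_infinity filterlim_ident)
    fix r y assume r: "max (\<bar>Rb\<bar> + \<bar>c1\<bar> + \<bar>c2\<bar>) (2 * \<bar>c1\<bar> + 2 * \<bar>c2\<bar> + 1) \<le> \<bar>r\<bar>"
      and y: "- c2 / sqrt 2 \<le> y" "y \<le> - c1 / sqrt 2"
    define c where "c = - sqrt 2 * y"
    have yc: "y = - c / sqrt 2" by (simp add: c_def)
    have cb: "c1 \<le> c" "c \<le> c2" using y unfolding yc by (simp_all add: field_simps)
    have sq: "1 \<le> sqrt (2::real)" by simp
    have ca: "\<bar>c / sqrt 2\<bar> \<le> \<bar>c1\<bar> + \<bar>c2\<bar>"
    proof -
      have "\<bar>c\<bar> / sqrt 2 \<le> \<bar>c\<bar> / 1" using sq by (intro divide_left_mono) auto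
      then have "\<bar>c / sqrt 2\<bar> \<le> \<bar>c\<bar>" by simp
      also have "\<dots> \<le> \<bar>c1\<bar> + \<bar>c2\<bar>" using cb by linarith
      finally show ?thesis .
    qed
    \<comment> \<open>Beyond the chosen threshold the displacement of the parameter is at most half
      of \<open>\<bar>r\<bar>\<close>; this is the factor 2 in the bound
      \<open>2 * \<bar>K\<bar> / r\<close>.\<close>
    have "\<bar>r - c / sqrt 2\<bar> \<ge> \<bar>r\<bar> - \<bar>c / sqrt 2\<bar>" by linarith
    then have r1: "\<bar>r - c / sqrt 2\<bar> \<ge> Rb" "\<bar>r - c / sqrt 2\<bar> \<ge> \<bar>r\<bar> / 2" and r2: "\<bar>r\<bar> > 0" and r3: "\<bar>r - c / sqrt 2\<bar> > 0"
      using r ca by linarith+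
    have "norm (g (Complex r y)) \<le> K / \<bar>r - c / sqrt 2\<bar>"
      unfolding g_def yc slC using bd[OF r1(1) cb] .
    also have "\<dots> \<le> \<bar>K\<bar> / \<bar>r - c / sqrt 2\<bar>" by (intro divide_right_mono) auto
    also have "\<dots> \<le> \<bar>K\<bar> / (\<bar>r\<bar> / 2)" using r1 r2 r3 by (intro divide_left_mono mult_pos_pos) auto
    finally show "norm (g (Complex r y)) \<le> 2 * \<bar>K\<bar> / \<bar>r\<bar>" by (simp add: mult.commute)
  qed (auto simp: \<open>open S\<close> \<open>convex S\<close>)
  also have "(\<Sum>p\<in>pts. residue g p) = (\<Sum>p\<in>P. rs p / e8)"
  proof -
    have inj: "inj_on (\<lambda>p. complex_of_real p / e8) P" by (auto simp: inj_on_def)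
    have "residue g (of_real p / e8) = rs p / e8" if p: "p \<in> P" for p
    proof -
      have "(((\<lambda>x. f x * (x - of_real p)) \<circ> (\<lambda>z. e8 * z)) \<longlongrightarrow> rs p) (at (of_real p / e8))"
        unfolding o_def
        by (rule filterlim_compose[OF res[OF p]])
           (auto simp: filterlim_at eventually_at_filter field_simps intro!: tendsto_eq_intros)
      then have "((\<lambda>z. f (e8 * z) * (e8 * z - of_real p) / e8) \<longlongrightarrow> rs p / e8) (at (of_real p / e8))"
        unfolding o_def by (intro tendsto_intros) auto
      also have "(\<lambda>z. f (e8 * z) * (e8 * z - of_real p) / e8) = (\<lambda>z. g z * (z - of_real p / e8))"
        by (auto simp: g_def field_simps)
      finally have lim: "((\<lambda>z. g z * (z - of_real p / e8)) \<longlongrightarrow> rs p / e8) (at (of_real p / e8))" .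
      have pS: "of_real p / e8 \<in> S" using P(2) p c by (auto simp: S_def Im_p divide_strict_right_mono)
      have fin: "finite (pts - {of_real p / e8})" using P by (simp add: pts_def)
      have o: "open (S - (pts - {of_real p / e8}))" using \<open>open S\<close> finite_imp_closed[OF fin] by (rule open_Diff)
      have "g holomorphic_on (S - (pts - {of_real p / e8})) - {of_real p / e8}"
        by (rule holomorphic_on_subset[OF g_holo]) auto
      from residue_simple'[OF o _ this lim] pS show ?thesis by simp
    qed
    then show ?thesis unfolding pts_def by (subst sum.reindex[OF inj]) auto
  qed
  finally have "(\<integral>r. f (slant c2 r) \<partial>lborel) - (\<integral>r. f (slant c1 r) \<partial>lborel) = 2 * pi * \<i> * (\<Sum>p\<in>P. rs p / e8)"
    unfolding shift .
  then have "e8 * ((\<integral>r. f (slant c2 r) \<partial>lborel) - (\<integral>r. f (slant c1 r) \<partial>lborel)) = e8 * (2 * pi * \<i> * (\<Sum>p\<in>P. rs p / e8))"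
    by simp
  also have "\<dots> = 2 * pi * \<i> * (\<Sum>p\<in>P. rs p)"
    by (simp add: sum_divide_distrib[symmetric])
  finally show ?thesis by (simp add: algebra_simps)
qed

section \<open>Lower bounds for the sine on slanted lines\<close>

lemma norm_sin_ge_Im: "norm (sin z) \<ge> \<bar>Im z\<bar> / 2" for z :: complex
proof -
  have *: "y / 2 \<le> (exp y - exp (- y)) / 2" if "y \<ge> 0" for y :: real
  proof -
    have "exp y \<ge> 1 + y" by simp
    moreover have "exp (- y) \<le> 1" using that by simp
    ultimately have "y \<le> exp y - exp (- y)" by linarith
    then show ?thesis by simp
  qed
  let ?y = "\<bar>Im z\<bar>"
  \<comment> \<open>The right-hand side is the square of \<open>sinh ?y\<close>, which minorises
    \<open>norm (sin z) ^ 2\<close>.\<close>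
  have "(?y / 2)^2 \<le> ((exp ?y - exp (- ?y)) / 2)^2"
    using *[of ?y] by (intro power_mono) auto
  also have "\<dots> = (exp (2 * ?y) + exp (- (2 * ?y)) - 2) / 4"
    by (simp add: power2_eq_square algebra_simps exp_add[symmetric] exp_minus[symmetric])
  also have "\<dots> = (exp (2 * Im z) + inverse (exp (2 * Im z)) - 2) / 4"
    by (auto simp: abs_if exp_minus)
  also have "\<dots> \<le> norm (sin z) ^ 2"
    unfolding norm_sin_squared using cos_le_one[of "2 * Re z"] by simp
  finally show ?thesis by (rule power2_le_imp_le) simp
qed

lemma norm_sin_slant_far: "norm (sin (of_real pi * slant c r)) \<ge> \<bar>r\<bar>"
proof -
  have "sqrt 2 \<le> (1.5 :: real)" by (rule real_le_lsqrt) (auto simp: power2_eq_square)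
  then have "1 \<le> pi / sqrt 2 / 2" using pi_gt3 by (simp add: field_simps)
  then have "1 * \<bar>r\<bar> \<le> (pi / sqrt 2 / 2) * \<bar>r\<bar>" by (intro mult_right_mono) auto
  also have "\<dots> = \<bar>Im (pi * slant c r)\<bar> / 2" by (simp add: Im_slant abs_mult)
  also have "\<dots> \<le> norm (sin (of_real pi * slant c r))" by (rule norm_sin_ge_Im)
  finally show ?thesis by simp
qed

text \<open>The quotient \<open>sin (pi * z) / z\<close>, with its removable singularity filled in,
  is continuous and has no zero on the compact set of points with \<open>0 \<le> c \<le> 3/4\<close>
  and \<open>\<bar>r\<bar> \<le> 1\<close>; farther out the growth of the sine with the imaginary
  part suffices. The bound is proportional to \<open>norm (slant c r)\<close> so that it stays valid
  as the line approaches the zero at the origin.\<close>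

lemma sin_slant_lower:
  "\<exists>\<kappa>>0. \<forall>c\<in>{0..3/4}. \<forall>r. \<kappa> * norm (slant c r) \<le> norm (sin (of_real pi * slant c r))"
proof -
  define f where "f = (\<lambda>z::complex. if z = 0 then of_real pi else sin (of_real pi * z) / z)"
  define K where "K = (\<lambda>(c, r). slant c r) ` ({0..3/4} \<times> {-1..1})"
  have "compact K" unfolding K_def slant_def
    by (intro compact_continuous_image compact_Times) (auto intro!: continuous_intros simp: case_prod_unfold)
  moreover have "continuous_on UNIV f"
  proof -
    have "isCont f z" for z
    proof (cases "z = 0")
      case True
      have "((\<lambda>z::complex. sin (of_real pi * z)) has_field_derivative pi) (at 0)"
        by (auto intro!: derivative_eq_intros)
      then have "((\<lambda>z::complex. sin (of_real pi * z) / z) \<longlongrightarrow> pi) (at 0)"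
        by (simp add: has_field_derivative_iff)
      then have "(f \<longlongrightarrow> pi) (at 0)"
        by (rule Lim_transform_eventually) (auto simp: f_def eventually_at_filter)
      then show ?thesis unfolding isCont_def True by (simp add: f_def)
    next
      case False
      have "\<forall>\<^sub>F w in nhds z. sin (of_real pi * w) / w = f w"
        using t1_space_nhds[OF False] by eventually_elim (auto simp: f_def)
      moreover have "isCont (\<lambda>w. sin (of_real pi * w) / w) z" using False by (intro continuous_intros) auto
      ultimately show ?thesis using isCont_cong by (metis (mono_tags, lifting) eventually_mono)
    qed
    then show ?thesis by (simp add: continuous_on_eq_continuous_at)
  qed
  moreover have "K \<noteq> {}" by (auto simp: K_def)
  ultimately obtain z0 where z0: "z0 \<in> K" "\<And>z. z \<in> K \<Longrightarrow> norm (f z0) \<le> norm (f z)"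
    using continuous_attains_inf[of K "\<lambda>z. norm (f z)"]
    by (metis continuous_on_norm continuous_on_subset subset_UNIV)
  have "f z0 \<noteq> 0"
  proof
    assume 0: "f z0 = 0"
    from z0(1) obtain c r where cr: "c \<in> {0..3/4}" "r \<in> {-1..1}" "z0 = slant c r" by (auto simp: K_def)
    from 0 have "z0 \<noteq> 0" "sin (of_real pi * z0) = 0" by (auto simp: f_def split: if_splits)
    then have "r = 0" using norm_sin_slant_far[of r c] cr by simp
    then have "sin (pi * c) = 0" "c \<noteq> 0"
      using \<open>sin (of_real pi * z0) = 0\<close> \<open>z0 \<noteq> 0\<close> cr(3)
      by (auto simp: slant_def sin_of_real simp flip: of_real_mult)
    then show False using sin_gt_zero[of "pi * c"] cr(1) by auto
  qed
  \<comment> \<open>The cap 1/2 serves \<open>\<bar>r\<bar> > 1\<close>, where the point has norm at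
    most \<open>2 * \<bar>r\<bar>\<close> while the sine is at least
    \<open>\<bar>r\<bar>\<close>.\<close>
  define \<kappa> where "\<kappa> = min (norm (f z0)) (1/2)"
  have "\<kappa> > 0" using \<open>f z0 \<noteq> 0\<close> by (simp add: \<kappa>_def)
  moreover have "\<kappa> * norm (slant c r) \<le> norm (sin (of_real pi * slant c r))" if c: "c \<in> {0..3/4}" for c r
  proof (cases "\<bar>r\<bar> \<le> 1")
    case True
    then have "slant c r \<in> K" using c unfolding K_def by (intro image_eqI[of _ _ "(c, r)"]) auto
    then have "\<kappa> \<le> norm (f (slant c r))" using z0(2) unfolding \<kappa>_def by (meson min.coboundedI1)
    then show ?thesis by (cases "slant c r = 0") (auto simp: f_def norm_divide field_simps)
  next
    case False
    have "norm (slant c r) \<le> 2 * \<bar>r\<bar>" using norm_slant_le[of c r] c False by auto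
    moreover have "\<kappa> \<le> 1/2" by (simp add: \<kappa>_def)
    ultimately have "\<kappa> * norm (slant c r) \<le> 1/2 * (2 * \<bar>r\<bar>)" by (intro mult_mono) auto
    also have "\<dots> \<le> norm (sin (of_real pi * slant c r))" using norm_sin_slant_far[of r c] by simp
    finally show ?thesis .
  qed
  ultimately show ?thesis by blast
qed

lemma norm_sin_slant_shift: "norm (sin (of_real pi * slant (real N + c) r)) = norm (sin (of_real pi * slant c r))"
proof -
  have "sin (of_real pi * slant (real N + c) r) = sin (of_real pi * slant c r + of_nat N * of_real pi)"
    by (simp add: slant_def algebra_simps)
  also have "\<dots> = (-1)^N * sin (of_real pi * slant c r)"
    by (induction N) (auto simp: algebra_simps sin_add)
  finally show ?thesis by (simp add: norm_mult norm_power)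
qed

text \<open>A quantitative form of the line avoiding every pole of \<open>1 / sin (pi * x)\<close>.
  The constant is a parameter because the remainder estimate needs one value for all positions of
  the line.\<close>

definition line_bound :: "real \<Rightarrow> real \<Rightarrow> bool" where
  "line_bound c \<kappa> \<longleftrightarrow> \<kappa> > 0 \<and> (\<forall>r. \<kappa> \<le> norm (sin (of_real pi * slant c r)))"

text \<open>The modulus of the sine has period 1 in the crossing point, so only the fractional part
  matters, and in the middle half of the unit interval the line keeps a fixed distance from the
  origin.\<close>

lemma line_bound_uniform:
  "\<exists>\<kappa>>0. \<forall>N::nat. \<forall>\<theta>\<in>{1/4..3/4}. line_bound (real N + \<theta>) \<kappa>"
proof -
  obtain \<kappa> where k: "\<kappa> > 0" "\<And>c r. c \<in> {0..3/4} \<Longrightarrow> \<kappa> * norm (slant c r) \<le> norm (sin (of_real pi * slant c r))"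
    using sin_slant_lower by blast
  show ?thesis
  proof (intro exI[of _ "\<kappa> * (1/4 / sqrt 2)"] conjI allI ballI)
    fix N :: nat and \<theta> :: real assume t: "\<theta> \<in> {1/4..3/4}"
    have "\<kappa> * (1/4 / sqrt 2) \<le> norm (sin (of_real pi * slant (real N + \<theta>) r))" for r
    proof -
      have "1/4 / sqrt 2 \<le> \<bar>\<theta>\<bar> / sqrt 2" using t by (intro divide_right_mono) auto
      also have "\<dots> \<le> norm (slant \<theta> r)" by (rule norm_slant_ge)
      finally have "\<kappa> * (1/4 / sqrt 2) \<le> \<kappa> * norm (slant \<theta> r)" using k(1) by (intro mult_left_mono) auto
      also have "\<dots> \<le> norm (sin (of_real pi * slant (real N + \<theta>) r))"
        unfolding norm_sin_slant_shift using k(2) t by auto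
      finally show ?thesis .
    qed
    then show "line_bound (real N + \<theta>) (\<kappa> * (1/4 / sqrt 2))" using k(1) by (simp add: line_bound_def)
  qed (use k in auto)
qed

lemma line_bound_small:
  assumes "0 < c" "c \<le> 3/4"
  shows "\<exists>\<kappa>. line_bound c \<kappa>"
proof -
  obtain \<kappa> where k: "\<kappa> > 0" "\<And>c r. c \<in> {0..3/4} \<Longrightarrow> \<kappa> * norm (slant c r) \<le> norm (sin (of_real pi * slant c r))"
    using sin_slant_lower by blast
  have "line_bound c (\<kappa> * (c / sqrt 2))"
    unfolding line_bound_def
  proof (intro conjI allI)
    fix r
    have "\<kappa> * (c / sqrt 2) \<le> \<kappa> * norm (slant c r)" using norm_slant_ge[of c r] k(1) assms by (intro mult_left_mono) auto
    also have "\<dots> \<le> norm (sin (of_real pi * slant c r))" using k(2)[of c r] assms by auto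
    finally show "\<kappa> * (c / sqrt 2) \<le> norm (sin (of_real pi * slant c r))" .
  qed (use k assms in auto)
  then show ?thesis by blast
qed

lemma line_bound_not_int:
  assumes "line_bound c \<kappa>"
  shows "c \<notin> \<int>"
proof
  assume "c \<in> \<int>"
  then have "sin (pi * c) = 0" by (auto simp: sin_zero_iff_int2 elim!: Ints_cases)
  then have "sin (complex_of_real pi * slant c 0) = 0" by (simp add: slant_def sin_of_real flip: of_real_mult)
  with assms show False unfolding line_bound_def by (metis norm_zero not_less)
qed

section \<open>The line integral and its dependence on the crossing point\<close>

definition line_integrand :: "(complex \<Rightarrow> complex) \<Rightarrow> complex \<Rightarrow> complex" where
  "line_integrand h x = h x * gauss x / (2 * \<i> * sin (of_real pi * x))"

text \<open>The factor \<open>e8\<close> is dx/dr, so this is a genuine contour integral. The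
  normalisation \<open>2 * \<i> * sin (pi * x)\<close> makes the residue of the integrand at an
  integer \<open>n\<close> equal to \<open>h n / (2 * pi * \<i>)\<close>; moving the line past
  \<open>n\<close> thus changes the integral by exactly \<open>h n\<close>.\<close>

definition line_int :: "real \<Rightarrow> (complex \<Rightarrow> complex) \<Rightarrow> complex" where
  "line_int c h = e8 * (\<integral>r. line_integrand h (slant c r) \<partial>lborel)"

lemma line_integrand_bound:
  assumes "line_bound c \<kappa>" "norm (h (slant c r)) \<le> K * exp (\<alpha> * \<bar>r\<bar>)"
  shows "norm (line_integrand h (slant c r)) \<le> K / (2 * \<kappa>) * exp ((\<alpha> + 5 * \<bar>c\<bar>) * \<bar>r\<bar> - pi * r^2)"
proof -
  have k: "\<kappa> > 0" "\<kappa> \<le> norm (sin (of_real pi * slant c r))" using assms(1) by (auto simp: line_bound_def)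
  have "norm (h (slant c r)) * norm (gauss (slant c r)) \<le> K * exp (\<alpha> * \<bar>r\<bar>) * exp (5 * \<bar>c\<bar> * \<bar>r\<bar> - pi * r^2)"
    by (intro mult_mono norm_gauss_slant_le assms order.trans[OF norm_ge_zero assms(2)]) auto
  also have "\<dots> = K * exp ((\<alpha> + 5 * \<bar>c\<bar>) * \<bar>r\<bar> - pi * r^2)"
    by (simp add: mult.assoc exp_add[symmetric] algebra_simps)
  finally have n: "norm (h (slant c r)) * norm (gauss (slant c r)) \<le> K * exp ((\<alpha> + 5 * \<bar>c\<bar>) * \<bar>r\<bar> - pi * r^2)" .
  have "norm (line_integrand h (slant c r)) = norm (h (slant c r)) * norm (gauss (slant c r)) / (2 * norm (sin (of_real pi * slant c r)))"
    by (simp add: line_integrand_def norm_mult norm_divide)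
  also have "\<dots> \<le> K * exp ((\<alpha> + 5 * \<bar>c\<bar>) * \<bar>r\<bar> - pi * r^2) / (2 * \<kappa>)"
    using n k by (intro frac_le order.trans[OF _ n]) auto
  finally show ?thesis by simp
qed

lemma line_integrand_measurable [measurable]:
  assumes [measurable]: "(\<lambda>r. h (slant c r)) \<in> borel_measurable borel"
  shows "(\<lambda>r. line_integrand h (slant c r)) \<in> borel_measurable borel"
proof -
  have [measurable]: "gauss \<in> borel_measurable borel" "(sin :: complex \<Rightarrow> complex) \<in> borel_measurable borel"
    unfolding gauss_def by (intro borel_measurable_continuous_onI continuous_intros)+
  show ?thesis unfolding line_integrand_def by measurable
qed

lemma line_integrand_integrable:
  assumes "line_bound c \<kappa>" "\<And>r. norm (h (slant c r)) \<le> K * exp (\<alpha> * \<bar>r\<bar>)"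
    and [measurable]: "(\<lambda>r. h (slant c r)) \<in> borel_measurable borel"
  shows "integrable lborel (\<lambda>r. line_integrand h (slant c r))"
proof (rule Bochner_Integration.integrable_bound)
  show "integrable lborel (\<lambda>r. K / (2 * \<kappa>) * exp ((\<alpha> + 5 * \<bar>c\<bar>) * \<bar>r\<bar> - pi * r^2))"
    by (intro Bochner_Integration.integrable_mult_right integrable_exp_quadratic)
  show "AE r in lborel. norm (line_integrand h (slant c r)) \<le> norm (K / (2 * \<kappa>) * exp ((\<alpha> + 5 * \<bar>c\<bar>) * \<bar>r\<bar> - pi * r^2))"
    by (intro AE_I2 order.trans[OF line_integrand_bound[where h = h and K = K and \<alpha> = \<alpha>, OF assms(1,2)]]) (simp only: real_norm_def abs_ge_self)
qed measurable

lemma holomorphic_slant_measurable: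
  assumes "h holomorphic_on {x. 0 < Re x - Im x}" "c > 0"
  shows "(\<lambda>r. h (slant c r)) \<in> borel_measurable borel"
proof (rule borel_measurable_continuous_onI)
  have "continuous_on {x. 0 < Re x - Im x} h" using assms holomorphic_on_imp_continuous_on by blast
  then show "continuous_on UNIV (\<lambda>r. h (slant c r))"
    by (rule continuous_on_compose2) (use assms in \<open>auto intro!: continuous_intros simp: slant_def e8_eq\<close>)
qed

text \<open>The residue theorem for the strip between the two lines. This identity is the source of
  the partial sums of \<open>n powr (-s)\<close> in the Riemann-Siegel formula.\<close>

lemma line_int_shift:
  assumes c: "0 < c1" "c1 < c2" and k: "line_bound c1 \<kappa>1" "line_bound c2 \<kappa>2"
    and holo: "h holomorphic_on {x. 0 < Re x - Im x}"
    and bd: "\<And>c r. c1 \<le> c \<Longrightarrow> c \<le> c2 \<Longrightarrow> norm (h (slant c r)) \<le> K * exp (\<alpha> * \<bar>r\<bar>)"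
  shows "line_int c2 h - line_int c1 h = (\<Sum>n | c1 < real n \<and> real n < c2. h (of_nat n))"
proof -
  define Q where "Q = {n::nat. c1 < real n \<and> real n < c2}"
  have finQ: "finite Q"
    by (rule finite_subset[of _ "{..nat \<lceil>c2\<rceil>}"]) (auto simp: Q_def, linarith)
  have nint: "c1 \<notin> \<int>" "c2 \<notin> \<int>" using k line_bound_not_int by auto
  \<comment> \<open>The integers next to \<open>c1\<close> on the left and to \<open>c2\<close> on
    the right: the open strip between them contains no poles except those in \<open>Q\<close>, and
    \<open>lo \<ge> 0\<close> keeps it inside the domain of \<open>h\<close>.\<close>
  define lo hi where "lo = real_of_int \<lfloor>c1\<rfloor>" and "hi = real_of_int \<lceil>c2\<rceil>"
  have "of_int \<lfloor>c1\<rfloor> \<noteq> c1" "of_int \<lceil>c2\<rceil> \<noteq> c2" using nint by (metis Ints_of_int)+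
  then have lo: "lo < c1" "lo \<ge> 0" and hi: "c2 < hi" unfolding lo_def hi_def using c(1)
    by (simp_all add: less_le)
  have sin0: "x \<in> of_real ` real ` Q" if x: "lo < Re x - Im x" "Re x - Im x < hi" "sin (of_real pi * x) = 0" for x
  proof -
    obtain n where n: "of_real pi * x = of_real (of_int n * pi)"
      using x(3) unfolding sin_eq_0 by auto
    then have xn: "x = of_int n" by simp
    then have n1: "\<lfloor>c1\<rfloor> < n" "n < \<lceil>c2\<rceil>" using x unfolding lo_def hi_def by auto
    have "n \<ge> 0" using n1(1) c(1) by (smt (verit) zero_le_floor)
    have "c1 < of_int n" using n1(1) by linarith
    moreover have "of_int n < c2" using n1(2) by linarith
    ultimately have "nat n \<in> Q" using \<open>n \<ge> 0\<close> by (simp add: Q_def)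
    moreover have "x = of_real (real (nat n))" using xn \<open>n \<ge> 0\<close> by simp
    ultimately show ?thesis by blast
  qed
  have meas: "(\<lambda>r. h (slant c1 r)) \<in> borel_measurable borel" "(\<lambda>r. h (slant c2 r)) \<in> borel_measurable borel"
    using holomorphic_slant_measurable[OF holo] c by auto
  have "K * exp 0 \<ge> 0" using order.trans[OF norm_ge_zero bd[of c1 0]] c by simp
  then have K0: "K \<ge> 0" by simp
  define \<beta> where "\<beta> = \<bar>\<alpha>\<bar> + 5 * \<bar>c2\<bar>"
  have "e8 * (\<integral>r. line_integrand h (slant c2 r) \<partial>lborel) - e8 * (\<integral>r. line_integrand h (slant c1 r) \<partial>lborel)
      = 2 * pi * \<i> * (\<Sum>p\<in>real ` Q. h (of_real p) / (2 * pi * \<i>))"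
  proof (rule slanted_line_shift[OF lo(1) c(2) hi, where Rb = 1 and K = "K * exp ((\<beta> + 1)^2)"])
    show "finite (real ` Q)" using finQ by simp
    show "real ` Q \<subseteq> {c1<..<c2}" by (auto simp: Q_def)
    show "line_integrand h holomorphic_on {x. lo < Re x - Im x \<and> Re x - Im x < hi} - of_real ` real ` Q"
      unfolding line_integrand_def gauss_def
    proof (intro holomorphic_intros)
      show "h holomorphic_on {x. lo < Re x - Im x \<and> Re x - Im x < hi} - of_real ` real ` Q"
        by (rule holomorphic_on_subset[OF holo]) (use lo in auto)
      fix z assume "z \<in> {x. lo < Re x - Im x \<and> Re x - Im x < hi} - of_real ` real ` Q"
      then show "2 * \<i> * sin (complex_of_real pi * z) \<noteq> 0" using sin0[of z] by auto
    qed
    show "integrable lborel (\<lambda>r. line_integrand h (slant c1 r))"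
      by (rule line_integrand_integrable[where K = K and \<alpha> = \<alpha>, OF k(1) bd meas(1)]) (use c in auto)
    show "integrable lborel (\<lambda>r. line_integrand h (slant c2 r))"
      by (rule line_integrand_integrable[where K = K and \<alpha> = \<alpha>, OF k(2) bd meas(2)]) (use c in auto)
    fix r cc :: real assume r: "1 \<le> \<bar>r\<bar>" and cc: "c1 \<le> cc" "cc \<le> c2"
    have "norm (line_integrand h (slant cc r)) = norm (h (slant cc r)) * norm (gauss (slant cc r)) / (2 * norm (sin (of_real pi * slant cc r)))"
      by (simp add: line_integrand_def norm_mult norm_divide)
    also have "\<dots> \<le> (K * exp (\<alpha> * \<bar>r\<bar>) * exp (5 * \<bar>cc\<bar> * \<bar>r\<bar> - pi * r^2)) / (1 * \<bar>r\<bar>)"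
      using norm_sin_slant_far[of r cc] r
      by (intro frac_le mult_mono bd cc norm_gauss_slant_le mult_nonneg_nonneg K0) auto
    also have "\<dots> \<le> (K * exp ((\<beta> + 1)^2)) / (1 * \<bar>r\<bar>)"
    proof (intro divide_right_mono)
      have "\<alpha> * \<bar>r\<bar> + (5 * \<bar>cc\<bar> * \<bar>r\<bar> - pi * r^2) \<le> \<beta> * \<bar>r\<bar> - pi * r^2"
      proof -
        have "\<alpha> + 5 * \<bar>cc\<bar> \<le> \<beta>" using cc c unfolding \<beta>_def by auto
        then have "(\<alpha> + 5 * \<bar>cc\<bar>) * \<bar>r\<bar> \<le> \<beta> * \<bar>r\<bar>" by (intro mult_right_mono) auto
        then show ?thesis by (simp add: algebra_simps)
      qed
      also have "\<dots> \<le> (\<beta> + 1)^2" using quadratic_le[of \<beta> r] by simp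
      finally have "exp (\<alpha> * \<bar>r\<bar> + (5 * \<bar>cc\<bar> * \<bar>r\<bar> - pi * r^2)) \<le> exp ((\<beta> + 1)^2)" by simp
      then show "K * exp (\<alpha> * \<bar>r\<bar>) * exp (5 * \<bar>cc\<bar> * \<bar>r\<bar> - pi * r^2) \<le> K * exp ((\<beta> + 1)^2)"
        unfolding mult.assoc exp_add[symmetric] using K0 by (intro mult_left_mono) auto
    qed auto
    finally show "norm (line_integrand h (slant cc r)) \<le> K * exp ((\<beta> + 1)^2) / \<bar>r\<bar>" by simp
  next
    fix p assume "p \<in> real ` Q"
    then obtain n where n: "n \<in> Q" "p = real n" by auto
    have sn: "sin (of_real pi * of_nat n :: complex) = 0"
      using sin_npi[of n] by (metis mult.commute of_real_0 of_real_mult of_real_of_nat_eq sin_of_real)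
    have cn: "cos (of_real pi * of_nat n :: complex) = (-1)^n"
      using cos_npi[of n] by (metis (no_types, lifting) cos_of_real mult.commute of_real_1 of_real_minus of_real_mult of_real_of_nat_eq of_real_power)
    have "((\<lambda>x::complex. sin (of_real pi * x)) has_field_derivative pi * (-1)^n) (at (of_nat n))"
      using cn by (auto intro!: derivative_eq_intros)
    then have l1: "((\<lambda>x::complex. sin (of_real pi * x) / (x - of_nat n)) \<longlongrightarrow> pi * (-1)^n) (at (of_nat n))"
      by (simp add: has_field_derivative_iff sn)
    have nS: "of_nat n \<in> {x. 0 < Re x - Im x}" using n c by (auto simp: Q_def)
    have opn: "open {x. 0 < Re x - Im x}" by (intro open_Collect_less continuous_intros)
    have "isCont h (of_nat n)"
      using holo nS opn by (meson continuous_on_eq_continuous_at holomorphic_on_imp_continuous_on)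
    moreover have "isCont gauss (of_nat n)" unfolding gauss_def by (intro continuous_intros)
    ultimately have "((\<lambda>x. h x * gauss x / (2 * \<i> * (sin (of_real pi * x) / (x - of_nat n))))
        \<longlongrightarrow> h (of_nat n) * gauss (of_nat n) / (2 * \<i> * (pi * (-1)^n))) (at (of_nat n))"
      unfolding isCont_def by (intro tendsto_intros l1) auto
    also have "h (of_nat n) * gauss (of_nat n) / (2 * \<i> * (pi * (-1)^n)) = h (of_nat n) / (2 * pi * \<i>)"
      by (simp add: gauss_of_nat)
    also have "(\<lambda>x. h x * gauss x / (2 * \<i> * (sin (of_real pi * x) / (x - of_nat n)))) = (\<lambda>x. line_integrand h x * (x - of_nat n))"
      by (auto simp: line_integrand_def fun_eq_iff)
    finally show "((\<lambda>x. line_integrand h x * (x - of_real p)) \<longlongrightarrow> h (of_real p) / (2 * pi * \<i>)) (at (of_real p))"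
      using n by simp
  qed
  also have "\<dots> = (\<Sum>n\<in>Q. h (of_nat n))"
    by (subst sum.reindex) (auto simp: sum_divide_distrib[symmetric] o_def)
  finally show ?thesis unfolding line_int_def Q_def .
qed

section \<open>Mordell's integral\<close>

lemma exp_linear_bound:
  "norm (exp (w * slant c r)) \<le> exp (norm w * \<bar>c\<bar>) * exp (norm w * \<bar>r\<bar>)"
proof -
  have "norm (exp (w * slant c r)) \<le> exp (norm (w * slant c r))" by (rule norm_exp)
  also have "\<dots> \<le> exp (norm w * (\<bar>c\<bar> + \<bar>r\<bar>))"
    using norm_slant_le[of c r] by (simp add: norm_mult mult_left_mono)
  finally show ?thesis by (simp add: exp_add[symmetric] algebra_simps)
qed

lemma gauss_line_integrable: "integrable lborel (\<lambda>r. gauss (slant c r))"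
proof (rule Bochner_Integration.integrable_bound[OF integrable_exp_quadratic])
  show "AE r in lborel. norm (gauss (slant c r)) \<le> norm (exp ((5 * \<bar>c\<bar>) * \<bar>r\<bar> - pi * r^2))"
    using norm_gauss_slant_le[of c] by simp
  show "(\<lambda>r. gauss (slant c r)) \<in> borel_measurable lborel"
    unfolding gauss_def by measurable
qed

lemma gauss_line_indep:
  assumes "c1 < c2"
  shows "(\<integral>r. gauss (slant c1 r) \<partial>lborel) = (\<integral>r. gauss (slant c2 r) \<partial>lborel)"
proof -
  define \<beta> where "\<beta> = 5 * (\<bar>c1\<bar> + \<bar>c2\<bar>)"
  have "e8 * (\<integral>r. gauss (slant c2 r) \<partial>lborel) - e8 * (\<integral>r. gauss (slant c1 r) \<partial>lborel)
     = 2 * pi * \<i> * (\<Sum>p\<in>({}::real set). (\<lambda>_. 0) p)"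
  proof (rule slanted_line_shift[where rs = "\<lambda>_. 0" and P = "{}" and lo = "c1 - 1" and hi = "c2 + 1" and Rb = 1 and K = "exp ((\<beta> + 1)^2)"])
    show "gauss holomorphic_on {x. c1 - 1 < Re x - Im x \<and> Re x - Im x < c2 + 1} - complex_of_real ` {}"
      unfolding gauss_def by (intro holomorphic_intros)
    fix r c :: real assume r: "1 \<le> \<bar>r\<bar>" and c: "c1 \<le> c" "c \<le> c2"
    have "norm (gauss (slant c r)) \<le> exp (5 * \<bar>c\<bar> * \<bar>r\<bar> - pi * r^2)" by (rule norm_gauss_slant_le)
    also have "\<dots> \<le> exp (\<beta> * \<bar>r\<bar> - pi * r^2)" using c unfolding \<beta>_def by (auto intro!: mult_right_mono)
    also have "\<dots> \<le> exp ((\<beta> + 1)^2 - \<bar>r\<bar>)" using quadratic_le[of \<beta> r] by simp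
    also have "\<dots> \<le> exp ((\<beta> + 1)^2) / \<bar>r\<bar>"
    proof -
      have "\<bar>r\<bar> \<le> exp \<bar>r\<bar>" using exp_ge_add_one_self[of "\<bar>r\<bar>"] by linarith
      then show ?thesis using r unfolding exp_diff by (intro divide_left_mono mult_pos_pos) auto
    qed
    finally show "norm (gauss (slant c r)) \<le> exp ((\<beta> + 1)^2) / \<bar>r\<bar>" .
  qed (use assms gauss_line_integrable in auto)
  then show ?thesis by simp
qed

lemma gauss_line_const: "(\<integral>r. gauss (slant c r) \<partial>lborel) = (\<integral>r. gauss (slant 0 r) \<partial>lborel)"
  by (cases c "0::real" rule: linorder_cases) (use gauss_line_indep in metis)+

text \<open>Completing the square replaces \<open>x\<close> by \<open>x + v\<close> at the price of
  \<open>exp (- \<i> * pi * v^2)\<close>. Every complex \<open>v\<close> is itself a point of some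
  slanted line, so \<open>x + v\<close> again runs along such a line, and the Gaussian integral does
  not depend on which one.\<close>

lemma gauss_linear_integral:
  "(\<integral>r. gauss (slant c r) * exp (2 * pi * \<i> * v * slant c r) \<partial>lborel)
   = exp (- \<i> * pi * v ^ 2) * (\<integral>r. gauss (slant 0 r) \<partial>lborel)"
proof -
  define a b where "a = Re v - Im v" and "b = sqrt 2 * Im v"
  have v: "v = slant a b" unfolding a_def b_def by (rule slant_surj)
  have "gauss (slant c r) * exp (2 * pi * \<i> * v * slant c r) = exp (- \<i> * pi * v ^ 2) * gauss (slant (c + a) (b + 1 * r))" for r
  proof -
    have "slant (c + a) (b + 1 * r) = slant c r + v" unfolding v slant_add by (simp add: add.commute)
    then show ?thesis
      unfolding gauss_def by (simp add: exp_add[symmetric] power2_eq_square algebra_simps)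
  qed
  then have "(\<integral>r. gauss (slant c r) * exp (2 * pi * \<i> * v * slant c r) \<partial>lborel)
    = exp (- \<i> * pi * v ^ 2) * (\<integral>r. gauss (slant (c + a) (b + 1 * r)) \<partial>lborel)" by simp
  also have "(\<integral>r. gauss (slant (c + a) (b + 1 * r)) \<partial>lborel) = (\<integral>r. gauss (slant (c + a) r) \<partial>lborel)"
    by (subst (2) lborel_integral_real_affine[of 1 _ b]) auto
  finally show ?thesis using gauss_line_const[of "c + a"] by simp
qed

text \<open>
  Mordell's integral: the right-hand side follows by eliminating \<open>I(u + 1)\<close> between the relations
  coming from \<open>u \<mapsto> u + 1\<close> and from moving the line by 1; the value of the Gaussian
  integral is read off at \<open>u = 0\<close>.
\<close>
lemma mordell_integral:
  "(exp (2 * pi * \<i> * u) - 1) * line_int (1/2) (\<lambda>x. exp (2 * pi * \<i> * u * x))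
   = exp (2 * pi * \<i> * u) - exp (\<i> * pi * u - \<i> * pi * u ^ 2)"
proof -
  define h where "h = (\<lambda>u x. exp (2 * pi * \<i> * u * x))"
  define I where "I = (\<lambda>u. line_int (1/2) (h u))"
  define g where "g = e8 * (\<integral>r. gauss (slant 0 r) \<partial>lborel)"
  obtain \<kappa>1 where k1: "line_bound (1/2) \<kappa>1" using line_bound_small[of "1/2"] by force
  obtain \<kappa>2 where k2: "line_bound (3/2) \<kappa>2"
  proof -
    obtain \<kappa> where k: "\<forall>N::nat. \<forall>\<theta>\<in>{1/4..3/4}. line_bound (real N + \<theta>) \<kappa>"
      using line_bound_uniform by blast
    have "line_bound (real 1 + 1/2) \<kappa>" by (rule k[rule_format]) simp
    with that show ?thesis by simp
  qed
  have holo: "h u holomorphic_on A" for u A unfolding h_def by (intro holomorphic_intros)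
  have bd: "norm (h u (slant c r)) \<le> exp (norm (2 * pi * \<i> * u) * 2) * exp (norm (2 * pi * \<i> * u) * \<bar>r\<bar>)" if "\<bar>c\<bar> \<le> 2" for c r u
  proof -
    have "exp (norm (2 * pi * \<i> * u) * \<bar>c\<bar>) \<le> exp (norm (2 * pi * \<i> * u) * 2)"
      using that by (simp add: mult_left_mono)
    then show ?thesis unfolding h_def
      by (intro order.trans[OF exp_linear_bound] mult_right_mono) auto
  qed
  have int: "integrable lborel (\<lambda>r. line_integrand (h u) (slant (1/2) r))" for u
    by (rule line_integrand_integrable[OF k1 bd]) (auto simp: h_def)
  have "line_int (3/2) (h u) - line_int (1/2) (h u) = (\<Sum>n | 1/2 < real n \<and> real n < 3/2. h u (of_nat n))" for u
    by (rule line_int_shift[OF _ _ k1 k2 holo bd]) auto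
  moreover have "{n. 1/2 < real n \<and> real n < 3/2} = {1}"
  proof -
    have "n = 1" if "1/2 < real n" "real n < 3/2" for n
    proof -
      have "n > 0" "real n < 2" using that by (auto intro: Nat.gr0I)
      then show ?thesis by simp
    qed
    then show ?thesis by auto
  qed
  ultimately have s1: "line_int (3/2) (h u) - I u = exp (2 * pi * \<i> * u)" for u
    by (simp add: I_def h_def)
  \<comment> \<open>Under \<open>x \<mapsto> x + 1\<close> the Gaussian acquires the factor
    \<open>- exp (2 * pi * \<i> * x)\<close> and the sine changes sign, so moving the line by 1 acts
    as \<open>u \<mapsto> u + 1\<close>.\<close>
  have s2: "line_int (3/2) (h u) = exp (2 * pi * \<i> * u) * I (u + 1)" for u
  proof -
    have "line_integrand (h u) (slant (3/2) r) = exp (2 * pi * \<i> * u) * line_integrand (h (u + 1)) (slant (1/2) r)" for r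
    proof -
      define x where "x = slant (1/2) r"
      have x1: "slant (3/2) r = x + 1" by (simp add: slant_def x_def)
      have gs: "gauss (x + 1) = - gauss x * exp (2 * pi * \<i> * x)"
      proof -
        have "\<i> * complex_of_real pi * (x + 1)^2 = \<i> * pi * x^2 + 2 * pi * \<i> * x + \<i> * pi"
          by (simp add: power2_eq_square algebra_simps)
        then show ?thesis unfolding gauss_def by (simp add: exp_add)
      qed
      have sn: "sin (of_real pi * (x + 1)) = - sin (of_real pi * x)"
        by (simp add: distrib_left sin_add)
      show ?thesis unfolding x1 x_def[symmetric] line_integrand_def gs sn
        by (simp add: h_def exp_add algebra_simps)
    qed
    then show ?thesis by (simp add: line_int_def I_def)
  qed
  \<comment> \<open>Raising \<open>u\<close> by 1 multiplies the exponential by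
    \<open>exp (2 * pi * \<i> * x)\<close>; the difference produces a sine that cancels the
    denominator, and a Gaussian integral with linear term \<open>u + 1/2\<close> remains.\<close>
  have s3: "I (u + 1) = I u + g * exp (- \<i> * pi * (u + 1/2)^2)" for u
  proof -
    have e: "line_integrand (h (u + 1)) (slant (1/2) r) - line_integrand (h u) (slant (1/2) r)
        = gauss (slant (1/2) r) * exp (2 * pi * \<i> * (u + 1/2) * slant (1/2) r)" for r
    proof -
      define x where "x = slant (1/2) r"
      have nz: "sin (of_real pi * x) \<noteq> 0" using k1 unfolding line_bound_def x_def by (metis norm_zero not_less)
      have "h (u + 1) x - h u x = exp (2 * pi * \<i> * (u + 1/2) * x) * (exp (\<i> * (of_real pi * x)) - exp (- (\<i> * (of_real pi * x))))"
        unfolding h_def right_diff_distrib exp_add[symmetric] by (simp add: algebra_simps)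
      also have "exp (\<i> * (of_real pi * x)) - exp (- (\<i> * (of_real pi * x))) = 2 * \<i> * sin (of_real pi * x)"
        by (simp add: sin_exp_eq)
      finally have hd: "h (u + 1) x - h u x = exp (2 * pi * \<i> * (u + 1/2) * x) * (2 * \<i> * sin (of_real pi * x))" .
      have "line_integrand (h (u + 1)) x - line_integrand (h u) x = (h (u + 1) x - h u x) * gauss x / (2 * \<i> * sin (of_real pi * x))"
        unfolding line_integrand_def by (simp add: diff_divide_distrib left_diff_distrib)
      also have "\<dots> = gauss x * exp (2 * pi * \<i> * (u + 1/2) * x)"
        unfolding hd using nz by simp
      finally show ?thesis unfolding x_def .
    qed
    have "I (u + 1) - I u = e8 * (\<integral>r. line_integrand (h (u + 1)) (slant (1/2) r) - line_integrand (h u) (slant (1/2) r) \<partial>lborel)"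
      unfolding I_def line_int_def using int by (simp add: right_diff_distrib)
    also have "\<dots> = g * exp (- \<i> * pi * (u + 1/2)^2)"
      unfolding e gauss_linear_integral g_def by simp
    finally show ?thesis by (simp add: algebra_simps)
  qed
  have main: "(exp (2 * pi * \<i> * u) - 1) * I u = exp (2 * pi * \<i> * u) * (1 - g * exp (- \<i> * pi * (u + 1/2)^2))" for u
    using s1[of u] unfolding s2 s3 by (simp add: algebra_simps)
  have "g * exp (- \<i> * pi / 4) = 1" using main[of 0] by (simp add: power2_eq_square)
  then have g: "g = exp (\<i> * pi / 4)" by (simp add: exp_minus field_simps)
  have "exp (2 * pi * \<i> * u) * (g * exp (- \<i> * pi * (u + 1/2)^2)) = exp (\<i> * pi * u - \<i> * pi * u ^ 2)"
    unfolding g exp_add[symmetric]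
    by (rule arg_cong[where f = exp]) (simp add: power2_eq_square field_simps)
  with main[of u] show ?thesis unfolding I_def h_def by (simp add: algebra_simps)
qed

section \<open>The Riemann--Siegel formula\<close>

text \<open>The \<open>R s\<close> of the overview, with the crossing point of the line as an
  explicit parameter.\<close>

definition rs_int :: "real \<Rightarrow> complex \<Rightarrow> complex" where
  "rs_int c s = line_int c (\<lambda>x. x powr (- s))"

lemma slant_not_nonpos:
  assumes "c > 0" shows "slant c r \<notin> \<real>\<^sub>\<le>\<^sub>0"
  using assms by (auto simp: complex_nonpos_Reals_iff Re_slant Im_slant)

lemma slant_nonzero: "c > 0 \<Longrightarrow> slant c r \<noteq> 0"
  using slant_not_nonpos[of c r] by auto

text \<open>The norm is the exponential of \<open>- Re s * ln \<bar>x\<bar> + Im s * arg x\<close>.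
  The logarithm is bounded above by \<open>\<bar>x\<bar>\<close> and below through the distance
  \<open>c1 / sqrt 2\<close> of the line from 0, the argument by pi. Uniformity in \<open>c\<close>
  serves the line shift, uniformity in \<open>s\<close> the holomorphy of
  \<open>rs_int\<close>.\<close>

lemma norm_slant_powr_le:
  assumes c: "0 < c1" "c1 \<le> c" "c \<le> c2" and B: "norm s \<le> B"
  shows "norm (slant c r powr (- s)) \<le> exp (B * (c2 + sqrt 2 / c1 + pi)) * exp (B * \<bar>r\<bar>)"
proof -
  let ?x = "slant c r"
  have nz: "?x \<noteq> 0" using slant_nonzero c by simp
  have n: "norm ?x > 0" using nz by simp
  have "norm (?x powr (- s)) = exp (Re (- s * Ln ?x))"
    using nz by (simp add: powr_def norm_exp_eq_Re)
  also have "Re (- s * Ln ?x) = - Re s * ln (norm ?x) + Im s * Im (Ln ?x)"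
    using nz by (simp add: Re_Ln)
  also have "\<dots> \<le> B * (c2 + \<bar>r\<bar> + sqrt 2 / c1) + B * pi"
  proof (rule add_mono)
    have Bs: "\<bar>Re s\<bar> \<le> B" "\<bar>Im s\<bar> \<le> B" "B \<ge> 0"
      using B abs_Re_le_cmod[of s] abs_Im_le_cmod[of s] norm_ge_zero[of s] by linarith+
    have "ln (norm ?x) \<le> norm ?x" using ln_le_minus_one[OF n] by simp
    moreover have "- ln (norm ?x) \<le> 1 / norm ?x"
      using ln_le_minus_one[of "1 / norm ?x"] n by (simp add: ln_div)
    moreover have "1 / norm ?x \<le> sqrt 2 / c1"
    proof -
      have "c1 / sqrt 2 \<le> norm ?x" using norm_slant_ge[of c r] c by (intro order.trans[OF _ norm_slant_ge] divide_right_mono) auto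
      then have "1 / norm ?x \<le> 1 / (c1 / sqrt 2)" using c by (intro divide_left_mono) (auto intro!: mult_pos_pos divide_pos_pos n)
      then show ?thesis by simp
    qed
    moreover have "norm ?x \<le> c2 + \<bar>r\<bar>" using norm_slant_le[of c r] c by simp
    ultimately have l: "\<bar>ln (norm ?x)\<bar> \<le> c2 + \<bar>r\<bar> + sqrt 2 / c1"
      using c n by (smt (verit) divide_nonneg_pos real_sqrt_ge_zero zero_le_divide_1_iff)
    have "- Re s * ln (norm ?x) \<le> \<bar>Re s\<bar> * \<bar>ln (norm ?x)\<bar>" by (metis abs_ge_self abs_minus_cancel abs_mult)
    also have "\<dots> \<le> B * (c2 + \<bar>r\<bar> + sqrt 2 / c1)" using Bs l by (intro mult_mono) auto
    finally show "- Re s * ln (norm ?x) \<le> B * (c2 + \<bar>r\<bar> + sqrt 2 / c1)" .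
    have "\<bar>Im (Ln ?x)\<bar> \<le> pi" using nz Im_Ln_le_pi[of ?x] mpi_less_Im_Ln[of ?x] by auto
    then have "\<bar>Im s\<bar> * \<bar>Im (Ln ?x)\<bar> \<le> B * pi" using Bs by (intro mult_mono) auto
    then show "Im s * Im (Ln ?x) \<le> B * pi" by (metis abs_ge_self abs_mult order_trans)
  qed
  also have "\<dots> = B * (c2 + sqrt 2 / c1 + pi) + B * \<bar>r\<bar>" by (simp add: algebra_simps)
  finally show ?thesis by (simp add: exp_add)
qed

lemma powr_holomorphic_slant: "(\<lambda>x. x powr (- s)) holomorphic_on {x. 0 < Re x - Im x}"
  by (intro holomorphic_intros) (auto simp: complex_nonpos_Reals_iff)

lemma rs_int_shift:
  assumes c: "0 < c1" "c1 < c2" and k: "line_bound c1 \<kappa>1" "line_bound c2 \<kappa>2"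
  shows "rs_int c2 s - rs_int c1 s = (\<Sum>n | c1 < real n \<and> real n < c2. of_nat n powr (- s))"
  unfolding rs_int_def
  by (rule line_int_shift[OF c k powr_holomorphic_slant norm_slant_powr_le[OF c(1) _ _ order.refl]])

lemma rs_int_integrable:
  assumes "c > 0" "line_bound c \<kappa>"
  shows "integrable lborel (\<lambda>r. line_integrand (\<lambda>x. x powr (- s)) (slant c r))"
  by (rule line_integrand_integrable[OF assms(2) norm_slant_powr_le[OF assms(1) order.refl order.refl order.refl]
        holomorphic_slant_measurable[OF powr_holomorphic_slant assms(1)]])

lemma rs_int_holomorphic:
  assumes c: "c > 0" and k: "line_bound c \<kappa>"
  shows "rs_int c holomorphic_on UNIV"
proof -
  have "(\<lambda>s. \<integral>r. line_integrand (\<lambda>x. x powr (- s)) (slant c r) \<partial>lborel) holomorphic_on UNIV"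
  proof (rule holomorphic_parameter_integral)
    fix r show "(\<lambda>s. line_integrand (\<lambda>x. x powr (- s)) (slant c r)) holomorphic_on UNIV"
      unfolding line_integrand_def using k
      by (intro holomorphic_intros) (auto simp: slant_nonzero c line_bound_def, metis norm_zero not_less)
  next
    fix s show "(\<lambda>r. line_integrand (\<lambda>x. x powr (- s)) (slant c r)) \<in> borel_measurable lborel"
      using rs_int_integrable[OF c k, of s] by (rule borel_measurable_integrable)
  next
    fix s :: complex
    define B where "B = norm s + 1"
    define K where "K = exp (B * (c + sqrt 2 / c + pi))"
    show "\<exists>d>0. \<exists>g. integrable lborel g \<and> cball s d \<subseteq> UNIV \<and>
      (\<forall>v\<in>cball s d. \<forall>r\<in>space lborel. norm (line_integrand (\<lambda>x. x powr (- v)) (slant c r)) \<le> g r)"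
    proof (intro exI[of _ 1] exI[of _ "\<lambda>r. K / (2 * \<kappa>) * exp ((B + 5 * \<bar>c\<bar>) * \<bar>r\<bar> - pi * r^2)"] conjI ballI)
      show "integrable lborel (\<lambda>r. K / (2 * \<kappa>) * exp ((B + 5 * \<bar>c\<bar>) * \<bar>r\<bar> - pi * r^2))"
        by (intro Bochner_Integration.integrable_mult_right integrable_exp_quadratic)
      fix v r assume "v \<in> cball s 1"
      then have vB: "norm v \<le> B" unfolding B_def using norm_triangle_ineq2[of v s] by (simp add: dist_norm norm_minus_commute)
      show "norm (line_integrand (\<lambda>x. x powr (- v)) (slant c r)) \<le> K / (2 * \<kappa>) * exp ((B + 5 * \<bar>c\<bar>) * \<bar>r\<bar> - pi * r^2)"
        unfolding K_def by (rule line_integrand_bound[where h = "\<lambda>x. x powr (- v)" and \<alpha> = B, OF k norm_slant_powr_le[OF c order.refl order.refl vB]])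
    qed auto
  qed auto
  then show ?thesis unfolding rs_int_def line_int_def by (intro holomorphic_intros)
qed

section \<open>The Mellin transform of Mordell's integral\<close>

lemma Re_e8_slant: "Re (e8 * slant c r) = c / sqrt 2"
  by (simp add: e8_eq Re_slant Im_slant field_simps)

text \<open>On a line with \<open>c > 0\<close> the argument of \<open>x\<close> stays below pi/2,
  so that adding the pi/4 of \<open>e8\<close> does not cross the branch cut and the logarithms
  add.\<close>

lemma powr_e8_slant:
  assumes c: "c > 0" and a: "a > 0"
  shows "(of_real a * e8 * slant c r) powr (- of_real s) = of_real (a powr (- s)) * cis (- (pi / 4 * s)) * slant c r powr (- of_real s)"
proof -
  let ?x = "slant c r"
  have nz: "?x \<noteq> 0" using slant_nonzero c by simp
  have le: "Im (Ln ?x) < pi / 2"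
  proof (cases "Re ?x > 0")
    case True
    then show ?thesis using Re_Ln_pos_lt_imp[of ?x] by simp
  next
    case False
    then have "Im ?x < 0" using c by (simp add: Re_slant Im_slant)
    then have "Im (Ln ?x) \<le> 0" using nz Im_Ln_pos_le[of ?x] Im_Ln_le_pi[of ?x] by linarith
    then show ?thesis using pi_gt_zero by linarith
  qed
  have "Ln (of_real a * e8 * ?x) = of_real (ln a) + \<i> * (pi / 4) + Ln ?x"
  proof (rule Ln_unique)
    have "exp (of_real (ln a) + \<i> * (pi / 4) + Ln ?x) = exp (of_real (ln a)) * exp (\<i> * (pi / 4)) * exp (Ln ?x)"
      by (simp add: exp_add)
    also have "\<dots> = of_real a * e8 * ?x" using a nz by (simp add: e8_def cis_conv_exp exp_of_real)
    finally show "exp (of_real (ln a) + \<i> * (pi / 4) + Ln ?x) = of_real a * e8 * ?x" .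
    have im: "Im (of_real (ln a) + \<i> * (pi / 4) + Ln ?x) = pi / 4 + Im (Ln ?x)"
      by simp
    show "- pi < Im (of_real (ln a) + \<i> * (pi / 4) + Ln ?x)"
      unfolding im using mpi_less_Im_Ln[OF nz] pi_gt_zero by linarith
    show "Im (of_real (ln a) + \<i> * (pi / 4) + Ln ?x) \<le> pi"
      unfolding im using le pi_gt_zero by linarith
  qed
  then have "(of_real a * e8 * ?x) powr (- of_real s) = exp (- of_real s * of_real (ln a)) * exp (- of_real s * (\<i> * (pi / 4))) * exp (- of_real s * Ln ?x)"
    using nz a by (simp add: powr_def exp_add[symmetric] algebra_simps)
  also have "exp (- of_real s * complex_of_real (ln a)) = of_real (a powr (- s))"
    using a by (simp add: powr_def exp_of_real[symmetric])
  also have "exp (- complex_of_real s * (\<i> * (pi / 4))) = cis (- (pi / 4 * s))"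
    by (simp add: cis_conv_exp mult_ac)
  also have "exp (- complex_of_real s * Ln ?x) = ?x powr (- of_real s)"
    using nz by (simp add: powr_def)
  finally show ?thesis .
qed

text \<open>Mordell's integral at \<open>u = \<i> * e8 * q\<close>. On this ray the exponent
  \<open>2 * pi * \<i> * u * x\<close> equals \<open>- 2 * pi * e8 * x * q\<close>, whose real part
  is constant along the line and negative for \<open>q > 0\<close>; this makes the Mellin transform
  in \<open>q\<close> absolutely convergent.\<close>

definition mordell_ray :: "real \<Rightarrow> complex" where
  "mordell_ray q = line_int (1/2) (\<lambda>x. exp (2 * pi * \<i> * (\<i> * e8 * of_real q) * x))"

text \<open>Fubini: for fixed \<open>x\<close> the integral over \<open>q\<close> is the Gamma
  integral with scale \<open>2 * pi * e8 * x\<close>, which produces \<open>x powr (-s)\<close> and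
  hence \<open>rs_int\<close>.\<close>

lemma mellin_mordell:
  assumes s: "s > 0"
  shows "integrable lborel (\<lambda>q. of_real (Gamma_kernel s q) * mordell_ray q)" (is ?A)
    and "(\<integral>q. of_real (Gamma_kernel s q) * mordell_ray q \<partial>lborel)
       = of_real (Gamma s * (2 * pi) powr (- s)) * cis (- (pi / 4 * s)) * rs_int (1/2) (of_real s)" (is ?B)
proof -
  obtain \<kappa> where k: "line_bound (1/2) \<kappa>" using line_bound_small[of "1/2"] by force
  define X where "X = slant (1/2)"
  have [measurable]: "X \<in> borel_measurable borel" unfolding X_def by measurable
  define G where "G = (\<lambda>r. gauss (X r) / (2 * \<i> * sin (of_real pi * X r)))"
  have Gli: "G r = line_integrand (\<lambda>_. 1) (X r)" for r by (simp add: G_def line_integrand_def)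
  have Gint: "integrable lborel G"
    unfolding Gli[abs_def] X_def by (rule line_integrand_integrable[OF k, where K = 1 and \<alpha> = 0]) auto
  then have [measurable]: "G \<in> borel_measurable borel" by auto
  define F where "F = (\<lambda>(r, q). of_real (Gamma_kernel s q) * (G r * exp (- (2 * pi * e8 * X r) * of_real q)))"
  \<comment> \<open>The decay rate in \<open>q\<close>, the same for every \<open>r\<close>; the
    norm of the double integrand therefore factorises.\<close>
  define a where "a = 2 * pi * (1 / 2 / sqrt 2)"
  have a: "a > 0" by (simp add: a_def)
  have Re_a: "Re (2 * pi * e8 * X r) = a" for r
  proof -
    have "2 * complex_of_real pi * e8 * X r = of_real (2 * pi) * (e8 * X r)" by simp
    also have "Re \<dots> = 2 * pi * Re (e8 * X r)" by simp
    finally show ?thesis unfolding a_def X_def Re_e8_slant by simp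
  qed
  have nF: "norm (F (r, q)) = norm (G r) * (Gamma_kernel s q * exp (- a * q))" for r q
    using Re_a[of r] by (simp add: F_def norm_mult norm_exp_eq_Re)
  have Fm: "F \<in> borel_measurable (lborel \<Otimes>\<^sub>M lborel)" unfolding F_def by measurable
  have inner: "integrable lborel (\<lambda>q. F (r, q))" for r
  proof -
    have "integrable lborel (\<lambda>q. of_real (Gamma_kernel s q) * exp (- (2 * pi * e8 * X r) * of_real q))"
      by (rule Gamma_kernel_exp_integrable[OF s]) (unfold Re_a, rule a)
    then have "integrable lborel (\<lambda>q. G r * (of_real (Gamma_kernel s q) * exp (- (2 * pi * e8 * X r) * of_real q)))"
      by (rule Bochner_Integration.integrable_mult_right)
    then show ?thesis by (simp add: F_def mult_ac)
  qed
  have Fi: "integrable (lborel \<Otimes>\<^sub>M lborel) F"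
  proof (rule lborel_pair.Fubini_integrable[OF Fm])
    show "integrable lborel (\<lambda>x. \<integral>y. norm (F (x, y)) \<partial>lborel)"
      unfolding nF using Gint by simp
    show "AE x in lborel. integrable lborel (\<lambda>y. F (x, y))" using inner by simp
  qed
  have Fi': "integrable (lborel \<Otimes>\<^sub>M lborel) (case_prod (\<lambda>r q. F (r, q)))" using Fi by simp
  have sw: "e8 * (\<integral>r. F (r, q) \<partial>lborel) = of_real (Gamma_kernel s q) * mordell_ray q" for q
  proof -
    have ii: "exp (- (2 * pi * e8 * X r) * of_real q) = exp (2 * pi * \<i> * (\<i> * e8 * of_real q) * X r)" for r
      by (rule arg_cong[where f = exp]) (simp add: algebra_simps)
    have "F (r, q) = of_real (Gamma_kernel s q) * line_integrand (\<lambda>x. exp (2 * pi * \<i> * (\<i> * e8 * of_real q) * x)) (X r)" for r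
    proof -
      have gen: "k * (G r * w) = k * (w * gauss (X r) / (2 * \<i> * sin (of_real pi * X r)))" for k w
        by (simp add: G_def)
      have "F (r, q) = of_real (Gamma_kernel s q) * (G r * exp (- (2 * pi * e8 * X r) * of_real q))"
        by (simp only: F_def split)
      also have "\<dots> = of_real (Gamma_kernel s q) * line_integrand (\<lambda>x. exp (2 * pi * \<i> * (\<i> * e8 * of_real q) * x)) (X r)"
        unfolding ii line_integrand_def by (rule gen)
      finally show ?thesis .
    qed
    then show ?thesis unfolding mordell_ray_def line_int_def X_def by simp
  qed
  have "integrable lborel (\<lambda>q. \<integral>r. F (r, q) \<partial>lborel)"
    using lborel_pair.integrable_snd[OF Fi'] by simp
  then have "integrable lborel (\<lambda>q. e8 * (\<integral>r. F (r, q) \<partial>lborel))" by simp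
  then show ?A unfolding sw .
  have fq: "(\<integral>q. F (r, q) \<partial>lborel) = of_real (Gamma s * (2 * pi) powr (- s)) * cis (- (pi / 4 * s)) * line_integrand (\<lambda>x. x powr (- of_real s)) (X r)" for r
  proof -
    have "(\<integral>q. F (r, q) \<partial>lborel) = G r * (\<integral>q. of_real (Gamma_kernel s q) * exp (- (2 * pi * e8 * X r) * of_real q) \<partial>lborel)"
      by (simp add: F_def mult_ac)
    also have "\<dots> = G r * (Gamma (of_real s) * (2 * pi * e8 * X r) powr (- of_real s))"
      by (subst Gamma_kernel_exp_integral[OF s]) (unfold Re_a, rule a, rule refl)
    also have "(2 * pi * e8 * X r) powr (- of_real s) = of_real ((2 * pi) powr (- s)) * cis (- (pi / 4 * s)) * X r powr (- of_real s)"
      using powr_e8_slant[of "1/2" "2 * pi" r s] by (simp add: X_def)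
    finally show ?thesis by (simp add: line_integrand_def G_def Gamma_complex_of_real mult_ac)
  qed
  have "(\<integral>q. of_real (Gamma_kernel s q) * mordell_ray q \<partial>lborel) = e8 * (\<integral>q. \<integral>r. F (r, q) \<partial>lborel \<partial>lborel)"
    unfolding sw[symmetric] by simp
  also have "(\<integral>q. \<integral>r. F (r, q) \<partial>lborel \<partial>lborel) = (\<integral>r. \<integral>q. F (r, q) \<partial>lborel \<partial>lborel)"
    using lborel_pair.Fubini_integral[OF Fi'] by simp
  finally show ?B unfolding rs_int_def line_int_def X_def[symmetric] fq by (simp add: mult_ac)
qed

section \<open>The closed form on the ray and the appearance of zeta\<close>

lemma cnj_e8: "cnj e8 = - \<i> * e8"
  by (simp add: e8_eq complex_eq_iff)

lemma gauss_e8: "gauss (e8 * of_real r) = of_real (exp (- pi * r^2))"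
proof -
  have "\<i> * complex_of_real pi * (e8 * of_real r)^2 = \<i> * pi * ((e8 * e8) * (of_real r)^2)"
    by (simp add: power2_eq_square mult_ac)
  also have "\<dots> = of_real (- pi * r^2)" by (simp add: e8_sq algebra_simps)
  finally show ?thesis unfolding gauss_def by (simp only: exp_of_real)
qed

text \<open>What remains of Mordell's closed form on the ray once a geometric series is split off: a
  Gaussian divided by \<open>2 * sinh (pi * e8 * q)\<close>.\<close>

definition rs_kernel :: "real \<Rightarrow> complex" where
  "rs_kernel q = of_real (exp (- pi * q^2)) / (exp (pi * e8 * of_real q) - exp (- (pi * e8 * of_real q)))"

text \<open>With \<open>E = exp (- 2 * pi * e8 * q)\<close>, Mordell's evaluation is divided by
  \<open>E - 1\<close>. The summand \<open>E / (E - 1)\<close> is minus a geometric series, kept as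
  a series because its Mellin transform is a Dirichlet series.\<close>

lemma mordell_ray_eq:
  assumes q: "q > 0"
  shows "mordell_ray q = rs_kernel q - (\<Sum>k. exp (- (2 * pi * real (Suc k) * e8) * of_real q))"
    and "summable (\<lambda>k. norm (exp (- (2 * pi * real (Suc k) * e8) * of_real q)))"
proof -
  define w where "w = complex_of_real pi * e8 * of_real q"
  define E where "E = exp (- 2 * w)"
  have "Re w > 0" using q by (simp add: w_def e8_eq)
  then have nE: "norm E < 1" by (simp add: E_def norm_exp_eq_Re)
  then have E1: "E - 1 \<noteq> 0" by auto
  have Ek: "exp (- (2 * pi * real (Suc k) * e8) * of_real q) = E ^ Suc k" for k
    unfolding E_def exp_of_nat_mult[symmetric] by (rule arg_cong[where f = exp]) (simp add: w_def algebra_simps)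
  have "summable (\<lambda>k. norm (E ^ k))" using nE by (simp add: norm_power)
  then show "summable (\<lambda>k. norm (exp (- (2 * pi * real (Suc k) * e8) * of_real q)))"
    unfolding Ek by (subst summable_Suc_iff)
  have "(\<lambda>k. E ^ k) sums (1 / (1 - E))" by (rule geometric_sums[OF nE])
  then have "(\<lambda>k. E * E ^ k) sums (E * (1 / (1 - E)))" by (rule sums_mult)
  then have S: "(\<Sum>k. exp (- (2 * pi * real (Suc k) * e8) * of_real q)) = E / (1 - E)"
    unfolding Ek by (simp add: sums_iff)
  define u where "u = \<i> * e8 * complex_of_real q"
  have u1: "exp (2 * pi * \<i> * u) = E" unfolding E_def
    by (rule arg_cong[where f = exp]) (simp add: u_def w_def algebra_simps)
  have u2: "exp (\<i> * pi * u - \<i> * pi * u ^ 2) = exp (- w) * of_real (exp (- pi * q^2))"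
  proof -
    have "u^2 = - \<i> * (of_real q)^2"
      using e8_sq by (simp add: u_def power_mult_distrib)
    then have "\<i> * pi * u - \<i> * pi * u ^ 2 = \<i> * pi * u - \<i> * pi * (- \<i> * (of_real q)^2)"
      by (simp only:)
    also have "\<dots> = - w + of_real (- pi * q^2)"
      by (simp add: u_def w_def algebra_simps)
    finally have "\<i> * pi * u - \<i> * pi * u ^ 2 = - w + of_real (- pi * q^2)" .
    then show ?thesis by (simp only: exp_add exp_of_real)
  qed
  have wE: "exp w - exp (- w) = (1 - E) / exp (- w)"
    by (simp add: E_def exp_minus field_simps exp_add[symmetric] exp_double[symmetric] power2_eq_square)
  have "(E - 1) * mordell_ray q = E - exp (- w) * of_real (exp (- pi * q^2))"
    using mordell_integral[of u] unfolding u1 u2 mordell_ray_def u_def[symmetric] .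
  then have "mordell_ray q = (E - exp (- w) * of_real (exp (- pi * q^2))) / (E - 1)"
    using E1 by (simp add: field_simps)
  also have "\<dots> = of_real (exp (- pi * q^2)) / ((1 - E) / exp (- w)) - E / (1 - E)"
    using E1 by (simp add: divide_simps) (simp add: algebra_simps)
  finally show "mordell_ray q = rs_kernel q - (\<Sum>k. exp (- (2 * pi * real (Suc k) * e8) * of_real q))"
    unfolding S rs_kernel_def w_def[symmetric] wE[symmetric] .
qed

lemma zeta_sums:
  assumes "Re s > 1" shows "(\<lambda>n. of_nat (Suc n) powr (- s)) sums zeta s"
  using is_zeta_continuation_zeta assms unfolding is_zeta_continuation_def
  by (simp add: powr_minus_divide)

text \<open>Termwise integration of the geometric series gives zeta with the same factor \<rho> that
  accompanies \<open>rs_int\<close> in \<open>mellin_mordell\<close>. Summability of the norms is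
  that of \<open>k powr (-s)\<close>, hence \<open>s > 1\<close>.\<close>

lemma mellin_rs_kernel:
  assumes s: "s > 1"
  defines "\<rho> \<equiv> of_real (Gamma s * (2 * pi) powr (- s)) * cis (- (pi / 4 * s))"
  shows "integrable lborel (\<lambda>q. of_real (Gamma_kernel s q) * rs_kernel q)" (is ?A)
    and "\<rho> * (rs_int (1/2) (of_real s) + zeta (of_real s)) = (\<integral>q. of_real (Gamma_kernel s q) * rs_kernel q \<partial>lborel)" (is ?B)
proof -
  define f where "f = (\<lambda>k q. of_real (Gamma_kernel s q) * exp (- (2 * pi * real (Suc k) * e8) * of_real q))"
  define S where "S = (\<lambda>q. \<Sum>k. f k q)"
  have s0: "s > 0" using s by simp
  have Re_e: "Re (2 * pi * real (Suc k) * e8) = real (Suc k) * (2 * pi / sqrt 2)" for k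
    by (simp add: e8_eq)
  have pos: "real (Suc k) * (2 * pi / sqrt 2) > 0" for k by simp
  have fi: "integrable lborel (f k)" for k
    unfolding f_def by (rule Gamma_kernel_exp_integrable[OF s0]) (unfold Re_e, rule pos)
  have nf: "norm (f k q) = Gamma_kernel s q * exp (- (real (Suc k) * (2 * pi / sqrt 2)) * q)" for k q
    using Re_e[of k] by (simp add: f_def norm_mult norm_exp_eq_Re)
  have inf: "(\<integral>q. norm (f k q) \<partial>lborel) = Gamma s * (2 * pi / sqrt 2) powr (- s) * real (Suc k) powr (- s)" for k
    unfolding nf Gamma_kernel_exp_integral_real[OF s0 pos]
    by (subst powr_mult) (auto simp: mult_ac)
  have sm: "summable (\<lambda>k. \<integral>q. norm (f k q) \<partial>lborel)"
  proof -
    have "summable (\<lambda>k. real k powr (- s))" using s by (simp add: summable_real_powr_iff)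
    then have "summable (\<lambda>k. real (Suc k) powr (- s))" by (subst summable_Suc_iff)
    then show ?thesis unfolding inf by (rule summable_mult)
  qed
  have sp: "AE q in lborel. summable (\<lambda>k. norm (f k q))"
  proof (rule AE_I2)
    fix q :: real
    show "summable (\<lambda>k. norm (f k q))"
    proof (cases "q > 0")
      case True
      show ?thesis unfolding f_def norm_mult by (intro summable_mult mordell_ray_eq(2) True)
    qed (simp add: f_def Gamma_kernel_def)
  qed
  have Si: "integrable lborel S" unfolding S_def by (rule integrable_suminf[OF fi sp sm])
  have ss: "(\<lambda>k. \<integral>q. f k q \<partial>lborel) sums (\<integral>q. S q \<partial>lborel)"
    unfolding S_def by (rule sums_integral[OF fi sp sm])
  have fint: "(\<integral>q. f k q \<partial>lborel) = \<rho> * of_nat (Suc k) powr (- of_real s)" for k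
  proof -
    have "(\<integral>q. f k q \<partial>lborel) = Gamma (of_real s) * (2 * pi * real (Suc k) * e8) powr (- of_real s)"
      unfolding f_def by (rule Gamma_kernel_exp_integral[OF s0]) (unfold Re_e, rule pos)
    also have "2 * pi * real (Suc k) * e8 = of_real (2 * pi) * e8 * slant (real (Suc k)) 0"
      by (simp add: slant_def)
    also have "(\<dots>) powr (- of_real s) = of_real ((2 * pi) powr (- s)) * cis (- (pi / 4 * s)) * slant (real (Suc k)) 0 powr (- of_real s)"
      by (rule powr_e8_slant) auto
    also have "slant (real (Suc k)) 0 = of_nat (Suc k)" by (simp add: slant_def)
    finally show ?thesis by (simp add: \<rho>_def Gamma_complex_of_real)
  qed
  have "(\<lambda>k. \<rho> * of_nat (Suc k) powr (- of_real s)) sums (\<rho> * zeta (of_real s))"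
    using s by (intro sums_mult zeta_sums) auto
  then have IS: "(\<integral>q. S q \<partial>lborel) = \<rho> * zeta (of_real s)"
    using ss unfolding fint by (rule sums_unique2[rotated])
  have eq: "of_real (Gamma_kernel s q) * rs_kernel q = of_real (Gamma_kernel s q) * mordell_ray q + S q" for q
  proof (cases "q > 0")
    case True
    have "summable (\<lambda>k. exp (- (2 * pi * real (Suc k) * e8) * of_real q))"
      using mordell_ray_eq(2)[OF True] by (rule summable_norm_cancel)
    then have "S q = of_real (Gamma_kernel s q) * (\<Sum>k. exp (- (2 * pi * real (Suc k) * e8) * of_real q))"
      unfolding S_def f_def by (rule suminf_mult)
    moreover have "k * r = k * m + k * S" if "m = r - S" for k r m S :: complex
      unfolding that by (simp add: algebra_simps)
    ultimately show ?thesis using mordell_ray_eq(1)[OF True] by metis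
  qed (simp add: S_def f_def Gamma_kernel_def)
  show ?A unfolding eq using mellin_mordell(1)[OF s0] Si by simp
  show ?B unfolding eq
    using mellin_mordell[OF s0] Si IS by (simp add: \<rho>_def algebra_simps)
qed

section \<open>The dual integral and the formula for real s between 2 and 3\<close>

lemma Ln_cis:
  assumes "- pi < t" "t \<le> pi" shows "Ln (cis t) = \<i> * of_real t"
  by (rule Ln_unique) (use assms in \<open>auto simp: cis_conv_exp\<close>)

lemma cis_powr:
  assumes "- pi < t" "t \<le> pi" shows "cis t powr of_real a = cis (t * a)"
  using assms by (simp add: powr_def Ln_cis cis_conv_exp mult_ac)

lemma of_real_cis_powr:
  assumes "q > 0" "- pi < t" "t \<le> pi"
  shows "(of_real q * cis t) powr of_real a = of_real (q powr a) * cis (t * a)"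
  using assms by (subst powr_times_real_left) (simp_all add: cis_powr powr_of_real)

text \<open>The value of the dual integral is found by letting the line pass through the origin.\<close>
lemma rs_int_dual:
  assumes s: "2 < s" "s < 3"
  shows "rs_int (1/2) (1 - of_real s)
    = - (2 * cos (of_real (pi * s / 2)) * cis (- (pi * s / 4)) * cnj (\<integral>q. of_real (Gamma_kernel s q) * rs_kernel q \<partial>lborel))"
proof -
  define h where "h = (\<lambda>x::complex. x powr of_real (s - 1))"
  have hx: "h x = x powr (- (1 - of_real s))" for x by (simp add: h_def)
  have h1: "rs_int c (1 - of_real s) = line_int c h" for c
    unfolding rs_int_def hx[abs_def] ..
  obtain \<kappa> where k: "\<kappa> > 0" "\<And>c r. c \<in> {0..3/4} \<Longrightarrow> \<kappa> * norm (slant c r) \<le> norm (sin (of_real pi * slant c r))"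
    using sin_slant_lower by blast
  obtain \<kappa>1 where k1: "line_bound (1/2) \<kappa>1" using line_bound_small[of "1/2"] by force
  have hholo: "h holomorphic_on {x. 0 < Re x - Im x}"
    unfolding h_def by (intro holomorphic_intros) (auto simp: complex_nonpos_Reals_iff)
  \<comment> \<open>No integer lies between \<open>c\<close> and 1/2, so all these lines give the
    same value and the limit \<open>c \<rightarrow> 0\<close> can be taken.\<close>
  have const: "line_int c h = rs_int (1/2) (1 - of_real s)" if c: "0 < c" "c < 1/2" for c
  proof -
    obtain \<kappa>2 where k2: "line_bound c \<kappa>2" using line_bound_small[of c] c by force
    have "rs_int (1/2) (1 - of_real s) - rs_int c (1 - of_real s) = (\<Sum>n | c < real n \<and> real n < 1/2. of_nat n powr (- (1 - of_real s)))"
      by (rule rs_int_shift[OF c k2 k1])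
    also have "{n. c < real n \<and> real n < 1/2} = {}"
    proof -
      have "\<not> (c < real n \<and> real n < 1/2)" for n using c by (cases n) auto
      then show ?thesis by blast
    qed
    finally show ?thesis by (simp add: h1)
  qed
  define L where "L = (\<lambda>c r. line_integrand h (slant c r))"
  have Lm: "L c \<in> borel_measurable lborel" if "c > 0" for c
    using line_integrand_measurable[OF holomorphic_slant_measurable[OF hholo that]] by (simp add: L_def)
  \<comment> \<open>A majorant independent of \<open>c\<close>. The power
    \<open>x powr (s - 1)\<close> supplies a factor \<open>norm x\<close> that absorbs the zero of
    the sine at the origin, and since \<open>2 < s < 3\<close> the remaining power
    \<open>s - 2\<close> lies between 0 and 1.\<close>
  have Lb: "norm (L c r) \<le> 2 / (2 * \<kappa>) * exp (6 * \<bar>r\<bar> - pi * r^2)" if c: "0 < c" "c \<le> 1/2" for c r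
  proof -
    let ?x = "slant c r"
    have x0: "norm ?x > 0" using slant_nonzero c by simp
    have xl: "norm ?x \<le> 1/2 + \<bar>r\<bar>" using norm_slant_le[of c r] c by simp
    have "norm (h ?x) = norm ?x powr (s - 1)" unfolding h_def by (subst norm_powr_real_powr') auto
    also have "\<dots> = norm ?x * norm ?x powr (s - 2)" using x0 by (simp add: powr_diff power2_eq_square field_simps powr_add)
    also have "norm ?x powr (s - 2) \<le> (1 + norm ?x) powr (s - 2)" using s x0 by (intro powr_mono2) auto
    also have "\<dots> \<le> (1 + norm ?x) powr 1" using s x0 by (intro powr_mono) auto
    also have "\<dots> \<le> 2 + \<bar>r\<bar> * 2" using xl x0 by simp
    also have "\<dots> \<le> 2 * exp \<bar>r\<bar>" using exp_ge_add_one_self[of "\<bar>r\<bar>"] by linarith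
    finally have nh: "norm (h ?x) \<le> norm ?x * (2 * exp \<bar>r\<bar>)" using x0 by simp
    have ng: "norm (gauss ?x) \<le> exp (5 * \<bar>r\<bar> - pi * r^2)"
    proof (rule order.trans[OF norm_gauss_slant_le])
      have "c * \<bar>r\<bar> \<le> 1 * \<bar>r\<bar>" using c by (intro mult_right_mono) auto
      then show "exp (5 * \<bar>c\<bar> * \<bar>r\<bar> - pi * r\<^sup>2) \<le> exp (5 * \<bar>r\<bar> - pi * r\<^sup>2)" using c by simp
    qed
    have "norm (L c r) = norm (h ?x) * norm (gauss ?x) / (2 * norm (sin (of_real pi * ?x)))"
      by (simp add: L_def line_integrand_def norm_mult norm_divide)
    also have "\<dots> \<le> (norm ?x * (2 * exp \<bar>r\<bar>)) * exp (5 * \<bar>r\<bar> - pi * r^2) / (2 * (\<kappa> * norm ?x))"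
      using k(2)[of c r] c k(1) x0 by (intro frac_le mult_mono nh ng mult_left_mono mult_pos_pos) auto
    also have "\<dots> = 2 / (2 * \<kappa>) * (exp \<bar>r\<bar> * exp (5 * \<bar>r\<bar> - pi * r^2))" using x0 by simp
    also have "exp \<bar>r\<bar> * exp (5 * \<bar>r\<bar> - pi * r^2) = exp (6 * \<bar>r\<bar> - pi * r^2)" by (simp add: exp_add[symmetric])
    finally show ?thesis .
  qed
  define Q where "Q = (\<lambda>q. of_real (Gamma_kernel s q * exp (- pi * q^2)) / (2 * \<i> * sin (of_real pi * e8 * of_real q)))"
  define J where "J = (\<integral>q. of_real (Gamma_kernel s q) * rs_kernel q \<partial>lborel)"
  \<comment> \<open>The line through the origin consists of two rays with arguments pi/4 and
    \<open>- 3 * pi / 4\<close>; \<open>A\<close> and \<open>B\<close> are the values of the phase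
    of \<open>x powr (s - 1)\<close> on them.\<close>
  define A B where "A = cis (pi / 4 * (s - 1))" and "B = cis (- (3 * pi / 4) * (s - 1))"
  \<comment> \<open>Conjugation sends \<open>e8\<close> to \<open>- \<i> * e8\<close> and so turns
    the hyperbolic sine of \<open>rs_kernel\<close> into the sine of the line integrand. This is
    where the two Mellin integrals become conjugates of each other.\<close>
  have Qc: "Q q = - cnj (of_real (Gamma_kernel s q) * rs_kernel q)" for q
  proof -
    have "cnj (exp (pi * e8 * of_real q) - exp (- (pi * e8 * of_real q))) = exp (- (\<i> * (of_real pi * e8 * of_real q))) - exp (\<i> * (of_real pi * e8 * of_real q))"
      by (simp add: exp_cnj cnj_e8 mult_ac)
    also have "\<dots> = - (2 * \<i> * sin (of_real pi * e8 * of_real q))" by (simp add: sin_exp_eq)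
    finally have c: "cnj (exp (pi * e8 * of_real q) - exp (- (pi * e8 * of_real q))) = - (2 * \<i> * sin (of_real pi * e8 * of_real q))" .
    have "- cnj (of_real (Gamma_kernel s q) * rs_kernel q) = - (of_real (Gamma_kernel s q) * (of_real (exp (- pi * q^2)) / (- (2 * \<i> * sin (of_real pi * e8 * of_real q)))))"
      unfolding c[symmetric] rs_kernel_def by simp
    also have "\<dots> = Q q" by (simp add: Q_def)
    finally show ?thesis by simp
  qed
  have Ji: "integrable lborel (\<lambda>q. of_real (Gamma_kernel s q) * rs_kernel q)" using mellin_rs_kernel(1)[of s] s by simp
  have Qi: "integrable lborel Q" and QJ: "(\<integral>q. Q q \<partial>lborel) = - cnj J"
    unfolding Qc[abs_def] J_def
    by (intro Bochner_Integration.integrable_minus integrable_cnj Ji)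
       (simp only: Bochner_Integration.integral_minus Bochner_Integration.integral_cnj)
  have split: "L 0 r = A * Q r - B * Q (- r)" if "r \<noteq> 0" for r
  proof -
    have l0: "slant 0 r = e8 * of_real r" by (simp add: slant_def)
    show ?thesis
    proof (cases "r > 0")
      case True
      have "h (slant 0 r) = of_real (r powr (s - 1)) * A"
        unfolding h_def l0 A_def e8_def mult.commute[of "cis (pi / 4)"]
        by (rule of_real_cis_powr) (use True pi_gt_zero in auto)
      then show ?thesis using True
        unfolding L_def line_integrand_def l0 gauss_e8 by (simp add: Q_def Gamma_kernel_def mult_ac)
    next
      case False
      then have r: "r < 0" using that by simp
      have me: "e8 * of_real r = of_real (- r) * cis (- (3 * pi / 4))"
      proof -
        have "cis (- (3 * pi / 4)) = cis (pi / 4 + - pi)" by simp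
        also have "\<dots> = cis (pi / 4) * cis (- pi)" by (rule cis_mult[symmetric])
        also have "cis (- pi) = -1" by (simp add: complex_eq_iff)
        also have "cis (pi / 4) * -1 = - e8" by (simp add: e8_def)
        finally show ?thesis by simp
      qed
      have "h (slant 0 r) = of_real ((- r) powr (s - 1)) * B"
        unfolding h_def l0 B_def me minus_mult_left
        by (rule of_real_cis_powr) (use r pi_gt_zero in linarith)+
      moreover have "sin (of_real pi * (e8 * of_real r)) = - sin (of_real pi * e8 * of_real (- r))"
        by (simp add: mult_ac flip: sin_minus)
      ultimately show ?thesis using r
        unfolding L_def line_integrand_def l0 gauss_e8 by (simp add: Q_def Gamma_kernel_def mult_ac)
    qed
  qed
  \<comment> \<open>The offset 3 keeps every crossing point below 1/2, including the one for
    \<open>n = 0\<close>.\<close>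
  have "(\<lambda>n. \<integral>r. L (1 / (real n + 3)) r \<partial>lborel) \<longlonglongrightarrow> (\<integral>r. A * Q r - B * Q (- r) \<partial>lborel)"
  proof (rule integral_dominated_convergence)
    have [measurable]: "Q \<in> borel_measurable borel" using Qi by auto
    show "(\<lambda>r. A * Q r - B * Q (- r)) \<in> borel_measurable lborel" by measurable
    show "L (1 / (real n + 3)) \<in> borel_measurable lborel" for n by (rule Lm) simp
    show "integrable lborel (\<lambda>r. 2 / (2 * \<kappa>) * exp (6 * \<bar>r\<bar> - pi * r^2))"
      by (intro Bochner_Integration.integrable_mult_right integrable_exp_quadratic)
    show "AE r in lborel. norm (L (1 / (real n + 3)) r) \<le> 2 / (2 * \<kappa>) * exp (6 * \<bar>r\<bar> - pi * r^2)" for n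
      by (intro AE_I2 Lb) (auto simp: field_simps)
    have "AE r in lborel. r \<noteq> (0::real)" by (rule AE_lborel_singleton)
    then show "AE r in lborel. (\<lambda>n. L (1 / (real n + 3)) r) \<longlonglongrightarrow> A * Q r - B * Q (- r)"
    proof eventually_elim
      case (elim r)
      have sl: "(\<lambda>n. slant (1 / (real n + 3)) r) \<longlonglongrightarrow> slant 0 r"
      proof -
        have "(\<lambda>n. 1 / (real n + 3)) \<longlonglongrightarrow> 0" by real_asymp
        then have "(\<lambda>n. complex_of_real (1 / (real n + 3)) + e8 * of_real r) \<longlonglongrightarrow> of_real 0 + e8 * of_real r"
          by (intro tendsto_intros)
        then show ?thesis by (simp add: slant_def)
      qed
      have s0: "slant 0 r \<notin> \<real>\<^sub>\<le>\<^sub>0" using elim by (auto simp: complex_nonpos_Reals_iff Im_slant)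
      have sn: "sin (of_real pi * slant 0 r) \<noteq> 0" using norm_sin_slant_far[of r 0] elim by auto
      have "isCont (line_integrand h) (slant 0 r)"
        unfolding line_integrand_def gauss_def h_def using s0 sn
        by (intro continuous_intros) auto
      then have "(\<lambda>n. L (1 / (real n + 3)) r) \<longlonglongrightarrow> L 0 r"
        unfolding L_def by (rule isCont_tendsto_compose[OF _ sl])
      then show ?case using split[OF elim] by simp
    qed
  qed
  moreover have "(\<integral>r. L (1 / (real n + 3)) r \<partial>lborel) = rs_int (1/2) (1 - of_real s) / e8" for n
    using const[of "1 / (real n + 3)"] by (simp add: line_int_def L_def field_simps)
  ultimately have "rs_int (1/2) (1 - of_real s) / e8 = (\<integral>r. A * Q r - B * Q (- r) \<partial>lborel)"
    by (simp add: LIMSEQ_const_iff)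
  also have "\<dots> = A * (\<integral>r. Q r \<partial>lborel) - B * (\<integral>r. Q (- r) \<partial>lborel)"
    using Qi lborel_integrable_real_affine[OF Qi, of "-1" 0] by simp
  also have "(\<integral>r. Q (- r) \<partial>lborel) = (\<integral>r. Q r \<partial>lborel)"
    by (subst (2) lborel_integral_real_affine[of "-1" _ 0]) auto
  finally have "rs_int (1/2) (1 - of_real s) = - ((e8 * A - e8 * B) * cnj J)"
    unfolding QJ by (simp add: field_simps)
  also have "e8 * A - e8 * B = 2 * cos (of_real (pi * s / 2)) * cis (- (pi * s / 4))"
  proof -
    have "e8 * A = cis (pi * s / 4)"
      unfolding e8_def A_def cis_mult by (rule arg_cong[where f = cis]) (simp add: field_simps)
    moreover have "e8 * B = cis (pi + - (3 * pi * s / 4))"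
      unfolding e8_def B_def cis_mult by (rule arg_cong[where f = cis]) (simp add: field_simps)
    moreover have "cis (pi + - (3 * pi * s / 4)) = - cis (- (3 * pi * s / 4))"
      unfolding cis_mult[symmetric] by simp
    moreover have "2 * cos (complex_of_real (pi * s / 2)) = cis (pi * s / 2) + cis (- (pi * s / 2))"
      by (simp add: cos_exp_eq cis_conv_exp)
    moreover have "(cis (pi * s / 2) + cis (- (pi * s / 2))) * cis (- (pi * s / 4)) = cis (pi * s / 4) + cis (- (3 * pi * s / 4))"
      unfolding distrib_right cis_mult by (simp add: field_simps)
    ultimately show ?thesis by simp
  qed
  finally show ?thesis unfolding J_def .
qed

text \<open>The factor of the functional equation
  \<open>\<zeta>(1 - s) = fe_factor s * \<zeta>(s)\<close>.\<close>

definition fe_factor :: "complex \<Rightarrow> complex" where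
  "fe_factor s = 2 * Gamma s * cos (of_real pi * s / 2) * of_real (2 * pi) powr (- s)"

text \<open>The Mellin transform of \<open>rs_kernel\<close> occurs in
  \<open>mellin_rs_kernel\<close> and, conjugated, in \<open>rs_int_dual\<close>; eliminating it
  leaves this relation.\<close>

lemma riemann_siegel_real:
  assumes s: "2 < s" "s < 3"
  shows "fe_factor (of_real s) * (zeta (of_real s) + rs_int (1/2) (of_real s)) = - cnj (rs_int (1/2) (1 - of_real s))"
proof -
  define J where "J = (\<integral>q. of_real (Gamma_kernel s q) * rs_kernel q \<partial>lborel)"
  define \<rho> where "\<rho> = complex_of_real (Gamma s * (2 * pi) powr (- s)) * cis (- (pi / 4 * s))"
  have J: "\<rho> * (rs_int (1/2) (of_real s) + zeta (of_real s)) = J"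
    unfolding \<rho>_def J_def using s by (intro mellin_rs_kernel) auto
  have "cis (- (pi / 4 * s)) * cis (pi * s / 4) = 1" by (simp add: cis_mult)
  then have "fe_factor (of_real s) = 2 * cos (of_real (pi * s / 2)) * cis (pi * s / 4) * \<rho>"
    unfolding fe_factor_def \<rho>_def using s by (simp add: Gamma_complex_of_real powr_of_real[symmetric] mult_ac)
  then have "fe_factor (of_real s) * (zeta (of_real s) + rs_int (1/2) (of_real s)) = 2 * cos (of_real (pi * s / 2)) * cis (pi * s / 4) * J"
    unfolding J[symmetric] by (simp add: algebra_simps)
  also have "\<dots> = - cnj (rs_int (1/2) (1 - of_real s))"
    unfolding rs_int_dual[OF s] J_def[symmetric] by (simp add: cis_cnj cnj_cos)
  finally show ?thesis .
qed

text \<open>The double conjugation makes \<open>cnj (rs_int (1/2) (1 - cnj s))\<close> holomorphic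
  in \<open>s\<close>, so the identity on the real interval from 2 to 3 extends to the half-plane
  without 1, which is connected.\<close>

lemma riemann_siegel_formula:
  assumes s: "Re s > 0" "s \<noteq> 1"
  shows "fe_factor s * (zeta s + rs_int (1/2) s) = - cnj (rs_int (1/2) (1 - cnj s))"
proof -
  obtain \<kappa> where k: "line_bound (1/2) \<kappa>" using line_bound_small[of "1/2"] by force
  have R: "rs_int (1/2) holomorphic_on UNIV" by (rule rs_int_holomorphic[OF _ k]) simp
  let ?W = "{s. Re s > 0} - {1::complex}"
  define f where "f = (\<lambda>s. fe_factor s * (zeta s + rs_int (1/2) s) + cnj (rs_int (1/2) (1 - cnj s)))"
  have "f s = 0"
  proof (rule analytic_continuation[of f ?W "complex_of_real ` {2<..<3}" "of_real (5/2)"])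
    have "zeta holomorphic_on ?W"
      using is_zeta_continuation_zeta unfolding is_zeta_continuation_def
      by (elim conjE holomorphic_on_subset) auto
    moreover have "rs_int (1/2) holomorphic_on ?W" using R holomorphic_on_subset by blast
    moreover have "(\<lambda>s. cnj (rs_int (1/2) (1 - cnj s))) holomorphic_on ?W"
    proof -
      have "(\<lambda>s. rs_int (1/2) (1 - s)) holomorphic_on cnj ` ?W"
        by (rule holomorphic_on_compose[unfolded o_def, OF _ holomorphic_on_subset[OF R]])
           (auto intro!: holomorphic_intros)
      from holomorphic_on_compose_cnj_cnj[OF this open_delete[OF open_halfspace_Re_gt]] show ?thesis by (simp add: o_def)
    qed
    moreover have "fe_factor holomorphic_on ?W"
      unfolding fe_factor_def by (intro holomorphic_intros) (auto elim!: nonpos_Ints_cases)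
    ultimately show "f holomorphic_on ?W" unfolding f_def by (intro holomorphic_intros)
    show "open ?W" by (intro open_delete open_halfspace_Re_gt)
    show "connected ?W"
      by (intro connected_open_delete open_halfspace_Re_gt convex_connected convex_halfspace_Re_gt) simp
    show "complex_of_real (5/2) islimpt complex_of_real ` {2<..<3}"
    proof -
      have "(5/2::real) islimpt {2<..<3}"
        by (rule interior_limit_point) (simp add: interior_open)
      then obtain g where g: "\<forall>n. g n \<in> {2<..<3} - {5/2::real}" "g \<longlonglongrightarrow> 5/2"
        unfolding islimpt_sequential by blast
      have a1: "(\<lambda>n. complex_of_real (g n)) \<longlonglongrightarrow> of_real (5/2)" using g(2) by (intro tendsto_of_real)
      have a2: "complex_of_real (g n) \<in> complex_of_real ` {2<..<3} - {of_real (5/2)}" for n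
        using g(1)[rule_format, of n] by (simp only: Diff_iff singleton_iff of_real_eq_iff imageI not_False_eq_True)
      show ?thesis unfolding islimpt_sequential
        by (rule exI[of _ "\<lambda>n. complex_of_real (g n)"]) (intro conjI allI a1 a2)
    qed
    show "complex_of_real ` {2<..<3} \<subseteq> ?W" by auto
    fix z assume "z \<in> complex_of_real ` {2<..<3}"
    then obtain x where x: "z = of_real x" "2 < x" "x < 3" by auto
    show "f z = 0" using riemann_siegel_real[OF x(2,3)] unfolding f_def x(1) by simp
  qed (use s in \<open>auto simp: complex_eq_iff\<close>)
  then show ?thesis unfolding f_def by (simp add: eq_neg_iff_add_eq_0)
qed

text \<open>With \<open>z = s / 2\<close>, duplication and reflection reduce the factor to a power
  of pi times \<open>Gamma z / Gamma (1/2 - z)\<close>. On the critical line \<open>1/2 - z\<close>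
  is the conjugate of \<open>z\<close>, so the quotient is a pure phase, twice the imaginary part of
  \<open>ln_Gamma z\<close>.\<close>

lemma fe_factor_critical:
  "fe_factor (1/2 + \<i> * of_real t) = exp (2 * \<i> * of_real (RS_theta t))"
proof -
  define s where "s = 1/2 + \<i> * complex_of_real t"
  define z where "z = 1/4 + \<i> * complex_of_real (t / 2)"
  have sz: "s = 2 * z" by (simp add: s_def z_def)
  have cz: "1/2 - z = cnj z" by (simp add: z_def complex_eq_iff)
  have zn: "z \<notin> \<int>\<^sub>\<le>\<^sub>0" "z + 1/2 \<notin> \<int>\<^sub>\<le>\<^sub>0"
    by (auto simp: z_def complex_eq_iff elim!: nonpos_Ints_cases)
  have Gz: "Gamma z \<noteq> 0" "Gamma (z + 1/2) \<noteq> 0" using zn by (auto simp: Gamma_eq_zero_iff)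
  have dup: "Gamma z * Gamma (z + 1/2) = exp ((1 - 2*z) * of_real (ln 2)) * of_real (sqrt pi) * Gamma s"
    using Gamma_legendre_duplication[OF zn] unfolding sz .
  have refl: "Gamma (z + 1/2) * Gamma (cnj z) = of_real pi / cos (of_real pi * z)"
  proof -
    have "1 - (z + 1/2) = cnj z" using cz by (simp add: algebra_simps)
    moreover have "sin (of_real pi * (z + 1/2)) = cos (of_real pi * z)"
      by (simp add: distrib_left sin_add)
    ultimately show ?thesis using Gamma_reflection_complex[of "z + 1/2"] by simp
  qed
  have cn: "cos (of_real pi * z) \<noteq> 0"
  proof
    assume "cos (of_real pi * z) = 0"
    with refl have "Gamma (z + 1/2) * Gamma (cnj z) = 0" by simp
    then show False using Gz by (simp flip: cnj_Gamma)
  qed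
  have "of_real pi = Gamma (z + 1/2) * Gamma (cnj z) * cos (of_real pi * z)" using refl cn by simp
  define X where "X = exp ((1 - 2*z) * complex_of_real (ln 2)) * of_real (sqrt pi)"
  have X0: "X \<noteq> 0" by (simp add: X_def)
  have Gs: "Gamma s = Gamma z * Gamma (z + 1/2) / X" using dup X0 by (simp add: X_def field_simps)
  have "fe_factor s = 2 * (Gamma z * Gamma (z + 1/2) / X) * cos (of_real pi * z) * of_real (2 * pi) powr (- s)"
    unfolding fe_factor_def Gs by (simp add: sz)
  also have "\<dots> = 2 * (Gamma z / Gamma (cnj z)) * (Gamma (z + 1/2) * Gamma (cnj z) * cos (of_real pi * z)) / X * of_real (2 * pi) powr (- s)"
    using Gz by (simp flip: cnj_Gamma)
  also have "Gamma (z + 1/2) * Gamma (cnj z) * cos (of_real pi * z) = of_real pi" using refl cn by simp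
  also have "2 * (Gamma z / Gamma (cnj z)) * of_real pi / X * of_real (2 * pi) powr (- s)
     = (Gamma z / Gamma (cnj z)) * (of_real (2 * pi) / X * of_real (2 * pi) powr (- s))" by simp
  also have "of_real (2 * pi) / X * of_real (2 * pi) powr (- s) = exp (- \<i> * of_real t * of_real (ln pi))"
  proof -
    have a: "complex_of_real (2 * pi) = exp (of_real (ln 2 + ln pi))" by (simp only: exp_of_real exp_add) simp
    have b: "complex_of_real (sqrt pi) = exp (of_real (ln pi / 2))"
      by (simp only: exp_of_real) (simp add: powr_half_sqrt[symmetric] powr_def)
    have c: "complex_of_real (2 * pi) powr (- s) = exp (- s * of_real (ln 2 + ln pi))"
    proof -
      have "Ln (complex_of_real (2 * pi)) = of_real (ln (2 * pi))" by (rule Ln_of_real) simp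
      also have "ln (2 * pi) = ln 2 + ln pi" by (simp add: ln_mult)
      finally show ?thesis by (simp only: powr_def) simp
    qed
    show ?thesis unfolding X_def b c unfolding a exp_add[symmetric] exp_diff[symmetric]
      by (rule arg_cong[where f = exp]) (simp add: s_def z_def field_simps)
  qed
  also have "Gamma z / Gamma (cnj z) = exp (2 * \<i> * of_real (Im (ln_Gamma z)))"
  proof -
    have G1: "Gamma z = exp (ln_Gamma z)" using zn by (simp add: Gamma_complex_altdef)
    have "Gamma (cnj z) = cnj (Gamma z)" by (rule cnj_Gamma[symmetric])
    also have "\<dots> = exp (cnj (ln_Gamma z))" unfolding G1 by (simp add: exp_cnj)
    finally have "Gamma z / Gamma (cnj z) = exp (ln_Gamma z) / exp (cnj (ln_Gamma z))" using G1 by simp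
    then have "Gamma z / Gamma (cnj z) = exp (ln_Gamma z - cnj (ln_Gamma z))" by (simp add: exp_diff)
    also have "ln_Gamma z - cnj (ln_Gamma z) = 2 * \<i> * of_real (Im (ln_Gamma z))" by (simp add: complex_eq_iff)
    finally show ?thesis .
  qed
  finally show ?thesis unfolding s_def[symmetric] exp_add[symmetric]
    by (simp add: RS_theta_def z_def) (simp add: algebra_simps exp_diff exp_add exp_minus)
qed

text \<open>On the critical line \<open>1 - cnj s = s\<close>, so the Riemann-Siegel formula relates
  \<open>rs_int (1/2) s\<close> to its own conjugate; multiplied by
  \<open>exp (- \<i> * \<theta>)\<close> it shows \<open>Z\<close> as a number plus its conjugate.
  Moving the line from 1/2 to \<open>c\<close> then brings in the partial sum.\<close>

lemma hardy_Z_eq: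
  assumes t: "t > 0" and c: "c > 1/2" "line_bound c \<kappa>"
  shows "hardy_Z t = 2 * Re (exp (\<i> * of_real (RS_theta t)) *
     ((\<Sum>n | 0 < n \<and> real n < c. of_nat n powr (- (1/2 + \<i> * of_real t))) - rs_int c (1/2 + \<i> * of_real t)))"
proof -
  obtain \<kappa>1 where k: "line_bound (1/2) \<kappa>1" using line_bound_small[of "1/2"] by force
  define s where "s = 1/2 + \<i> * complex_of_real t"
  define \<theta> where "\<theta> = RS_theta t"
  define Y where "Y = - rs_int (1/2) s"
  have "rs_int c s - rs_int (1/2) s = (\<Sum>n | 1/2 < real n \<and> real n < c. of_nat n powr (- s))"
    by (rule rs_int_shift[OF _ c(1) k c(2)]) simp
  also have "{n. 1/2 < real n \<and> real n < c} = {n. 0 < n \<and> real n < c}" by auto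
  finally have Y: "Y = (\<Sum>n | 0 < n \<and> real n < c. of_nat n powr (- s)) - rs_int c s"
    by (simp add: Y_def algebra_simps)
  have cs: "1 - cnj s = s" by (simp add: s_def complex_eq_iff)
  have s1: "Re s > 0" "s \<noteq> 1" by (auto simp: s_def complex_eq_iff)
  have "exp (2 * \<i> * of_real \<theta>) * (zeta s - Y) = cnj Y"
    using riemann_siegel_formula[OF s1] fe_factor_critical[of t] unfolding cs by (simp add: s_def Y_def \<theta>_def)
  then have "exp (- (\<i> * of_real \<theta>)) * (exp (2 * \<i> * of_real \<theta>) * (zeta s - Y)) = exp (- (\<i> * of_real \<theta>)) * cnj Y" by simp
  also have "exp (- (\<i> * of_real \<theta>)) * (exp (2 * \<i> * of_real \<theta>) * (zeta s - Y)) = exp (\<i> * of_real \<theta>) * (zeta s - Y)"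
    by (simp add: mult.assoc[symmetric] exp_add[symmetric])
  also have "exp (- (\<i> * of_real \<theta>)) * cnj Y = cnj (exp (\<i> * of_real \<theta>) * Y)" by (simp add: exp_cnj)
  finally have "exp (\<i> * of_real \<theta>) * zeta s = exp (\<i> * of_real \<theta>) * Y + cnj (exp (\<i> * of_real \<theta>) * Y)"
    by (simp add: algebra_simps)
  also have "\<dots> = 2 * Re (exp (\<i> * of_real \<theta>) * Y)" by (rule complex_add_cnj)
  finally show ?thesis unfolding hardy_Z_def Y s_def \<theta>_def .
qed

section \<open>The remainder in the Riemann--Siegel formula\<close>

text \<open>After division by \<open>c\<close> the line depends only on
  \<open>v = r / (sqrt 2 * c)\<close>; this is the derivative of the argument along the rescaled
  line.\<close>

lemma has_real_derivative_Im_Ln_slant: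
  fixes v :: real
  shows "((\<lambda>v. Im (Ln (Complex (1 + v) v))) has_real_derivative 1 / (1 + 2 * v + 2 * v^2)) (at v)"
proof -
  have C: "Complex (1 + v) v = 1 + (1 + \<i>) * of_real v" for v by (simp add: complex_eq_iff)
  have nn: "Complex (1 + v) v \<notin> \<real>\<^sub>\<le>\<^sub>0" by (auto simp: complex_nonpos_Reals_iff)
  have "((\<lambda>z. Ln (1 + (1 + \<i>) * z)) has_field_derivative (1 + \<i>) / (1 + (1 + \<i>) * of_real v)) (at (of_real v))"
    using nn unfolding C by (auto intro!: derivative_eq_intros simp: field_simps)
  then have "((\<lambda>v. Ln (Complex (1 + v) v)) has_vector_derivative (1 + \<i>) / Complex (1 + v) v) (at v)"
    unfolding C by (rule has_vector_derivative_real_field)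
  then have "((\<lambda>v. Im (Ln (Complex (1 + v) v))) has_vector_derivative Im ((1 + \<i>) / Complex (1 + v) v)) (at v)"
    by (rule bounded_linear.has_vector_derivative[OF bounded_linear_Im])
  also have "Im ((1 + \<i>) / Complex (1 + v) v) = 1 / (1 + 2 * v + 2 * v^2)"
  proof -
    have "(1 + v)\<^sup>2 + v\<^sup>2 = 1 + 2 * v + 2 * v^2" by (simp add: power2_eq_square algebra_simps)
    then show ?thesis by (simp add: Im_divide)
  qed
  finally show ?thesis by (simp add: has_real_derivative_iff_has_vector_derivative)
qed

lemma quadratic_pos: "1 + 2 * v + 2 * v^2 \<ge> (1/2 :: real)"
proof -
  have "1 + 2 * v + 2 * v^2 = 1/2 + 2 * (v + 1/2)^2" by (simp add: power2_eq_square algebra_simps)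
  then show ?thesis by simp
qed

text \<open>The difference of the two sides has a derivative of the sign opposite to
  \<open>v\<close>, so its maximum is the value 0 at \<open>v = 0\<close>. When the line meets the
  saddle point exactly, the left-hand side times \<open>t\<close> is the exponent of the integrand,
  and the right-hand side is Gaussian decay.\<close>

lemma Im_Ln_slant_le: "Im (Ln (Complex (1 + v) v)) - v - v^2 \<le> - (v^2) / 2"
proof -
  define \<phi> where "\<phi> = (\<lambda>v. Im (Ln (Complex (1 + v) v)) - v - v^2 / 2)"
  define \<phi>' where "\<phi>' = (\<lambda>v::real. 1 / (1 + 2 * v + 2 * v^2) - 1 - v)"
  have d: "(\<phi> has_real_derivative \<phi>' v) (at v)" for v
    unfolding \<phi>_def \<phi>'_def
    by (rule DERIV_cong[OF DERIV_diff[OF DERIV_diff[OF has_real_derivative_Im_Ln_slant DERIV_ident] DERIV_cdivide[OF DERIV_pow[of 2]]]]) simp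
  have \<phi>': "\<phi>' v = - v * ((3 + 4 * v + 2 * v^2) / (1 + 2 * v + 2 * v^2))" for v
    using quadratic_pos[of v] unfolding \<phi>'_def by (simp add: field_simps power2_eq_square)
  have p: "(3 + 4 * v + 2 * v^2) / (1 + 2 * v + 2 * v^2) \<ge> 0" for v :: real
  proof -
    have e: "3 + 4 * v + 2 * v^2 = 1 + 2 * (v + 1)^2" by (simp add: power2_eq_square algebra_simps)
    have "3 + 4 * v + 2 * v^2 \<ge> 0" unfolding e by (intro add_nonneg_nonneg) auto
    then show ?thesis using quadratic_pos[of v] by (intro divide_nonneg_nonneg) auto
  qed
  have "\<phi> v \<le> \<phi> 0"
  proof (cases "v \<ge> 0")
    case True
    show ?thesis
    proof (rule DERIV_nonpos_imp_nonincreasing[OF True])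
      fix x assume "0 \<le> x" "x \<le> v"
      then have "\<phi>' x \<le> 0" unfolding \<phi>' using p[of x] by (simp add: mult_nonneg_nonneg)
      then show "\<exists>y. (\<phi> has_real_derivative y) (at x) \<and> y \<le> 0" using d by blast
    qed
  next
    case False
    show ?thesis
    proof (rule DERIV_nonneg_imp_nondecreasing[where f = \<phi> and a = v and b = 0])
      show "v \<le> 0" using False by simp
      fix x assume "v \<le> x" "x \<le> 0"
      then have "\<phi>' x \<ge> 0" unfolding \<phi>' using p[of x] by (intro mult_nonneg_nonneg) auto
      then show "\<exists>y. (\<phi> has_real_derivative y) (at x) \<and> y \<ge> 0" using d by blast
    qed
  qed
  also have "\<phi> 0 = 0" by (simp add: \<phi>_def flip: one_complex.code)
  finally show ?thesis by (simp add: \<phi>_def)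
qed

lemma abs_Im_Ln_slant_le: "\<bar>Im (Ln (Complex (1 + v) v))\<bar> \<le> 2 * \<bar>v\<bar>"
proof -
  have "norm (Im (Ln (Complex (1 + v) v)) - Im (Ln (Complex (1 + 0) 0))) \<le> 2 * norm (v - 0)"
  proof (rule field_differentiable_bound[of UNIV])
    show "((\<lambda>v. Im (Ln (Complex (1 + v) v))) has_real_derivative 1 / (1 + 2 * z + 2 * z^2)) (at z within UNIV)" for z
      using has_real_derivative_Im_Ln_slant by simp
    show "norm (1 / (1 + 2 * z + 2 * z^2)) \<le> 2" for z :: real
      using quadratic_pos[of z] by (simp add: field_simps)
  qed auto
  then show ?thesis by (simp flip: one_complex.code)
qed

text \<open>
  Exponent of the integrand on the line through a point near the saddle point \<open>sqrt (t / (2 * pi))\<close>,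
  where the line is a path of steepest descent.
\<close>
lemma rs_exponent_le:
  assumes t: "t > 0" and c: "c \<ge> 1" and near: "\<bar>c - sqrt (t / (2 * pi))\<bar> \<le> 1"
  shows "t * Im (Ln (slant c r)) - pi * (r^2 + sqrt 2 * c * r) \<le> 40 * \<bar>r\<bar> - pi * r^2 / 2"
proof -
  define v where "v = r / (sqrt 2 * c)"
  define A where "A = Im (Ln (Complex (1 + v) v))"
  have c0: "c > 0" using c by simp
  have rv: "r = sqrt 2 * c * v" using c0 by (simp add: v_def)
  have sc: "slant c r = of_real c * Complex (1 + v) v"
    unfolding rv by (simp add: complex_eq_iff Re_slant Im_slant algebra_simps)
  have nz: "Complex (1 + v) v \<noteq> 0" by (auto simp: complex_eq_iff)
  have A: "Im (Ln (slant c r)) = A"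
    unfolding sc A_def using Ln_times_of_real[OF c0 nz] c0 by (simp add: Ln_of_real)
  define u where "u = sqrt (t / (2 * pi))"
  have u: "u \<ge> 0" "t = 2 * pi * u^2" using t by (simp_all add: u_def)
  \<comment> \<open>Missing the saddle by at most 1 makes \<open>t - 2 * pi * c^2\<close> of order
    \<open>c\<close>, because \<open>u + c \<le> 3 * c\<close>. The argument is of order
    \<open>\<bar>r\<bar> / c\<close>, so the loss is linear in \<open>\<bar>r\<bar>\<close>; the 40
    of the statement bounds \<open>12 * pi\<close>.\<close>
  have "t - 2 * pi * c^2 = 2 * pi * ((u - c) * (u + c))" unfolding u(2) by (simp add: power2_eq_square algebra_simps)
  then have "\<bar>t - 2 * pi * c^2\<bar> = 2 * pi * (\<bar>u - c\<bar> * (u + c))"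
    using u(1) c0 by (simp add: abs_mult)
  also have "\<dots> \<le> 2 * pi * (1 * (3 * c))"
    using near u(1) c unfolding u_def[symmetric] by (intro mult_left_mono mult_mono) auto
  finally have tc: "\<bar>t - 2 * pi * c^2\<bar> \<le> 6 * pi * c" by simp
  have "(t - 2 * pi * c^2) * A \<le> \<bar>t - 2 * pi * c^2\<bar> * \<bar>A\<bar>" by (metis abs_ge_self abs_mult)
  also have "\<dots> \<le> (6 * pi * c) * (2 * \<bar>v\<bar>)"
    using tc abs_Im_Ln_slant_le[of v] unfolding A_def by (intro mult_mono) auto
  also have "\<dots> = 12 * pi / sqrt 2 * \<bar>r\<bar>" unfolding v_def using c0 by (simp add: abs_mult)
  also have "\<dots> \<le> 40 * \<bar>r\<bar>"
  proof (intro mult_right_mono)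
    have "12 * pi / sqrt 2 \<le> 12 * pi / 1" by (intro divide_left_mono) auto
    also have "\<dots> \<le> 40" using pi_approx by simp
    finally show "12 * pi / sqrt 2 \<le> 40" .
  qed simp
  finally have 1: "(t - 2 * pi * c^2) * A \<le> 40 * \<bar>r\<bar>" .
  have "2 * pi * c^2 * (A - v - v^2) \<le> 2 * pi * c^2 * (- (v^2) / 2)"
    using Im_Ln_slant_le[of v] unfolding A_def by (intro mult_left_mono) auto
  also have "\<dots> = - (pi * r^2 / 2)" unfolding rv by (simp add: power2_eq_square)
  finally have 2: "2 * pi * c^2 * (A - v - v^2) \<le> - (pi * r^2 / 2)" .
  have "pi * (r^2 + sqrt 2 * c * r) = 2 * pi * c^2 * (v + v^2)" unfolding rv by (simp add: power2_eq_square algebra_simps)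
  then have "t * Im (Ln (slant c r)) - pi * (r^2 + sqrt 2 * c * r) = (t - 2 * pi * c^2) * A + 2 * pi * c^2 * (A - v - v^2)"
    unfolding A by (simp add: algebra_simps)
  with 1 2 show ?thesis by simp
qed

text \<open>The whole saving is \<open>norm x powr (-1/2)\<close>, bounded through the distance of
  the line from the origin, which is of order \<open>sqrt t\<close>. The other factors are dominated
  by one integrable function and one lower bound for the sine, both independent of
  \<open>t\<close>.\<close>

lemma rs_int_bound:
  "\<exists>C>0. \<forall>(N::nat) \<theta> t. \<theta> \<in> {1/4..3/4} \<longrightarrow> t \<ge> 100 \<longrightarrow> \<bar>real N + \<theta> - sqrt (t / (2 * pi))\<bar> \<le> 1 \<longrightarrow>
     norm (rs_int (real N + \<theta>) (1/2 + \<i> * of_real t)) \<le> C * t powr (- 1/4)"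
proof -
  obtain \<kappa> where k: "\<kappa> > 0" "\<forall>N::nat. \<forall>\<theta>\<in>{1/4..3/4}. line_bound (real N + \<theta>) \<kappa>"
    using line_bound_uniform by blast
  define E where "E = (\<lambda>r::real. exp (40 * \<bar>r\<bar> - pi * r^2 / 2))"
  have E: "integrable lborel E"
  proof -
    have "integrable lborel (\<lambda>r::real. exp (40 * sqrt 2 * \<bar>0 + 1 / sqrt 2 * r\<bar> - pi * (0 + 1 / sqrt 2 * r)^2))"
      by (rule lborel_integrable_real_affine[OF integrable_exp_quadratic]) simp
    then show ?thesis by (simp add: E_def abs_mult power_divide)
  qed
  define I where "I = (\<integral>r. E r \<partial>lborel)"
  have I0: "I \<ge> 0" unfolding I_def E_def by (intro integral_nonneg_AE) auto
  define C where "C = sqrt 8 / (2 * \<kappa>) * I + 1"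
  show ?thesis
  proof (intro exI[of _ C] conjI allI impI)
    show "C > 0" using I0 k by (simp add: C_def add_nonneg_pos)
    fix N :: nat and \<theta> t :: real
    assume \<theta>: "\<theta> \<in> {1/4..3/4}" and t: "t \<ge> 100" and near: "\<bar>real N + \<theta> - sqrt (t / (2 * pi))\<bar> \<le> 1"
    define c where "c = real N + \<theta>"
    define s where "s = 1/2 + \<i> * complex_of_real t"
    have lb: "line_bound c \<kappa>" using k(2) \<theta> by (simp add: c_def)
    have u: "sqrt (t / (2 * pi)) \<ge> 2"
    proof (rule real_le_rsqrt)
      have "8 * pi \<le> 100" using pi_approx by simp
      then show "2^2 \<le> t / (2 * pi)" using t by (simp add: field_simps)
    qed
    \<comment> \<open>Since the saddle point is at least 2, being within 1 of it forces
      \<open>c\<close> to be at least half of it and at least 1.\<close>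
    have cu: "c \<ge> sqrt (t / (2 * pi)) / 2" "c \<ge> 1" using near u unfolding c_def by linarith+
    have c8: "c / sqrt 2 \<ge> sqrt t / 8"
    proof -
      have "2 * (sqrt (2 * pi) * sqrt 2) = sqrt (16 * pi)" by (simp add: real_sqrt_mult)
      also have "\<dots> \<le> 8" using pi_less_4 by (intro real_le_lsqrt) auto
      finally have 8: "2 * (sqrt (2 * pi) * sqrt 2) \<le> 8" .
      have "sqrt t / 8 \<le> sqrt t / (2 * (sqrt (2 * pi) * sqrt 2))"
        using 8 t by (intro divide_left_mono) (auto intro!: mult_pos_pos)
      also have "\<dots> = sqrt (t / (2 * pi)) / 2 / sqrt 2" by (simp add: real_sqrt_divide)
      also have "\<dots> \<le> c / sqrt 2" using cu by (intro divide_right_mono) auto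
      finally show ?thesis .
    qed
    have b: "norm (line_integrand (\<lambda>x. x powr (- s)) (slant c r)) \<le> (sqrt 8 * t powr (- 1/4)) / (2 * \<kappa>) * E r" for r
    proof -
      let ?x = "slant c r"
      have x0: "?x \<noteq> 0" using slant_nonzero cu by simp
      have "Re (- s * Ln ?x) = - (1/2) * ln (norm ?x) + t * Im (Ln ?x)"
        using x0 by (simp add: s_def Re_Ln)
      then have "norm (?x powr (- s)) = norm ?x powr (- (1/2)) * exp (t * Im (Ln ?x))"
        using x0 by (simp add: powr_def norm_exp_eq_Re exp_add[symmetric])
      then have "norm (?x powr (- s)) * norm (gauss ?x) = norm ?x powr (- (1/2)) * exp (t * Im (Ln ?x) - pi * (r^2 + sqrt 2 * c * r))"
        unfolding norm_gauss_slant by (simp add: mult.assoc exp_add[symmetric])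
      also have "\<dots> \<le> (sqrt t / 8) powr (- (1/2)) * E r"
      proof (intro mult_mono)
        have "c / sqrt 2 \<le> norm ?x" using norm_slant_ge[of c r] cu by simp
        with c8 have "sqrt t / 8 \<le> norm ?x" by (rule order.trans)
        then show "norm ?x powr (- (1/2)) \<le> (sqrt t / 8) powr (- (1/2))" using t by (intro powr_mono2') auto
        show "exp (t * Im (Ln ?x) - pi * (r^2 + sqrt 2 * c * r)) \<le> E r"
          unfolding E_def using rs_exponent_le[of t c r] t cu near by (simp add: c_def)
      qed auto
      also have "(sqrt t / 8) powr (- (1/2)) = sqrt 8 * t powr (- 1/4)"
      proof -
        have "(sqrt t / 8) powr (- (1/2)) = sqrt t powr (- (1/2)) / 8 powr (- (1/2))" using t by (simp add: powr_divide)
        also have "sqrt t powr (- (1/2)) = t powr (- 1/4)" using t by (simp add: powr_half_sqrt[symmetric] powr_powr)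
        also have "(8::real) powr (- (1/2)) = 1 / sqrt 8" by (simp add: powr_minus_divide powr_half_sqrt)
        finally show ?thesis by simp
      qed
      finally have n: "norm (?x powr (- s)) * norm (gauss ?x) \<le> sqrt 8 * t powr (- 1/4) * E r" .
      have "norm (line_integrand (\<lambda>x. x powr (- s)) ?x) = norm (?x powr (- s)) * norm (gauss ?x) / (2 * norm (sin (of_real pi * ?x)))"
        by (simp add: line_integrand_def norm_mult norm_divide)
      also have "\<dots> \<le> (sqrt 8 * t powr (- 1/4) * E r) / (2 * \<kappa>)"
        using lb k(1) n unfolding line_bound_def by (intro frac_le) (auto simp: E_def)
      finally show ?thesis by simp
    qed
    have "norm (rs_int c s) = norm (\<integral>r. line_integrand (\<lambda>x. x powr (- s)) (slant c r) \<partial>lborel)"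
      by (simp add: rs_int_def line_int_def norm_mult)
    also have "\<dots> \<le> (\<integral>r. (sqrt 8 * t powr (- 1/4)) / (2 * \<kappa>) * E r \<partial>lborel)"
    proof (rule Bochner_Integration.integral_norm_bound_integral)
      show "integrable lborel (\<lambda>r. line_integrand (\<lambda>x. x powr - s) (slant c r))"
        using rs_int_integrable[OF _ lb] cu by simp
    qed (use E b in auto)
    also have "\<dots> = (sqrt 8 / (2 * \<kappa>) * I) * t powr (- 1/4)" by (simp add: I_def)
    also have "\<dots> \<le> C * t powr (- 1/4)" by (intro mult_right_mono) (auto simp: C_def)
    finally show "norm (rs_int (real N + \<theta>) (1/2 + \<i> * of_real t)) \<le> C * t powr (- 1/4)"
      unfolding c_def s_def .
  qed
qed

section \<open>The theta function and Gram points\<close>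

text \<open>Because \<open>n^2 + y^2 \<ge> (n + y)^2 / 2\<close>, the terms are dominated by a
  telescoping sum with half-integer shifts.\<close>

lemma sum_inverse_square_bound:
  assumes "y \<ge> (1::real)"
  shows "(\<Sum>n<m. 1 / ((real n)^2 + y^2)) \<le> 4 / y"
proof -
  have tm: "1 / ((real n)^2 + y^2) \<le> 2 * (1 / (real n + y - 1/2) - 1 / (real (Suc n) + y - 1/2))" for n
  proof -
    define x where "x = real n + y"
    have x: "x \<ge> 1" using assms by (simp add: x_def)
    have p: "x^2 - 1/4 > 0" using power_mono[OF x, of 2] by simp
    have "x^2 / 2 \<le> (real n)^2 + y^2"
      using zero_le_power2[of "real n - y"] unfolding x_def by (simp add: power2_eq_square algebra_simps)
    then have "1 / ((real n)^2 + y^2) \<le> 1 / ((x^2 - 1/4) / 2)"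
      using p by (intro divide_left_mono) (auto intro!: mult_pos_pos add_nonneg_pos simp: assms)
    also have "\<dots> = 2 * (1 / (x - 1/2) - 1 / (x + 1/2))"
      using x p by (simp add: divide_simps) (simp add: power2_eq_square algebra_simps)
    finally show ?thesis by (simp add: x_def algebra_simps)
  qed
  have "(\<Sum>n<m. 1 / ((real n)^2 + y^2)) \<le> (\<Sum>n<m. 2 * (1 / (real n + y - 1/2) - 1 / (real (Suc n) + y - 1/2)))"
    by (intro sum_mono tm)
  also have "\<dots> = 2 * (1 / (y - 1/2) - 1 / (real m + y - 1/2))"
    unfolding sum_distrib_left[symmetric]
    using sum_lessThan_telescope'[of "\<lambda>n. 1 / (real n + y - 1/2)" m] by simp
  also have "\<dots> \<le> 2 * (1 / (y / 2))"
  proof (intro mult_left_mono)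
    have "1 / (y - 1/2) \<le> 1 / (y / 2)" using assms by (intro divide_left_mono) auto
    moreover have "1 / (real m + y - 1/2) \<ge> 0" using assms by simp
    ultimately show "1 / (y - 1/2) - 1 / (real m + y - 1/2) \<le> 1 / (y / 2)" by linarith
  qed simp
  finally show ?thesis by simp
qed

text \<open>The real part of the Digamma limit is \<open>ln m\<close> minus a sum of
  \<open>g (n + 1/4)\<close>, which is compared with the integral of \<open>g\<close>. On each unit
  interval the discrepancy is at most \<open>1 / (n^2 + y^2)\<close>, a bound for the derivative of
  \<open>g\<close>, and the integral itself yields \<open>ln y\<close>.\<close>

lemma Re_Digamma_quarter:
  assumes y: "y \<ge> (1::real)"
  shows "\<bar>Re (Digamma (1/4 + \<i> * of_real y)) - ln y\<bar> \<le> 4 / y"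
proof -
  define g where "g = (\<lambda>x::real. x / (x^2 + y^2))"
  define G where "G = (\<lambda>x::real. ln (x^2 + y^2) / 2)"
  have p: "x^2 + y^2 > 0" for x using y by (simp add: add_nonneg_pos)
  have dG: "(G has_real_derivative g x) (at x)" for x
    unfolding G_def g_def using p[of x]
    by (auto intro!: derivative_eq_intros simp: divide_simps)
  define g' where "g' = (\<lambda>x::real. (y^2 - x^2) / (x^2 + y^2)^2)"
  have dg: "(g has_real_derivative g' x) (at x)" for x
    unfolding g_def g'_def using p[of x]
    by (auto intro!: derivative_eq_intros simp: power2_eq_square field_simps)
  have g'b: "\<bar>g' x\<bar> \<le> 1 / ((real n)^2 + y^2)" if "real n \<le> x" for x n
  proof -
    have "\<bar>y^2 - x^2\<bar> \<le> x^2 + y^2" using zero_le_power2[of x] zero_le_power2[of y] by linarith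
    then have "\<bar>g' x\<bar> \<le> (x^2 + y^2) / (x^2 + y^2)^2" unfolding g'_def by (simp add: divide_right_mono)
    also have "\<dots> = 1 / (x^2 + y^2)" using p[of x] by (simp add: power2_eq_square)
    also have "\<dots> \<le> 1 / ((real n)^2 + y^2)"
      using that p[of x] p[of "real n"] by (intro divide_left_mono add_right_mono power_mono) auto
    finally show ?thesis .
  qed
  have step: "\<bar>(G (real (Suc n)) - G (real n)) - g (real n + 1/4)\<bar> \<le> 1 / ((real n)^2 + y^2)" for n
  proof -
    obtain \<xi> where \<xi>: "real n < \<xi>" "\<xi> < real (Suc n)" "G (real (Suc n)) - G (real n) = (real (Suc n) - real n) * g \<xi>"
      using MVT2[of "real n" "real (Suc n)" G g] dG by auto
    have "norm (g \<xi> - g (real n + 1/4)) \<le> 1 / ((real n)^2 + y^2) * norm (\<xi> - (real n + 1/4))"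
    proof (rule field_differentiable_bound[of "{real n..real (Suc n)}"])
      fix z assume z: "z \<in> {real n..real (Suc n)}"
      show "(g has_real_derivative g' z) (at z within {real n..real (Suc n)})"
        using dg has_field_derivative_at_within by blast
      show "norm (g' z) \<le> 1 / ((real n)^2 + y^2)" using g'b z by simp
    qed (use \<xi> in auto)
    also have "\<dots> \<le> 1 / ((real n)^2 + y^2) * 1" using \<xi> p[of "real n"] by (intro mult_left_mono) auto
    finally show ?thesis using \<xi>(3) by simp
  qed
  define z where "z = 1/4 + \<i> * complex_of_real y"
  have z0: "z \<noteq> 0" using y by (auto simp: z_def complex_eq_iff)
  have Reinv: "Re (inverse (z + of_nat n)) = g (real n + 1/4)" for n
    by (simp add: z_def g_def Re_divide inverse_eq_divide add.commute)
  have lim: "(\<lambda>m. ln (real m) - (\<Sum>n<m. g (real n + 1/4))) \<longlonglongrightarrow> Re (Digamma z)"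
    using tendsto_Re[OF Digamma_LIMSEQ[OF z0]]
    by (simp only: minus_complex.sel Re_sum Reinv Re_complex_of_real)
  have lim1: "(\<lambda>m. ln (real m) - ln ((real m)^2 + y^2) / 2) \<longlonglongrightarrow> 0"
    using y by real_asymp
  then have lim2: "(\<lambda>m. ln (real m) - (G (real m) - G 0)) \<longlonglongrightarrow> 0 + ln y"
    using tendsto_add[OF lim1 tendsto_const[of "ln y"]] y by (simp add: G_def ln_realpow algebra_simps)
  have "(\<lambda>m. \<bar>(ln (real m) - (\<Sum>n<m. g (real n + 1/4))) - (ln (real m) - (G (real m) - G 0))\<bar>) \<longlonglongrightarrow> \<bar>Re (Digamma z) - (0 + ln y)\<bar>"
    by (intro tendsto_intros lim lim2)
  moreover have "\<bar>(ln (real m) - (\<Sum>n<m. g (real n + 1/4))) - (ln (real m) - (G (real m) - G 0))\<bar> \<le> 4 / y" for m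
  proof -
    have "G (real m) - G 0 = (\<Sum>n<m. G (real (Suc n)) - G (real n))"
      using sum_lessThan_telescope[of "\<lambda>n. G (real n)" m] by simp
    then have "\<bar>(ln (real m) - (\<Sum>n<m. g (real n + 1/4))) - (ln (real m) - (G (real m) - G 0))\<bar>
       = \<bar>\<Sum>n<m. (G (real (Suc n)) - G (real n)) - g (real n + 1/4)\<bar>"
      by (simp add: sum_subtractf)
    also have "\<dots> \<le> (\<Sum>n<m. 1 / ((real n)^2 + y^2))"
      by (intro order.trans[OF sum_abs] sum_mono step)
    also have "\<dots> \<le> 4 / y" by (rule sum_inverse_square_bound[OF y])
    finally show ?thesis .
  qed
  ultimately have "\<bar>Re (Digamma z) - (0 + ln y)\<bar> \<le> 4 / y"
    by (intro LIMSEQ_le_const2) auto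
  then show ?thesis by (simp add: z_def)
qed

section \<open>Monotonicity of theta, existence of Gram points, linearisation\<close>

definition RS_theta' :: "real \<Rightarrow> real" where
  "RS_theta' t = - ln pi / 2 + Re (Digamma (1 / 4 + \<i> * of_real (t / 2))) / 2"

lemma RS_theta_deriv: "(RS_theta has_real_derivative RS_theta' t) (at t)"
proof -
  have nz: "1 / 4 + \<i> * complex_of_real (t / 2) \<notin> \<real>\<^sub>\<le>\<^sub>0"
    by (auto simp: complex_nonpos_Reals_iff)
  have "((\<lambda>z. ln_Gamma (1 / 4 + \<i> * (z / 2))) has_field_derivative Digamma (1 / 4 + \<i> * of_real (t / 2)) * (\<i> / 2)) (at (of_real t))"
    using nz by (auto intro!: derivative_eq_intros)
  then have "((\<lambda>t. ln_Gamma (1 / 4 + \<i> * (of_real t / 2))) has_vector_derivative Digamma (1 / 4 + \<i> * of_real (t / 2)) * (\<i> / 2)) (at t)"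
    by (rule has_vector_derivative_real_field)
  then have "((\<lambda>t. Im (ln_Gamma (1 / 4 + \<i> * (of_real t / 2)))) has_vector_derivative Im (Digamma (1 / 4 + \<i> * of_real (t / 2)) * (\<i> / 2))) (at t)"
    by (rule bounded_linear.has_vector_derivative[OF bounded_linear_Im])
  then have "((\<lambda>t. Im (ln_Gamma (1 / 4 + \<i> * of_real (t / 2)))) has_real_derivative Re (Digamma (1 / 4 + \<i> * of_real (t / 2))) / 2) (at t)"
    by (simp add: has_real_derivative_iff_has_vector_derivative)
  moreover have "((\<lambda>t. - (t / 2) * ln pi) has_real_derivative - ln pi / 2) (at t)"
    by (auto intro!: derivative_eq_intros)
  ultimately show ?thesis unfolding RS_theta_def[abs_def] RS_theta'_def
    by (rule DERIV_add[rotated])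
qed

lemma RS_theta'_approx:
  assumes "t \<ge> 2" shows "\<bar>RS_theta' t - ln (t / (2 * pi)) / 2\<bar> \<le> 4 / t"
proof -
  have "\<bar>Re (Digamma (1/4 + \<i> * of_real (t / 2))) - ln (t / 2)\<bar> \<le> 4 / (t / 2)"
    using assms by (intro Re_Digamma_quarter) simp
  moreover have "ln (t / (2 * pi)) = ln (t / 2) - ln pi"
    using assms by (simp add: ln_div ln_mult)
  ultimately show ?thesis unfolding RS_theta'_def by (simp add: abs_le_iff field_simps)
qed

text \<open>The threshold 200 makes \<open>t / (2 * pi)\<close> at least 27, hence at least
  \<open>exp 3\<close>, so the leading term is at least 3/2 and absorbs the error. Slope at least 1
  then bounds gaps in \<open>t\<close> by gaps in theta.\<close>

lemma RS_theta'_ge: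
  assumes "t \<ge> 200" shows "RS_theta' t \<ge> 1"
proof -
  have "exp (3::real) = exp 1 ^ 3" by (simp flip: exp_of_nat_mult)
  also have "\<dots> \<le> 3 ^ 3" using exp_le by (intro power_mono) auto
  also have "\<dots> \<le> t / (2 * pi)"
  proof -
    have "27 * (2 * pi) \<le> 200" using pi_approx by simp
    then show ?thesis using assms by (simp add: field_simps)
  qed
  finally have "3 \<le> ln (t / (2 * pi))" using assms by (subst ln_ge_iff) auto
  moreover have "4 / t \<le> 1/2" using assms by simp
  ultimately show ?thesis using RS_theta'_approx[of t] assms by linarith
qed

lemma RS_theta_increment:
  assumes "200 \<le> a" "a \<le> b"
  shows "b - a \<le> RS_theta b - RS_theta a"
proof (cases "a = b")
  case False
  then obtain \<xi> where "a < \<xi>" "\<xi> < b" "RS_theta b - RS_theta a = (b - a) * RS_theta' \<xi>"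
    using MVT2[of a b RS_theta RS_theta'] RS_theta_deriv assms by auto
  then show ?thesis using RS_theta'_ge[of \<xi>] assms by (simp add: mult_le_cancel_left1)
qed simp

lemma RS_theta_less_iff:
  assumes "200 \<le> a" "200 \<le> b"
  shows "RS_theta a < RS_theta b \<longleftrightarrow> a < b" "RS_theta a \<le> RS_theta b \<longleftrightarrow> a \<le> b"
  using RS_theta_increment[of a b] RS_theta_increment[of b a] assms by (smt (verit))+

text \<open>Beyond 200 theta is strictly increasing, so a solution found there by the intermediate
  value theorem exceeds every other solution; this justifies the use of
  \<open>GREATEST\<close>.\<close>

lemma gram_pt_solves:
  assumes "pi * of_int \<nu> + \<tau> \<ge> RS_theta 200"
  shows "gram_pt \<nu> \<tau> \<ge> 200" "RS_theta (gram_pt \<nu> \<tau>) = pi * of_int \<nu> + \<tau>"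
proof -
  define y where "y = pi * of_int \<nu> + \<tau>"
  \<comment> \<open>With slope at least 1, theta has certainly reached \<open>y\<close> at this
    point.\<close>
  define b where "b = 200 + (y - RS_theta 200)"
  have b: "b \<ge> 200" using assms by (simp add: b_def y_def)
  have "\<exists>t. 200 \<le> t \<and> t \<le> b \<and> RS_theta t = y"
  proof (rule IVT)
    show "RS_theta 200 \<le> y" using assms by (simp add: y_def)
    show "y \<le> RS_theta b" using RS_theta_increment[of 200 b] b by (simp add: b_def)
    show "\<forall>x. 200 \<le> x \<and> x \<le> b \<longrightarrow> isCont RS_theta x"
      using RS_theta_deriv DERIV_isCont by blast
  qed fact
  then obtain t where t: "200 \<le> t" "RS_theta t = y" by blast
  have "gram_pt \<nu> \<tau> = t"
    unfolding gram_pt_def y_def[symmetric]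
  proof (rule Greatest_equality)
    fix x assume x: "RS_theta x = y"
    show "x \<le> t"
    proof (rule ccontr)
      assume "\<not> x \<le> t"
      then show False using RS_theta_less_iff(1)[of t x] t x by simp
    qed
  qed fact
  then show "gram_pt \<nu> \<tau> \<ge> 200" "RS_theta (gram_pt \<nu> \<tau>) = pi * of_int \<nu> + \<tau>"
    using t by (simp_all add: y_def)
qed

text \<open>On the interval the derivative differs from \<open>ln (T / (2 * pi)) / 2\<close> by at
  most \<open>3 * X / T\<close>: the variation of the logarithm, halved, accounts for
  \<open>X / T\<close>, and the error \<open>4 / z\<close> of the derivative for
  \<open>2 * X / T\<close>, since \<open>X \<ge> 4\<close> and \<open>z \<ge> T / 2\<close>.\<close>

lemma RS_theta_linear:
  assumes T: "T \<ge> 400" and X: "4 \<le> X" "X \<le> T / 2"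
    and a: "\<bar>a - T\<bar> \<le> X" and b: "\<bar>b - T\<bar> \<le> X"
  shows "\<bar>(RS_theta b - RS_theta a) - ln (T / (2 * pi)) / 2 * (b - a)\<bar> \<le> 3 * X / T * \<bar>b - a\<bar>"
proof -
  define q where "q = X / T"
  define f where "f = (\<lambda>t. RS_theta t - ln (T / (2 * pi)) / 2 * t)"
  have "norm (f b - f a) \<le> 3 * X / T * norm (b - a)"
  proof (rule field_differentiable_bound[of "{T - X..T + X}"])
    fix z assume z: "z \<in> {T - X..T + X}"
    have zT: "z \<ge> T / 2" "z > 0" using z X T by auto
    show "(f has_real_derivative (RS_theta' z - ln (T / (2 * pi)) / 2)) (at z within {T - X..T + X})"
      unfolding f_def
      by (rule has_field_derivative_at_within) (auto intro!: derivative_eq_intros RS_theta_deriv)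
    have l: "\<bar>ln z - ln T\<bar> \<le> X / (T / 2)"
    proof -
      have "norm (ln z - ln T) \<le> 1 / (T / 2) * norm (z - T)"
      proof (rule field_differentiable_bound[of "{T / 2..}"])
        fix w assume "w \<in> {T / 2..}"
        then have w: "w \<ge> T / 2" "w > 0" using T by auto
        show "(ln has_real_derivative 1 / w) (at w within {T / 2..})"
          using w by (auto intro!: derivative_eq_intros simp: inverse_eq_divide)
        show "norm (1 / w) \<le> 1 / (T / 2)" using w T by (simp add: field_simps)
      qed (use zT T in auto)
      also have "\<dots> \<le> 1 / (T / 2) * X" using z T by (intro mult_left_mono) auto
      finally show ?thesis by (simp add: mult.commute)
    qed
    have "ln (z / (2 * pi)) - ln (T / (2 * pi)) = ln z - ln T"
      using zT T by (simp add: ln_div)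
    moreover have "\<bar>RS_theta' z - ln (z / (2 * pi)) / 2\<bar> \<le> 4 / z"
      using zT T by (intro RS_theta'_approx) auto
    moreover have "4 / z \<le> 2 * q"
    proof -
      have "4 / z \<le> 4 / (T / 2)" using zT T by (intro divide_left_mono) auto
      also have "\<dots> \<le> 2 * q" using X T by (simp add: q_def field_simps)
      finally show ?thesis .
    qed
    moreover have "\<bar>ln z - ln T\<bar> \<le> 2 * q" "3 * X / T = 3 * q" using l by (simp_all add: q_def mult.commute)
    ultimately show "norm (RS_theta' z - ln (T / (2 * pi)) / 2) \<le> 3 * X / T"
      unfolding real_norm_def by linarith
  qed (use a b in \<open>auto simp: abs_le_iff\<close>)
  then show ?thesis by (simp add: f_def algebra_simps diff_divide_distrib)
qed

section \<open>Weighted exponential sums\<close>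

text \<open>Partial summation with the total variation of the weight. The weight is also evaluated
  at \<open>n\<close>, one step past the last summand, and must be controlled there.\<close>

lemma abel_summation_bound:
  fixes a w :: "nat \<Rightarrow> complex"
  assumes mn: "m \<le> n" and B: "\<And>j. m \<le> j \<Longrightarrow> j \<le> n \<Longrightarrow> norm (\<Sum>k=m..<j. a k) \<le> B"
  shows "norm (\<Sum>k=m..<n. w k * a k) \<le> B * (norm (w n) + (\<Sum>k=m..<n. norm (w (Suc k) - w k)))"
proof -
  define S where "S = (\<lambda>j. \<Sum>k=m..<j. a k)"
  have "(\<Sum>k=m..<j. w k * a k) = w j * S j - (\<Sum>k=m..<j. (w (Suc k) - w k) * S (Suc k))" if "m \<le> j" for j
    using that by (induction rule: dec_induct) (auto simp: S_def algebra_simps)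
  from this[OF mn] have "norm (\<Sum>k=m..<n. w k * a k) \<le> norm (w n * S n) + norm (\<Sum>k=m..<n. (w (Suc k) - w k) * S (Suc k))"
    by (simp add: norm_triangle_ineq4)
  also have "\<dots> \<le> norm (w n) * B + (\<Sum>k=m..<n. norm (w (Suc k) - w k) * B)"
    using B mn unfolding S_def
    by (intro add_mono order.trans[OF norm_sum] sum_mono) (auto simp: norm_mult simp del: sum.op_ivl_Suc intro!: mult_left_mono)
  also have "\<dots> = B * (norm (w n) + (\<Sum>k=m..<n. norm (w (Suc k) - w k)))"
    by (simp add: sum_distrib_left algebra_simps)
  finally show ?thesis .
qed

lemma sin_ge_half: "sin x \<ge> x / 2" if "0 \<le> x" "x \<le> pi / 2" for x :: real
proof -
  have "\<bar>sin x - (\<Sum>m<3. sin_coeff m * x ^ m)\<bar> \<le> inverse (fact 3) * \<bar>x\<bar> ^ 3"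
    by (rule Maclaurin_sin_bound)
  then have "\<bar>sin x - x\<bar> \<le> x ^ 3 / 6"
    using that by (simp add: sin_coeff_def lessThan_nat_numeral lessThan_Suc fact_numeral)
  moreover have "x ^ 3 / 6 \<le> x / 2"
  proof -
    have "x \<le> 1.6" using that pi_approx by simp
    then have "x^2 \<le> 1.6^2" using that by (intro power_mono) auto
    then have "x^2 \<le> 3" by (simp add: power2_eq_square)
    then have "x * x^2 \<le> x * 3" using that by (intro mult_left_mono) auto
    then show ?thesis by (simp add: power3_eq_cube power2_eq_square)
  qed
  ultimately show ?thesis by linarith
qed

text \<open>Numerator and denominator of \<open>gram_weight\<close> are each divided by
  \<open>x\<close>, which removes the 0/0 at the origin: the bounds for the two quotients do not
  degenerate as \<open>x\<close> tends to 0.\<close>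

definition phase_quot :: "real \<Rightarrow> real \<Rightarrow> complex" where
  "phase_quot a x = (exp (\<i> * of_real (a * x)) - 1) / of_real x"

lemma phase_quot_le: "norm (phase_quot a x) \<le> \<bar>a\<bar>"
proof (cases "x = 0")
  case False
  have "norm (exp (\<i> * of_real (a * x)) - 1) = 2 * \<bar>sin (a * x / 2)\<bar>" by (rule dist_exp_i_1)
  also have "\<dots> \<le> 2 * \<bar>a * x / 2\<bar>" by (intro mult_left_mono abs_sin_x_le_abs_x) simp
  also have "\<dots> = \<bar>a\<bar> * \<bar>x\<bar>" by (simp add: abs_mult)
  finally show ?thesis using False by (simp add: phase_quot_def norm_divide divide_simps)
qed (simp add: phase_quot_def)

text \<open>With \<open>v = - \<i> * a * z\<close> the numerator of the derivative equals
  \<open>exp (\<i> * a * z) * (exp v - 1 - v)\<close>, and the quadratic Taylor bound for the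
  bracket cancels the \<open>z^2\<close> below.\<close>

lemma phase_quot_lipschitz:
  assumes "x > 0" "y > 0"
  shows "norm (phase_quot a x - phase_quot a y) \<le> a^2 * \<bar>x - y\<bar>"
proof -
  have "norm (phase_quot a x - phase_quot a y) \<le> a^2 * norm (of_real x - complex_of_real y)"
  proof -
    define f where "f = (\<lambda>z::complex. (exp (\<i> * of_real a * z) - 1) / z)"
    define f' where "f' = (\<lambda>z::complex. (\<i> * of_real a * z * exp (\<i> * of_real a * z) - (exp (\<i> * of_real a * z) - 1)) / z^2)"
    have pf: "phase_quot a x = f (of_real x)" for x by (simp add: phase_quot_def f_def mult.assoc)
    show ?thesis unfolding pf
    proof (rule field_differentiable_bound[of "complex_of_real ` {0<..}"])
      show "convex (complex_of_real ` {0<..})"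
        by (rule convex_linear_image) (auto simp: linear_iff scaleR_conv_of_real)
      fix z assume "z \<in> complex_of_real ` {0<..}"
      then obtain u where u: "z = of_real u" "u > 0" by auto
      have "(f has_field_derivative f' z) (at z)"
        unfolding f_def f'_def using u
        by (auto intro!: derivative_eq_intros simp: power2_eq_square field_simps)
      then show "(f has_field_derivative f' z) (at z within complex_of_real ` {0<..})"
        by (rule has_field_derivative_at_within)
      define v where "v = - \<i> * of_real a * z"
      have "norm (exp v - (\<Sum>i\<le>1. v ^ i / fact i)) \<le> exp \<bar>Re v\<bar> * (norm v ^ Suc 1) / fact 1"
        by (rule Taylor_exp)
      moreover have "exp v - (\<Sum>i\<le>1. v ^ i / fact i) = exp v - 1 - v" by simp
      moreover have "norm v = \<bar>a\<bar> * u" "Re v = 0" using u by (simp_all add: v_def norm_mult)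
      ultimately have T: "norm (exp v - 1 - v) \<le> (\<bar>a\<bar> * u)^2"
        by (simp add: power2_eq_square diff_diff_eq)
      have e1: "exp (\<i> * of_real a * z) * exp v = 1" by (simp add: v_def exp_add[symmetric])
      have "\<i> * of_real a * z * exp (\<i> * of_real a * z) - (exp (\<i> * of_real a * z) - 1)
         = exp (\<i> * of_real a * z) * (exp v - 1 - v)"
        using e1 by (simp add: algebra_simps v_def)
      then have "norm (f' z) = norm (exp v - 1 - v) / u^2"
        using u by (simp add: f'_def norm_divide norm_mult norm_power norm_exp_eq_Re)
      also have "\<dots> \<le> (\<bar>a\<bar> * u)^2 / u^2" by (intro divide_right_mono T) auto
      also have "\<dots> = a^2" using u by (simp add: power_mult_distrib)
      finally show "norm (f' z) \<le> a^2" .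
    qed (use assms in auto)
  qed
  also have "norm (of_real x - complex_of_real y) = \<bar>x - y\<bar>" by (metis norm_of_real of_real_diff)
  finally show ?thesis .
qed

text \<open>The sine bound \<open>sin (pi * x) \<ge> 3/2 * x * (1 - x)\<close>, proved on one half
  of the interval and reflected to the other. The zero at 0 is divided out; the zero at 1 remains as
  the factor \<open>1 - x\<close>.\<close>

lemma phase_quot_ge:
  assumes "0 < x" "x < 1"
  shows "norm (phase_quot (2 * pi) x) \<ge> 3 * (1 - x)"
proof -
  have n: "norm (exp (\<i> * of_real (2 * pi * x)) - 1) = 2 * \<bar>sin (pi * x)\<bar>"
    using dist_exp_i_1[of "2 * pi * x"] by simp
  have half: "sin (pi * u) \<ge> 3/2 * u" if "0 \<le> u" "u \<le> 1/2" for u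
  proof -
    have "sin (pi * u) \<ge> pi * u / 2" using that by (intro sin_ge_half) auto
    moreover have "pi * u \<ge> 3 * u" using that pi_gt3 by (intro mult_right_mono) auto
    ultimately show ?thesis by simp
  qed
  have "sin (pi * x) \<ge> 3/2 * (x * (1 - x))"
  proof (cases "x \<le> 1/2")
    case True
    have "3/2 * (x * (1 - x)) \<le> 3/2 * (x * 1)" using assms by (intro mult_left_mono) auto
    also have "\<dots> \<le> sin (pi * x)" using half[of x] True assms by simp
    finally show ?thesis .
  next
    case False
    have "sin (pi * (1 - x)) = sin (pi * x)" by (simp add: right_diff_distrib sin_diff)
    moreover have "3/2 * (x * (1 - x)) \<le> 3/2 * (1 * (1 - x))" using assms by (intro mult_left_mono mult_right_mono) auto
    moreover have "3/2 * (1 - x) \<le> sin (pi * (1 - x))" using half[of "1 - x"] False assms by simp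
    ultimately show ?thesis by simp
  qed
  then have "norm (exp (\<i> * of_real (2 * pi * x)) - 1) \<ge> 3 * (1 - x) * x"
    unfolding n by (simp add: mult_ac)
  then show ?thesis using assms by (simp add: phase_quot_def norm_divide pos_le_divide_eq)
qed

definition gram_weight :: "real \<Rightarrow> real \<Rightarrow> complex" where
  "gram_weight \<tau> x = (exp (\<i> * of_real (\<tau> * x)) - 1) / (exp (\<i> * of_real (2 * pi * x)) - 1)"

lemma gram_weight_eq: "x \<noteq> 0 \<Longrightarrow> gram_weight \<tau> x = phase_quot \<tau> x / phase_quot (2 * pi) x"
  by (simp add: gram_weight_def phase_quot_def)

lemma gram_weight_le:
  assumes "0 < x" "x < 1" "\<bar>\<tau>\<bar> \<le> pi"
  shows "norm (gram_weight \<tau> x) \<le> 2 / (1 - x)"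
proof -
  have "norm (gram_weight \<tau> x) \<le> pi / (3 * (1 - x))"
    unfolding gram_weight_eq[OF less_imp_neq[OF assms(1), symmetric]] norm_divide
    using assms phase_quot_ge[of x] phase_quot_le[of \<tau> x] by (intro frac_le) auto
  also have "\<dots> = (pi / 3) / (1 - x)" by simp
  also have "\<dots> \<le> 2 / (1 - x)" using assms pi_less_4 by (intro divide_right_mono) auto
  finally show ?thesis .
qed

text \<open>The quotient rule for two values of \<open>phase_quot\<close>: each denominator is at
  least \<open>3 * \<eta>\<close>, and 24 bounds \<open>6 * pi^3 / 9\<close>.\<close>

lemma gram_weight_lipschitz:
  assumes x: "0 < x" "x \<le> 1 - \<eta>" and y: "0 < y" "y \<le> 1 - \<eta>" and \<eta>: "\<eta> > 0" and \<tau>: "\<bar>\<tau>\<bar> \<le> pi"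
  shows "norm (gram_weight \<tau> x - gram_weight \<tau> y) \<le> 24 / \<eta>^2 * \<bar>x - y\<bar>"
proof -
  let ?f = "phase_quot \<tau>" and ?g = "phase_quot (2 * pi)"
  have gx: "norm (?g x) \<ge> 3 * \<eta>" using phase_quot_ge[of x] x \<eta> by simp
  have gy: "norm (?g y) \<ge> 3 * \<eta>" using phase_quot_ge[of y] y \<eta> by simp
  have nz: "?g x \<noteq> 0" "?g y \<noteq> 0" using gx gy \<eta> by auto
  have "gram_weight \<tau> x - gram_weight \<tau> y = ((?f x - ?f y) * ?g y - ?f y * (?g x - ?g y)) / (?g x * ?g y)"
    using x y nz by (simp add: gram_weight_eq field_simps)
  then have "norm (gram_weight \<tau> x - gram_weight \<tau> y) \<le> (norm (?f x - ?f y) * norm (?g y) + norm (?f y) * norm (?g x - ?g y)) / (norm (?g x) * norm (?g y))"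
    by (simp add: norm_divide norm_mult divide_right_mono order.trans[OF norm_triangle_ineq4])
  also have "\<dots> \<le> (pi^2 * \<bar>x - y\<bar> * (2 * pi) + pi * ((2 * pi)^2 * \<bar>x - y\<bar>)) / ((3 * \<eta>) * (3 * \<eta>))"
  proof (intro frac_le add_mono mult_mono gx gy)
    have "norm (?f x - ?f y) \<le> \<tau>^2 * \<bar>x - y\<bar>" using x y by (intro phase_quot_lipschitz) auto
    also have "\<tau>^2 \<le> pi^2" using \<tau> by (metis abs_le_square_iff abs_of_nonneg pi_ge_zero)
    finally show "norm (?f x - ?f y) \<le> pi^2 * \<bar>x - y\<bar>" by (simp add: mult_right_mono)
    show "norm (?g y) \<le> 2 * pi" using phase_quot_le[of "2 * pi" y] by simp
    show "norm (?f y) \<le> pi" using phase_quot_le[of \<tau> y] \<tau> by simp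
    show "norm (?g x - ?g y) \<le> (2 * pi)^2 * \<bar>x - y\<bar>" using x y by (intro phase_quot_lipschitz) auto
  qed (use \<eta> in auto)
  also have "\<dots> = (6 * pi^3 / 9) / \<eta>^2 * \<bar>x - y\<bar>" by (simp add: power2_eq_square power3_eq_cube field_simps)
  also have "\<dots> \<le> 24 / \<eta>^2 * \<bar>x - y\<bar>"
  proof (intro mult_right_mono divide_right_mono)
    have "pi^3 \<le> 3.2^3" using pi_approx by (intro power_mono) auto
    then show "6 * pi^3 / 9 \<le> 24" by (simp add: power3_eq_cube)
  qed auto
  finally show ?thesis .
qed

section \<open>Weighted sums under the dyadic hypothesis\<close>

lemma sum_inverse_sqrt_le: "(\<Sum>n=1..m. real n powr (- 1/2)) \<le> 2 * sqrt (real m)"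
proof (induction m)
  case (Suc m)
  define x y where "x = sqrt (real m)" and "y = sqrt (real (Suc m))"
  have xy: "0 \<le> x" "x \<le> y" "y > 0" "y^2 = x^2 + 1" by (simp_all add: x_def y_def)
  have "2 * x * y \<le> x^2 + y^2" using zero_le_power2[of "x - y"] by (simp add: power2_eq_square algebra_simps)
  then have "2 * x * y + 1 \<le> 2 * y * y" using xy(4) by (simp add: power2_eq_square)
  then have "2 * x + 1 / y \<le> 2 * y" using xy(3) by (simp add: field_simps)
  moreover have "real (Suc m) powr (- 1/2) = 1 / y"
    by (simp add: y_def powr_minus_divide powr_half_sqrt)
  ultimately show ?case using Suc by (simp add: x_def y_def)
qed simp

definition exp_sum_hyp :: "real \<Rightarrow> real \<Rightarrow> bool" where
  "exp_sum_hyp A \<Delta> \<longleftrightarrow> (\<forall>(t :: real) (a :: real) (b :: real).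
         0 < t \<and> 1 \<le> a \<and> a < b \<and> b \<le> 2 * a \<and> b \<le> sqrt (t / (2 * pi)) \<longrightarrow>
         cmod (\<Sum>n | a \<le> real n \<and> real n < b. of_nat n powr (\<i> * of_real t))
           < A * sqrt a * t powr \<Delta>)"

text \<open>The weight \<open>k powr (-1/2)\<close> is decreasing, so its variation telescopes to
  \<open>m powr (-1/2)\<close>, which cancels the \<open>sqrt m\<close> of the hypothesis.\<close>

lemma dyadic_block_bound:
  assumes hyp: "exp_sum_hyp A \<Delta>" and A: "A > 0" and t: "t > 0"
    and mn: "1 \<le> m" "m \<le> n" "n \<le> 2 * m" and n: "real n \<le> sqrt (t / (2 * pi))"
  shows "norm (\<Sum>k=m..<n. of_real (real k powr (- 1/2)) * of_nat k powr (\<i> * of_real t)) \<le> A * t powr \<Delta>"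
proof -
  define w where "w = (\<lambda>k. complex_of_real (real k powr (- 1/2)))"
  define B where "B = A * sqrt (real m) * t powr \<Delta>"
  have "norm (\<Sum>k=m..<n. w k * of_nat k powr (\<i> * of_real t)) \<le> B * (norm (w n) + (\<Sum>k=m..<n. norm (w (Suc k) - w k)))"
  proof (rule abel_summation_bound[OF mn(2)])
    fix j assume j: "m \<le> j" "j \<le> n"
    show "norm (\<Sum>k=m..<j. complex_of_nat k powr (\<i> * of_real t)) \<le> B"
    \<comment> \<open>The empty sum is treated apart because the hypothesis asks for
      \<open>a < b\<close>.\<close>
    proof (cases "j = m")
      case True
      then show ?thesis using A by (simp add: B_def)
    next
      case False
      have "cmod (\<Sum>k | real m \<le> real k \<and> real k < real j. of_nat k powr (\<i> * of_real t)) < B"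
        unfolding B_def using hyp[unfolded exp_sum_hyp_def, rule_format, of t "real m" "real j"] t mn j False n
        by auto
      moreover have "{k. real m \<le> real k \<and> real k < real j} = {m..<j}" by auto
      ultimately show ?thesis by simp
    qed
  qed
  also have "(\<Sum>k=m..<n. norm (w (Suc k) - w k)) = real m powr (- 1/2) - real n powr (- 1/2)"
  proof -
    have "norm (w (Suc k) - w k) = (- (real (Suc k) powr (- 1/2))) - (- (real k powr (- 1/2)))" if "k \<in> {m..<n}" for k
    proof -
      have "real (Suc k) powr (- 1/2) \<le> real k powr (- 1/2)"
        using that mn by (intro powr_mono2') auto
      then show ?thesis unfolding w_def of_real_diff[symmetric] norm_of_real by simp
    qed
    then have "(\<Sum>k=m..<n. norm (w (Suc k) - w k)) = (\<Sum>k=m..<n. (- (real (Suc k) powr (- 1/2))) - (- (real k powr (- 1/2))))"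
      by (rule sum.cong[OF refl])
    also have "\<dots> = real m powr (- 1/2) - real n powr (- 1/2)"
      using sum_Suc_diff'[OF mn(2), of "\<lambda>k. - (real k powr (- 1/2))"] by simp
    finally show ?thesis .
  qed
  also have "norm (w n) = real n powr (- 1/2)" by (simp add: w_def)
  also have "B * (real n powr (- 1/2) + (real m powr (- 1/2) - real n powr (- 1/2))) = A * t powr \<Delta> * (real m powr (1/2) * real m powr (- 1/2))"
    using mn by (simp add: B_def powr_half_sqrt)
  also have "real m powr (1/2) * real m powr (- 1/2) = 1" using mn by (simp flip: powr_add)
  finally show ?thesis by (simp add: w_def)
qed

text \<open>Induction on the number \<open>j\<close> of doublings between \<open>m\<close> and
  \<open>n\<close>; each one adds a block.\<close>

lemma dyadic_sum_bound:
  assumes hyp: "exp_sum_hyp A \<Delta>" and A: "A > 0" and t: "t > 0"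
    and mn: "1 \<le> m" "m \<le> n" "n \<le> 2 ^ j * m" and n: "real n \<le> sqrt (t / (2 * pi))"
  shows "norm (\<Sum>k=m..<n. of_real (real k powr (- 1/2)) * of_nat k powr (\<i> * of_real t)) \<le> real j * (A * t powr \<Delta>)"
  using mn n
proof (induction j arbitrary: n)
  case (Suc j)
  have AB: "A * t powr \<Delta> \<ge> 0" using A by simp
  show ?case
  proof (cases "n \<le> 2 ^ j * m")
    case True
    show ?thesis using Suc.IH[OF Suc.prems(1,2) True Suc.prems(4)] AB by (simp add: distrib_right)
  next
    case False
    define p where "p = 2 ^ j * m"
    have p: "m \<le> p" "p \<le> n" "n \<le> 2 * p" "1 \<le> p" using False Suc.prems by (auto simp: p_def mult_ac)
    have pn: "real (2 ^ j * m) \<le> sqrt (t / (2 * pi))" using p(2) Suc.prems(4) unfolding p_def by linarith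
    have "(\<Sum>k=m..<n. of_real (real k powr (- 1/2)) * complex_of_nat k powr (\<i> * of_real t))
      = (\<Sum>k=m..<p. of_real (real k powr (- 1/2)) * of_nat k powr (\<i> * of_real t)) + (\<Sum>k=p..<n. of_real (real k powr (- 1/2)) * of_nat k powr (\<i> * of_real t))"
      using p by (subst sum.atLeastLessThan_concat) auto
    also have "norm \<dots> \<le> real j * (A * t powr \<Delta>) + A * t powr \<Delta>"
      using p Suc.prems pn
      by (intro norm_triangle_le add_mono Suc.IH dyadic_block_bound[OF hyp A t]) (auto simp: p_def)
    finally show ?thesis by (simp add: distrib_right)
  qed
qed simp

text \<open>The geometric sums over Gram points reduce to a difference of this expression at two
  values of \<open>t\<close>. The range stops before \<open>N - 1\<close> because partial summation
  evaluates the weight at \<open>N - 1\<close> as well, and there \<open>\<lambda>\<close> is still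
  positive; at \<open>N\<close> it could vanish.\<close>

definition gram_weight_sum :: "real \<Rightarrow> real \<Rightarrow> nat \<Rightarrow> real \<Rightarrow> complex" where
  "gram_weight_sum \<tau> T N t = (\<Sum>n=2..<N-1. gram_weight \<tau> (1 - ln (real n) / (ln (T / (2 * pi)) / 2)) *
     (of_real (real n powr (- 1/2)) * of_nat n powr (- (\<i> * of_real t))))"

text \<open>The cut at \<open>T powr (2 * \<Delta>)\<close> is the largest power for which the
  trivial bound of the initial terms stays within \<open>T powr \<Delta> * ln T\<close>. Beyond it
  the weight keeps away from its pole at \<open>\<lambda> = 1\<close>, and partial summation against
  the dyadic bounds loses only a constant depending on \<Delta>.\<close>

lemma weighted_exp_sum_bound:
  assumes hyp: "exp_sum_hyp A \<Delta>" and A: "A > 0" and \<Delta>: "\<Delta> > 0" "\<Delta> \<le> 1/6"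
  shows "\<exists>C>0. \<forall>T\<ge>100. \<forall>\<tau> N t. \<bar>\<tau>\<bar> \<le> pi \<longrightarrow> real N \<le> sqrt (T / (2 * pi)) \<longrightarrow> T \<le> t \<longrightarrow> t \<le> 2 * T \<longrightarrow>
    norm (gram_weight_sum \<tau> T N t) \<le> C * (T powr \<Delta> * ln T)"
proof -
  \<comment> \<open>For \<open>n \<ge> T powr (2 * \<Delta>)\<close> one has
    \<open>ln n \<ge> 2 * \<Delta> * ln T \<ge> 4 * \<Delta> * \<omega>\<close>, so
    \<open>1 - \<lambda> \<ge> 4 * \<Delta>\<close>.\<close>
  define \<eta> where "\<eta> = 4 * \<Delta>"
  have \<eta>: "\<eta> > 0" "\<eta> < 1" using \<Delta> by (simp_all add: \<eta>_def)
  define D where "D = 2 / \<eta> + 24 / \<eta>^2"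
  have D: "D > 0" using \<eta> by (simp add: D_def add_pos_pos)
  define C where "C = 3 + 4 * A * D"
  show ?thesis
  proof (intro exI[of _ C] conjI allI impI)
    show "C > 0" using A D by (simp add: C_def add_pos_pos)
    fix T \<tau> t :: real and N :: nat
    assume T: "T \<ge> 100" and \<tau>: "\<bar>\<tau>\<bar> \<le> pi" and N: "real N \<le> sqrt (T / (2 * pi))" and t: "T \<le> t" "t \<le> 2 * T"
    define \<omega> where "\<omega> = ln (T / (2 * pi)) / 2"
    define x where "x = (\<lambda>n. 1 - ln (real n) / \<omega>)"
    define a where "a = (\<lambda>n. complex_of_real (real n powr (- 1/2)) * of_nat n powr (- (\<i> * of_real t)))"
    define M where "M = N - 1"
    have "2 * pi \<le> 8" using pi_less_4 by simp
    then have T1: "T / (2 * pi) > 1" using T by (simp add: field_simps)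
    have \<omega>: "\<omega> > 0" "ln (sqrt (T / (2 * pi))) = \<omega>" using ln_gt_zero[OF T1] ln_sqrt[OF less_imp_le[OF less_trans[OF zero_less_one T1]]] by (simp_all add: \<omega>_def)
    have "T / (2 * pi) \<le> T / 1" using T pi_gt3 by (intro divide_left_mono) auto
    then have "ln (T / (2 * pi)) \<le> ln T" using T1 T by (subst ln_le_cancel_iff) auto
    then have \<omega>T: "\<omega> \<le> ln T / 2" by (simp add: \<omega>_def)
    have lnT: "ln T \<ge> 1" using T exp_le by (subst ln_ge_iff) auto
    have TD: "T powr \<Delta> \<ge> 1" using T \<Delta> by (simp add: ge_one_powr_ge_zero)
    have x1: "0 < x n" "x n < 1" if "2 \<le> n" "n \<le> M" for n
    proof -
      have "n < N" using that by (auto simp: M_def)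
      then have "real n < sqrt (T / (2 * pi))" using N by linarith
      then have "ln (real n) < \<omega>" unfolding \<omega>(2)[symmetric] using that T by (subst ln_less_cancel_iff) auto
      then show "0 < x n" using \<omega> by (simp add: x_def)
      have "ln (real n) > 0" using that by simp
      then show "x n < 1" using \<omega> by (simp add: x_def)
    qed
    have na: "norm (a n) = real n powr (- 1/2)" if "n \<ge> 2" for n
      using that by (simp add: a_def norm_mult norm_powr_real_powr)
    have main: "norm (\<Sum>n=2..<M. gram_weight \<tau> (x n) * a n) \<le> C * (T powr \<Delta> * ln T)"
    proof (cases "M \<le> 2")
      case True
      have "C * (T powr \<Delta> * ln T) \<ge> 0" using TD lnT \<open>C > 0\<close> by simp
      then show "norm (\<Sum>n=2..<M. gram_weight \<tau> (x n) * a n) \<le> C * (T powr \<Delta> * ln T)" using True by simp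
    next
      case False
      define n1 where "n1 = nat \<lceil>T powr (2 * \<Delta>)\<rceil>"
      \<comment> \<open>The cut, clipped to the range of summation so that both parts make sense for
        every \<open>M\<close>.\<close>
      define q where "q = max 2 (min M n1)"
      have q: "2 \<le> q" "q \<le> M" using False by (auto simp: q_def)
      have T2: "T powr (2 * \<Delta>) \<ge> 1" using T \<Delta> by (simp add: ge_one_powr_ge_zero)
      have n1: "real n1 \<ge> T powr (2 * \<Delta>)" "real n1 - 1 < T powr (2 * \<Delta>)"
        using T2 unfolding n1_def by linarith+
      have "norm (\<Sum>n=2..<q. gram_weight \<tau> (x n) * a n) \<le> (\<Sum>n=2..<q. 3 * \<omega> * real n powr (- 1/2))"
      proof (rule order.trans[OF norm_sum], rule sum_mono)
        fix n assume n: "n \<in> {2..<q}"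
        then have n': "2 \<le> n" "n \<le> M" using q by auto
        \<comment> \<open>Near the pole the weight is at most
          \<open>2 / (1 - x n) = 2 * \<omega> / ln n\<close>, and \<open>ln n \<ge> 2/3\<close> for
          \<open>n \<ge> 2\<close>.\<close>
        have "ln 2 \<le> ln (real n)" using n' by (subst ln_le_cancel_iff) auto
        then have "2/3 \<le> ln (real n)" using ln2_ge_two_thirds by linarith
        then have "2 / (1 - x n) \<le> 3 * \<omega>"
          using \<omega>(1) by (simp add: x_def pos_divide_le_eq mult_left_mono)
        then have "norm (gram_weight \<tau> (x n)) \<le> 3 * \<omega>"
          using gram_weight_le[OF x1[OF n'] \<tau>] by linarith
        then show "norm (gram_weight \<tau> (x n) * a n) \<le> 3 * \<omega> * real n powr (- 1/2)"
          unfolding norm_mult na[OF n'(1)] by (intro mult_right_mono) auto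
      qed
      also have "\<dots> \<le> 3 * \<omega> * (\<Sum>n=1..q-1. real n powr (- 1/2))"
        unfolding sum_distrib_left[symmetric] using \<omega> q
        by (intro mult_left_mono sum_mono2) auto
      also have "\<dots> \<le> 3 * \<omega> * (2 * sqrt (real (q - 1)))"
        using \<omega> by (intro mult_left_mono sum_inverse_sqrt_le) auto
      also have "\<dots> \<le> 3 * (ln T / 2) * (2 * T powr \<Delta>)"
      proof (intro mult_mono)
        have "real (q - 1) \<le> T powr (2 * \<Delta>)" using n1 T2 q by (auto simp: q_def of_nat_diff max_def min_def)
        then have "sqrt (real (q - 1)) \<le> sqrt (T powr (2 * \<Delta>))" by simp
        also have "\<dots> = T powr \<Delta>" by (simp add: powr_half_sqrt[symmetric] powr_powr)
        finally show "sqrt (real (q - 1)) \<le> T powr \<Delta>" .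
      qed (use \<omega>T lnT \<omega> in auto)
      finally have part1: "norm (\<Sum>n=2..<q. gram_weight \<tau> (x n) * a n) \<le> 3 * (T powr \<Delta> * ln T)" by (simp add: mult.commute)
      have part2: "norm (\<Sum>n=q..<M. gram_weight \<tau> (x n) * a n) \<le> 4 * A * D * (T powr \<Delta> * ln T)"
      proof (cases "q = M")
        case True
        then show ?thesis using A D TD lnT by simp
      next
        case False
        then have qn: "q \<ge> n1" using q by (auto simp: q_def)
        have x2: "x n \<le> 1 - \<eta>" if "q \<le> n" for n
        proof -
          have "T powr (2 * \<Delta>) \<le> real n" using n1(1) qn that by linarith
          moreover have "0 < n" using that q by simp
          ultimately have "ln (T powr (2 * \<Delta>)) \<le> ln (real n)" using T by (subst ln_le_cancel_iff) auto
          then have "2 * \<Delta> * ln T \<le> ln (real n)" using T by (simp add: ln_powr)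
          moreover have "4 * \<Delta> * \<omega> \<le> 4 * \<Delta> * (ln T / 2)" using \<Delta> \<omega>T by (intro mult_left_mono) auto
          ultimately have "\<eta> * \<omega> \<le> ln (real n)" by (simp add: \<eta>_def)
          then show ?thesis using \<omega>(1) by (simp add: x_def pos_le_divide_eq)
        qed
        \<comment> \<open>The number of doublings that lead from 1 past \<open>N\<close>; it is
          \<open>O(ln T)\<close>.\<close>
        define j0 where "j0 = nat \<lceil>log 2 (real N)\<rceil>"
        have N1: "N \<ge> 3" using \<open>\<not> M \<le> 2\<close> by (auto simp: M_def)
        have "log 2 (real N) \<le> real j0" unfolding j0_def by (rule real_nat_ceiling_ge)
        then have "real N \<le> 2 powr real j0" using N1 by (subst (asm) log_le_iff) auto
        then have Nj: "N \<le> 2 ^ j0" by (simp add: powr_realpow)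
        have j0: "real j0 \<le> 2 * ln T"
        proof -
          have "log 2 (real N) \<ge> 0" using N1 by simp
          then have "real j0 \<le> log 2 (real N) + 1" unfolding j0_def by linarith
          also have "log 2 (real N) = ln (real N) / ln 2" by (simp add: log_def)
          also have "\<dots> \<le> \<omega> / (2/3)"
          proof (intro frac_le)
            have "real N > 0" using N1 by simp
            then show "ln (real N) \<le> \<omega>"
              unfolding \<omega>(2)[symmetric] using N by (intro ln_mono) linarith+
          qed (use ln2_ge_two_thirds \<omega> in auto)
          also have "\<dots> + 1 \<le> 2 * ln T" using \<omega>T lnT by simp
          finally show ?thesis by simp
        qed
        \<comment> \<open>Doublings times the bound for one block; the inner factor 2 pays for
          \<open>t \<le> 2 * T\<close>.\<close>
        define B where "B = 2 * ln T * (A * (2 * T powr \<Delta>))"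
        have t\<Delta>: "t powr \<Delta> \<le> 2 * T powr \<Delta>"
        proof -
          have "t powr \<Delta> \<le> (2 * T) powr \<Delta>" using t T \<Delta> by (intro powr_mono2) auto
          also have "\<dots> = 2 powr \<Delta> * T powr \<Delta>" using T by (simp add: powr_mult)
          also have "2 powr \<Delta> \<le> 2 powr 1" using \<Delta> by (intro powr_mono) auto
          finally show ?thesis by (simp add: mult_right_mono)
        qed
        have "norm (\<Sum>n=q..<M. gram_weight \<tau> (x n) * a n) \<le> B * (norm (gram_weight \<tau> (x M)) + (\<Sum>n=q..<M. norm (gram_weight \<tau> (x (Suc n)) - gram_weight \<tau> (x n))))"
        proof (rule abel_summation_bound[OF q(2)])
          fix j assume j: "q \<le> j" "j \<le> M"
          have "j \<le> N" using j by (simp add: M_def)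
          also have "N \<le> 2 ^ j0 * 1" using Nj by simp
          also have "\<dots> \<le> 2 ^ j0 * q" using q by (intro mult_left_mono) auto
          finally have jq: "j \<le> 2 ^ j0 * q" .
          have "real j \<le> real N" using j by (simp add: M_def)
          also have "\<dots> \<le> sqrt (T / (2 * pi))" by fact
          also have "\<dots> \<le> sqrt (t / (2 * pi))" using t by (simp add: divide_right_mono)
          finally have js: "real j \<le> sqrt (t / (2 * pi))" .
          \<comment> \<open>The hypothesis concerns \<open>n powr (\<i> * t)\<close> with
            \<open>t > 0\<close>; conjugation reverses the sign of the exponent without changing
            norms.\<close>
          have "of_nat k powr (- (\<i> * of_real t)) = cnj (of_nat k powr (\<i> * of_real t))" for k
            by (cases "k = 0") (simp_all add: powr_def exp_cnj)
          then have "(\<Sum>k=q..<j. a k) = cnj (\<Sum>k=q..<j. of_real (real k powr (- 1/2)) * of_nat k powr (\<i> * of_real t))"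
            by (simp add: a_def)
          then have "norm (\<Sum>k=q..<j. a k) = norm (\<Sum>k=q..<j. of_real (real k powr (- 1/2)) * complex_of_nat k powr (\<i> * of_real t))"
            by (simp only: complex_mod_cnj)
          also have "\<dots> \<le> real j0 * (A * t powr \<Delta>)"
            using q j jq js t T by (intro dyadic_sum_bound[OF hyp A]) auto
          also have "\<dots> \<le> B" unfolding B_def using j0 A t\<Delta> lnT by (intro mult_mono) auto
          finally show "norm (\<Sum>k=q..<j. a k) \<le> B" .
        qed
        also have "\<dots> \<le> B * D"
        proof (intro mult_left_mono)
          show "B \<ge> 0" using A lnT by (simp add: B_def)
          have "norm (gram_weight \<tau> (x M)) \<le> 2 / (1 - x M)" using q by (intro gram_weight_le x1 \<tau>) auto
          also have "\<dots> \<le> 2 / \<eta>" using x2[of M] q \<eta> by (intro divide_left_mono) auto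
          finally have w1: "norm (gram_weight \<tau> (x M)) \<le> 2 / \<eta>" .
          have "(\<Sum>n=q..<M. norm (gram_weight \<tau> (x (Suc n)) - gram_weight \<tau> (x n))) \<le> (\<Sum>n=q..<M. 24 / \<eta>^2 * ((- x (Suc n)) - (- x n)))"
          proof (rule sum_mono)
            fix n assume n: "n \<in> {q..<M}"
            have mono: "x (Suc n) \<le> x n" using n q \<omega>(1) unfolding x_def by (simp add: divide_right_mono)
            then have ab: "\<bar>x (Suc n) - x n\<bar> = (- x (Suc n)) - (- x n)" by simp
            have "norm (gram_weight \<tau> (x (Suc n)) - gram_weight \<tau> (x n)) \<le> 24 / \<eta>^2 * \<bar>x (Suc n) - x n\<bar>"
              using n q by (intro gram_weight_lipschitz x1 x2 \<tau> \<eta>) auto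
            then show "norm (gram_weight \<tau> (x (Suc n)) - gram_weight \<tau> (x n)) \<le> 24 / \<eta>^2 * ((- x (Suc n)) - (- x n))"
              unfolding ab .
          qed
          also have "\<dots> = 24 / \<eta>^2 * (x q - x M)"
            unfolding sum_distrib_left[symmetric] using sum_Suc_diff'[OF q(2), of "\<lambda>n. - x n"] by simp
          also have "\<dots> \<le> 24 / \<eta>^2 * 1" using x1[of q] x1[of M] q by (intro mult_left_mono) auto
          finally show "norm (gram_weight \<tau> (x M)) + (\<Sum>n=q..<M. norm (gram_weight \<tau> (x (Suc n)) - gram_weight \<tau> (x n))) \<le> D"
            using w1 by (simp add: D_def)
        qed
        also have "\<dots> = 4 * A * D * (T powr \<Delta> * ln T)" by (simp add: B_def)
        finally show ?thesis .
      qed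
      have "(\<Sum>n=2..<M. gram_weight \<tau> (x n) * a n) = (\<Sum>n=2..<q. gram_weight \<tau> (x n) * a n) + (\<Sum>n=q..<M. gram_weight \<tau> (x n) * a n)"
        using q by (subst sum.atLeastLessThan_concat) auto
      also have "norm \<dots> \<le> C * (T powr \<Delta> * ln T)"
        using part1 part2 by (intro norm_triangle_le) (simp add: C_def distrib_right)
      finally show "norm (\<Sum>n=2..<M. gram_weight \<tau> (x n) * a n) \<le> C * (T powr \<Delta> * ln T)" .
    qed
    show "norm (gram_weight_sum \<tau> T N t) \<le> C * (T powr \<Delta> * ln T)"
      using main unfolding gram_weight_sum_def M_def x_def a_def \<omega>_def .
  qed
qed

section \<open>Sums over Gram points\<close>

text \<open>For indices with \<open>pi * j < RS_theta 200\<close> nothing is known about the Gram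
  point. Only finitely many of them are at least \<nu>0, so \<open>T1\<close> can be placed beyond
  all their Gram points; for the others monotonicity of theta translates the condition. The
  additional pi leaves room for a shift by \<tau>.\<close>

lemma gram_index_set:
  "\<exists>T1\<ge>200. \<forall>T\<ge>T1. \<forall>H>0. \<forall>j::int.
     (RS_theta T \<le> pi * of_int j \<longrightarrow> RS_theta 200 + pi \<le> pi * of_int j) \<and>
     (\<nu>0 \<le> j \<and> T \<le> gram_pt j 0 \<and> gram_pt j 0 \<le> T + H \<longleftrightarrow>
      RS_theta T \<le> pi * of_int j \<and> pi * of_int j \<le> RS_theta (T + H))"
proof -
  define E where "E = {j::int. \<nu>0 \<le> j \<and> pi * of_int j < RS_theta 200}"
  have "finite E"
  proof (rule finite_subset)
    show "E \<subseteq> {\<nu>0..\<lfloor>RS_theta 200 / pi\<rfloor>}" by (auto simp: E_def le_floor_iff field_simps)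
  qed simp
  \<comment> \<open>The entries serve in turn to raise theta by at least pi above its value at 200,
    to raise it above \<open>pi * \<nu>0\<close>, and to exceed the uncontrolled Gram
    points.\<close>
  define T1 where "T1 = Max (insert 210 (insert (200 + (pi * of_int \<nu>0 - RS_theta 200)) ((\<lambda>j. gram_pt j 0 + 1) ` E)))"
  have fin: "finite (insert 210 (insert (200 + (pi * of_int \<nu>0 - RS_theta 200)) ((\<lambda>j. gram_pt j 0 + 1) ` E)))"
    using \<open>finite E\<close> by simp
  have T1: "T1 \<ge> 210" "T1 \<ge> 200 + (pi * of_int \<nu>0 - RS_theta 200)" "\<And>j. j \<in> E \<Longrightarrow> gram_pt j 0 < T1"
  proof -
    show "T1 \<ge> 210" "T1 \<ge> 200 + (pi * of_int \<nu>0 - RS_theta 200)" unfolding T1_def by (rule Max_ge[OF fin], simp)+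
    fix j assume "j \<in> E"
    then have "gram_pt j 0 + 1 \<le> T1" unfolding T1_def using fin by (intro Max_ge) auto
    then show "gram_pt j 0 < T1" by simp
  qed
  show ?thesis
  proof (intro exI[of _ T1] conjI allI impI)
    show "T1 \<ge> 200" using T1(1) by simp
    fix T H :: real and j :: int
    assume T: "T1 \<le> T" and H: "H > 0"
    have inc: "RS_theta T \<ge> RS_theta 200 + (T - 200)" using RS_theta_increment[of 200 T] T T1(1) by simp
    have th: "RS_theta T \<ge> RS_theta 200 + pi" "RS_theta T \<ge> pi * of_int \<nu>0"
      using inc T T1(1,2) pi_less_4 by linarith+
    then show "RS_theta T \<le> pi * of_int j \<Longrightarrow> RS_theta 200 + pi \<le> pi * of_int j" by linarith
    show "(\<nu>0 \<le> j \<and> T \<le> gram_pt j 0 \<and> gram_pt j 0 \<le> T + H) \<longleftrightarrow>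
      (RS_theta T \<le> pi * of_int j \<and> pi * of_int j \<le> RS_theta (T + H))"
    proof (cases "RS_theta 200 \<le> pi * of_int j")
      case True
      have g: "gram_pt j 0 \<ge> 200" "RS_theta (gram_pt j 0) = pi * of_int j"
        using gram_pt_solves[of j 0] True by simp_all
      have "T \<le> gram_pt j 0 \<longleftrightarrow> RS_theta T \<le> pi * of_int j"
        using RS_theta_less_iff(2)[of T "gram_pt j 0"] g T T1(1) by simp
      moreover have "gram_pt j 0 \<le> T + H \<longleftrightarrow> pi * of_int j \<le> RS_theta (T + H)"
        using RS_theta_less_iff(2)[of "gram_pt j 0" "T + H"] g T T1(1) H by simp
      moreover have "\<nu>0 \<le> j" if "RS_theta T \<le> pi * of_int j"
      proof -
        have "pi * of_int \<nu>0 \<le> pi * of_int j" using th(2) that by linarith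
        then show ?thesis by simp
      qed
      ultimately show ?thesis by blast
    next
      case False
      then have "\<not> RS_theta T \<le> pi * of_int j" using th(1) pi_gt_zero by linarith
      moreover have "\<not> (\<nu>0 \<le> j \<and> T \<le> gram_pt j 0)"
        using T1(3)[of j] False T by (auto simp: E_def)
      ultimately show ?thesis by blast
    qed
  qed
qed

text \<open>The margin pi keeps \<open>pi * j + \<tau>\<close> above \<open>RS_theta 200\<close>,
  and slope at least 1 bounds the displacement by \<open>\<bar>\<tau>\<bar>\<close>.\<close>

lemma gram_pt_shift:
  assumes "RS_theta 200 + pi \<le> pi * of_int j" "\<bar>\<tau>\<bar> \<le> pi"
  shows "gram_pt j \<tau> \<ge> 200" "RS_theta (gram_pt j \<tau>) = pi * of_int j + \<tau>" "\<bar>gram_pt j \<tau> - gram_pt j 0\<bar> \<le> \<bar>\<tau>\<bar>"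
proof -
  have a: "gram_pt j 0 \<ge> 200" "RS_theta (gram_pt j 0) = pi * of_int j"
    using gram_pt_solves[of j 0] assms pi_gt_zero by auto
  show b: "gram_pt j \<tau> \<ge> 200" "RS_theta (gram_pt j \<tau>) = pi * of_int j + \<tau>"
    using gram_pt_solves[of j \<tau>] assms by auto
  show "\<bar>gram_pt j \<tau> - gram_pt j 0\<bar> \<le> \<bar>\<tau>\<bar>"
    using RS_theta_increment[OF a(1), of "gram_pt j \<tau>"] RS_theta_increment[OF b(1), of "gram_pt j 0"] a b by linarith
qed

text \<open>The length of the sum is determined by \<open>T\<close> and not by \<open>t\<close>, so
  that it is the same at all Gram points of the interval.\<close>

definition RS_main :: "real \<Rightarrow> real \<Rightarrow> real" where
  "RS_main T t = 2 * Re (exp (\<i> * of_real (RS_theta t)) *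
     (\<Sum>n=1..nat \<lfloor>sqrt (T / (2 * pi))\<rfloor>. of_nat n powr (- (1/2 + \<i> * of_real t))))"

text \<open>A line crossing between \<open>N\<close> and \<open>N + 1\<close> produces exactly the
  terms up to \<open>N\<close>. It can be kept a quarter away from the integers and within a quarter
  of \<open>P\<close>, while the saddle for \<open>t\<close> moves by at most 1/2 from
  \<open>P\<close>.\<close>

lemma hardy_Z_approx:
  "\<exists>C>0. \<forall>T\<ge>400. \<forall>t. \<bar>t - T\<bar> \<le> sqrt T \<longrightarrow>
     norm (hardy_Z t - of_real (RS_main T t)) \<le> C * T powr (- 1/4)"
proof -
  obtain C where C: "C > 0" "\<And>(N::nat) \<theta> t. \<theta> \<in> {1/4..3/4} \<Longrightarrow> t \<ge> 100 \<Longrightarrow> \<bar>real N + \<theta> - sqrt (t / (2 * pi))\<bar> \<le> 1 \<Longrightarrow>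
     norm (rs_int (real N + \<theta>) (1/2 + \<i> * of_real t)) \<le> C * t powr (- 1/4)"
    using rs_int_bound by metis
  obtain \<kappa> where k: "\<forall>N::nat. \<forall>\<theta>\<in>{1/4..3/4}. line_bound (real N + \<theta>) \<kappa>"
    using line_bound_uniform by blast
  show ?thesis
  proof (intro exI[of _ "4 * C"] conjI allI impI)
    fix T t :: real assume T: "T \<ge> 400" and t: "\<bar>t - T\<bar> \<le> sqrt T"
    define P where "P = sqrt (T / (2 * pi))"
    define N where "N = nat \<lfloor>P\<rfloor>"
    \<comment> \<open>The fractional part of \<open>P\<close>, clamped to the middle half of the
      unit interval; the clamping moves the line by at most 1/4.\<close>
    define \<theta> where "\<theta> = max (1/4) (min (3/4) (P - real N))"
    have "2^2 \<le> T / (2 * pi)" using T pi_less_4 by (simp add: field_simps)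
    then have P2: "P \<ge> 2" unfolding P_def by (rule real_le_rsqrt)
    have NP: "real N \<le> P" "P < real N + 1" using P2 unfolding N_def by linarith+
    have N1: "N \<ge> 1" using P2 unfolding N_def by linarith
    have \<theta>: "\<theta> \<in> {1/4..3/4}" "\<bar>real N + \<theta> - P\<bar> \<le> 1/4" using NP unfolding \<theta>_def by (auto simp: max_def min_def abs_if)
    have sT: "sqrt T \<le> T / 2"
    proof -
      have "2 \<le> sqrt T" using T by (intro real_le_rsqrt) simp
      then have "2 * sqrt T \<le> sqrt T * sqrt T" using T by (intro mult_right_mono) auto
      then show ?thesis using T by simp
    qed
    have t100: "t \<ge> 100" "t \<ge> T / 2" "t > 0" using t sT T by linarith+
    define u where "u = sqrt (t / (2 * pi))"
    have u0: "u \<ge> 0" using t100 by (simp add: u_def)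
    \<comment> \<open>Here \<open>\<bar>t - T\<bar> \<le> sqrt T\<close> enters: the difference of
      squares is at most \<open>P / 2\<close>, so the factor \<open>u - P\<close> is at most
      1/2.\<close>
    have "u^2 - P^2 = (t - T) / (2 * pi)" using t100 T by (simp add: u_def P_def diff_divide_distrib)
    then have "(u - P) * (u + P) = (t - T) / (2 * pi)" by (simp add: power2_eq_square algebra_simps)
    then have eq: "\<bar>(u - P) * (u + P)\<bar> = \<bar>t - T\<bar> / (2 * pi)" by simp
    have "\<bar>u - P\<bar> * (u + P) = \<bar>(u - P) * (u + P)\<bar>" using u0 P2 by (simp add: abs_mult)
    also have "\<dots> = \<bar>t - T\<bar> / (2 * pi)" by (rule eq)
    also have "\<dots> \<le> sqrt T / (2 * pi)" using t by (intro divide_right_mono) auto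
    also have "\<dots> = P * (1 / sqrt (2 * pi))"
      by (simp add: P_def real_sqrt_divide)
    also have "\<dots> \<le> P * (1/2)"
    proof (intro mult_left_mono)
      have "2 \<le> sqrt (2 * pi)" using pi_gt3 by (intro real_le_rsqrt) simp
      then show "1 / sqrt (2 * pi) \<le> 1/2" by (intro divide_left_mono) auto
    qed (use P2 in auto)
    also have "\<dots> \<le> 1/2 * (u + P)" using u0 P2 by simp
    finally have "\<bar>u - P\<bar> \<le> 1/2" using u0 P2 by (simp add: mult_le_cancel_right)
    then have near: "\<bar>real N + \<theta> - sqrt (t / (2 * pi))\<bar> \<le> 1" using \<theta>(2) unfolding u_def by linarith
    define s where "s = 1/2 + \<i> * complex_of_real t"
    define e where "e = exp (\<i> * complex_of_real (RS_theta t))"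
    have c: "real N + \<theta> > 1/2" using N1 \<theta> by simp
    have lb: "line_bound (real N + \<theta>) \<kappa>" using k \<theta> by blast
    have set: "{n. 0 < n \<and> real n < real N + \<theta>} = {1..N}"
    proof -
      have iff: "real n < real N + \<theta> \<longleftrightarrow> n \<le> N" for n
      proof (cases "n \<le> N")
        case False
        then have "real n \<ge> real N + 1" by simp
        then show ?thesis using False \<theta>(1) by auto
      qed (use \<theta>(1) in auto)
      show ?thesis unfolding iff by auto
    qed
    have Z: "hardy_Z t = of_real (2 * Re (e * ((\<Sum>n=1..N. of_nat n powr (- s)) - rs_int (real N + \<theta>) s)))"
      using hardy_Z_eq[OF t100(3) c lb] unfolding set s_def e_def by simp
    have "hardy_Z t - of_real (2 * Re (e * (\<Sum>n=1..N. of_nat n powr (- s)))) = of_real (- 2 * Re (e * rs_int (real N + \<theta>) s))"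
      unfolding Z by (simp add: right_diff_distrib)
    then have "norm (hardy_Z t - of_real (2 * Re (e * (\<Sum>n=1..N. of_nat n powr (- s))))) = 2 * \<bar>Re (e * rs_int (real N + \<theta>) s)\<bar>"
      by (simp only: norm_of_real abs_mult abs_neg_numeral abs_minus_cancel abs_numeral)
    also have "\<dots> \<le> 2 * norm (e * rs_int (real N + \<theta>) s)" by (intro mult_left_mono abs_Re_le_cmod) auto
    also have "\<dots> = 2 * norm (rs_int (real N + \<theta>) s)" by (simp add: norm_mult e_def)
    also have "\<dots> \<le> 2 * (C * t powr (- 1/4))" unfolding s_def using C(2)[OF \<theta>(1) t100(1) near] by simp
    also have "\<dots> \<le> 2 * (C * (2 * T powr (- 1/4)))"
    proof -
      have "t powr (- 1/4) \<le> (T / 2) powr (- 1/4)" using t100 T by (intro powr_mono2') auto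
      also have "\<dots> = T powr (- 1/4) * 2 powr (1/4)" using T by (simp add: powr_divide powr_minus_divide)
      also have "\<dots> \<le> T powr (- 1/4) * 2 powr 1" by (intro mult_left_mono powr_mono) auto
      finally show ?thesis using C(1) by (simp add: mult_ac)
    qed
    finally show "norm (hardy_Z t - of_real (RS_main T t)) \<le> 4 * C * T powr (- 1/4)"
      unfolding RS_main_def e_def s_def N_def P_def by simp
  qed (use C in auto)
qed

section \<open>Geometric sums over the progression of Gram points\<close>

lemma of_nat_powr_imaginary:
  assumes "n \<ge> 1"
  shows "of_nat n powr (- (\<i> * of_real t)) = cis (- (t * ln (real n)))"
    and "of_nat n powr (- (1/2 + \<i> * of_real t)) = of_real (real n powr (- 1/2)) * cis (- (t * ln (real n)))"
proof -
  have L: "Ln (of_nat n) = of_real (ln (real n))" using assms Ln_of_real[of "real n"] by simp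
  have nz: "complex_of_nat n \<noteq> 0" using assms by simp
  show 1: "of_nat n powr (- (\<i> * of_real t)) = cis (- (t * ln (real n)))"
    using nz by (simp add: powr_def L cis_conv_exp mult_ac)
  have "of_nat n powr (- (1/2 + \<i> * of_real t)) = of_nat n powr (- (1/2)) * of_nat n powr (- (\<i> * complex_of_real t))"
    by (simp flip: powr_add)
  also have "of_nat n powr (- (1/2)) = complex_of_real (real n powr (- 1/2))"
    using powr_of_real[of "real n" "- 1/2"] by simp
  finally show "of_nat n powr (- (1/2 + \<i> * of_real t)) = of_real (real n powr (- 1/2)) * cis (- (t * ln (real n)))"
    unfolding 1 .
qed

lemma norm_cis_diff_le: "norm (cis a - cis b) \<le> \<bar>a - b\<bar>"
proof -
  have "cis a - cis b = cis b * (cis (a - b) - 1)" by (simp add: right_diff_distrib cis_mult)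
  then have "norm (cis a - cis b) = norm (cis (a - b) - 1)" by (simp add: norm_mult)
  also have "\<dots> = 2 * \<bar>sin ((a - b) / 2)\<bar>" unfolding cis_conv_exp by (rule dist_exp_i_1)
  also have "\<dots> \<le> 2 * \<bar>(a - b) / 2\<bar>" by (intro mult_left_mono abs_sin_x_le_abs_x) simp
  finally show ?thesis by simp
qed

text \<open>The contribution of a single \<open>n\<close>, with \<open>l = ln n\<close>, when the
  Gram points of one parity are replaced by the progression
  \<open>t0 + (2 * pi * k + \<tau>) / \<omega>\<close>. The factor \<open>cis \<tau>\<close> is the
  phase \<open>exp (\<i> * \<theta>)\<close> there, up to the sign common to the parity; the
  \<open>+ 0\<close> is the same formula for the unshifted points.\<close>

definition gram_phase_sum :: "real \<Rightarrow> real \<Rightarrow> nat \<Rightarrow> real \<Rightarrow> real \<Rightarrow> complex" where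
  "gram_phase_sum \<omega> t0 K \<tau> l =
     (\<Sum>k<K. cis \<tau> * cis (- ((t0 + (2 * pi * real k + \<tau>) / \<omega>) * l)) - cis (- ((t0 + (2 * pi * real k + 0) / \<omega>) * l)))"

text \<open>The shift of the point by \<open>\<tau> / \<omega>\<close> combines with
  \<open>cis \<tau>\<close> to \<open>cis (\<tau> * \<lambda>)\<close>, and the step
  \<open>2 * pi / \<omega>\<close> gives the ratio \<open>cis (2 * pi * \<lambda>)\<close>, where
  \<open>\<lambda> = 1 - l / \<omega>\<close>.\<close>

lemma gram_phase_sum_eq:
  assumes "\<omega> > 0"
  shows "gram_phase_sum \<omega> t0 K \<tau> l =
    (cis (\<tau> * (1 - l / \<omega>)) - 1) * cis (- (t0 * l)) * (\<Sum>k<K. cis (2 * pi * (1 - l / \<omega>)) ^ k)"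
    and "cis (2 * pi * (1 - l / \<omega>)) ^ k = cis (- (2 * pi * real k * l / \<omega>))"
proof -
  have "cis (2 * pi * (1 - l / \<omega>)) = cis (2 * pi + - (2 * pi * l / \<omega>))" by (simp add: right_diff_distrib)
  also have "\<dots> = cis (2 * pi) * cis (- (2 * pi * l / \<omega>))" by (rule cis_mult[symmetric])
  also have "\<dots> = cis (- (2 * pi * l / \<omega>))" by simp
  finally have z1: "cis (2 * pi * (1 - l / \<omega>)) = cis (- (2 * pi * l / \<omega>))" .
  have z: "cis (2 * pi * (1 - l / \<omega>)) ^ k = cis (- (2 * pi * real k * l / \<omega>))" for k
    unfolding z1 Complex.DeMoivre by (rule arg_cong[where f = cis]) simp
  then show "cis (2 * pi * (1 - l / \<omega>)) ^ k = cis (- (2 * pi * real k * l / \<omega>))" .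
  have "cis \<tau> * cis (- ((t0 + (2 * pi * real k + \<tau>) / \<omega>) * l)) - cis (- ((t0 + (2 * pi * real k + 0) / \<omega>) * l))
      = (cis (\<tau> * (1 - l / \<omega>)) - 1) * cis (- (t0 * l)) * cis (- (2 * pi * real k * l / \<omega>))" for k
    unfolding left_diff_distrib cis_mult mult_1_left
    by (intro arg_cong2[where f = "(-)"] arg_cong[where f = cis]) (use assms in \<open>simp_all add: field_simps\<close>)
  then show "gram_phase_sum \<omega> t0 K \<tau> l =
    (cis (\<tau> * (1 - l / \<omega>)) - 1) * cis (- (t0 * l)) * (\<Sum>k<K. cis (2 * pi * (1 - l / \<omega>)) ^ k)"
    unfolding gram_phase_sum_def z sum_distrib_left by simp
qed

text \<open>For \<open>n = 1\<close> the ratio is 1 and nothing cancels; this is the source of the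
  main term.\<close>

lemma gram_phase_sum_one:
  "\<omega> > 0 \<Longrightarrow> gram_phase_sum \<omega> t0 K \<tau> 0 = of_nat K * (cis \<tau> - 1)"
  by (simp add: gram_phase_sum_eq)

text \<open>For \<open>0 < \<lambda> < 1\<close> the ratio differs from 1 and the geometric sum
  collapses to its two ends, which are \<open>n powr (- \<i> * t)\<close> at the first point of the
  progression and one step past its last.\<close>

lemma gram_phase_sum_weight:
  assumes \<omega>: "\<omega> > 0" and l: "0 < l" "l < \<omega>"
  shows "gram_phase_sum \<omega> t0 K \<tau> l = gram_weight \<tau> (1 - l / \<omega>) * (cis (- ((t0 + 2 * pi * real K / \<omega>) * l)) - cis (- (t0 * l)))"
proof -
  define x where "x = 1 - l / \<omega>"
  have x: "0 < x" "x < 1" using \<omega> l by (simp_all add: x_def)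
  have "0 < 3 * (1 - x)" using x by simp
  also have "\<dots> \<le> norm (phase_quot (2 * pi) x)" by (rule phase_quot_ge[OF x])
  finally have "norm (phase_quot (2 * pi) x) > 0" .
  then have z1: "cis (2 * pi * x) \<noteq> 1" by (auto simp: phase_quot_def cis_conv_exp)
  have w: "gram_weight \<tau> x = (cis (\<tau> * x) - 1) / (cis (2 * pi * x) - 1)"
    by (simp add: gram_weight_def cis_conv_exp)
  have "gram_phase_sum \<omega> t0 K \<tau> l = (cis (\<tau> * x) - 1) * cis (- (t0 * l)) * ((cis (2 * pi * x) ^ K - 1) / (cis (2 * pi * x) - 1))"
    unfolding gram_phase_sum_eq(1)[OF \<omega>] x_def[symmetric] by (subst geometric_sum[OF z1]) simp
  also have "\<dots> = gram_weight \<tau> x * (cis (- (t0 * l)) * cis (2 * pi * x) ^ K - cis (- (t0 * l)))"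
  proof -
    have "(a - 1) * b * ((q - 1) / d) = (a - 1) / d * (b * q - b)" for a b q d :: complex
    proof -
      have "b * q - b = b * (q - 1)" by (simp add: right_diff_distrib)
      then show ?thesis by simp
    qed
    then show ?thesis unfolding w .
  qed
  also have "cis (- (t0 * l)) * cis (2 * pi * x) ^ K = cis (- ((t0 + 2 * pi * real K / \<omega>) * l))"
    unfolding x_def gram_phase_sum_eq(2)[OF \<omega>] cis_mult
    by (rule arg_cong[where f = cis]) (simp add: field_simps)
  finally show ?thesis by (simp add: x_def)
qed

lemma gram_phase_sum_trivial: "norm (gram_phase_sum \<omega> t0 K \<tau> l) \<le> 2 * real K"
proof -
  have "norm (cis \<tau> * cis a - cis b) \<le> 2" for a b
    using norm_triangle_ineq4[of "cis \<tau> * cis a" "cis b"] by (simp add: norm_mult)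
  then have "norm (gram_phase_sum \<omega> t0 K \<tau> l) \<le> (\<Sum>k<K. 2)"
    unfolding gram_phase_sum_def by (intro order.trans[OF norm_sum] sum_mono)
  then show ?thesis by simp
qed

text \<open>\<open>Z\<close> is replaced by the main sum, then each Gram point by a point of the
  progression. The condition \<open>h \<le> T powr (1/4)\<close> makes the first error, summed over
  \<open>K\<close> points, \<open>O(ln T)\<close>; the condition on \<open>h ^ 3\<close> does this
  for the second. The pair \<open>p\<close>, \<sigma> encodes the parity and the sign
  \<open>cis (pi * p)\<close>.\<close>

lemma gram_sum_main_estimate:
  fixes \<nu>1 :: int and p :: int
  assumes T: "T \<ge> 400" and h: "1 \<le> h" "5 * h \<le> sqrt T" "h \<le> T powr (1/4)" "h ^ 3 / T * ln T * T powr (1/4) \<le> 1"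
    and H: "0 < H" "H \<le> h" and \<tau>: "\<bar>\<tau>\<bar> \<le> pi"
    and \<omega>_def: "\<omega> = ln (T / (2 * pi)) / 2" and \<omega>1: "\<omega> \<ge> 1"
    and p: "p = 0 \<and> \<sigma> = 1 \<or> p = 1 \<and> \<sigma> = (-1::real)"
    and Cz: "Cz > 0" "\<And>t. \<bar>t - T\<bar> \<le> sqrt T \<Longrightarrow>
     norm (hardy_Z t - of_real (RS_main T t)) \<le> Cz * T powr (- 1/4)"
    and W: "\<And>N t. real N \<le> sqrt (T / (2 * pi)) \<Longrightarrow> T \<le> t \<Longrightarrow> t \<le> 2 * T \<Longrightarrow>
    norm (gram_weight_sum \<tau> T N t) \<le> W"
    and K: "K \<ge> 1" "\<bar>real K - H * \<omega> / (2 * pi)\<bar> \<le> 2"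
    and g: "\<And>k \<tau>'. k < K \<Longrightarrow> \<bar>\<tau>'\<bar> \<le> pi \<Longrightarrow> RS_theta (gram_pt (2 * (\<nu>1 + int k) + p) \<tau>') = pi * of_int (2 * (\<nu>1 + int k) + p) + \<tau>'"
      "\<And>k \<tau>'. k < K \<Longrightarrow> \<bar>\<tau>'\<bar> \<le> pi \<Longrightarrow> \<bar>gram_pt (2 * (\<nu>1 + int k) + p) \<tau>' - T\<bar> \<le> H + 4"
      "T \<le> gram_pt (2 * \<nu>1 + p) 0" "gram_pt (2 * \<nu>1 + p) 0 \<le> T + H"
  shows "norm ((\<Sum>k<K. hardy_Z (gram_pt (2 * (\<nu>1 + int k) + p) \<tau>) - hardy_Z (gram_pt (2 * (\<nu>1 + int k) + p) 0))
      - of_real (\<sigma> * (- (1 / pi) * H * ln (T / (2 * pi)) * (sin (\<tau> / 2))\<^sup>2)))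
      \<le> (6 * Cz + 3680) * ln T + 4 * W"
proof -
  define P where "P = sqrt (T / (2 * pi))"
  define N where "N = nat \<lfloor>P\<rfloor>"
  define t0 where "t0 = gram_pt (2 * \<nu>1 + p) 0"
  define G where "G = (\<lambda>k \<tau>'. gram_pt (2 * (\<nu>1 + int k) + p) \<tau>')"
  define x where "x = (\<lambda>k \<tau>'. t0 + (2 * pi * real k + \<tau>') / \<omega>)"
  \<comment> \<open>The phase \<tau>' and the point \<open>t\<close> are separate arguments: the
    phase at a Gram point is known exactly, and only the point inside
    \<open>n powr (- \<i> * t)\<close> is to be approximated.\<close>
  define Y where "Y = (\<lambda>\<tau>' t. \<Sum>n=1..N. complex_of_real (real n powr (- 1/2)) * (cis \<tau>' * cis (- (t * ln (real n)))))"
  \<comment> \<open>From \<open>RS_theta_linear\<close> with \<open>X = H + 4\<close>: the relative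
    error \<open>3 * X / T\<close> times a distance of at most \<open>2 * X\<close>. The 4 covers a
    shift by up to pi.\<close>
  define E where "E = 6 * (H + 4)^2 / T"
  define m where "m = T powr (- 1/4)"
  have \<omega>0: "\<omega> > 0" using \<omega>1 by simp
  have lnT: "ln T \<ge> 1" using T exp_le by (subst ln_ge_iff) auto
  have m0: "m > 0" using T by (simp add: m_def)
  have "T / (2 * pi) \<le> T / 1" using T pi_gt3 by (intro divide_left_mono) auto
  then have "ln (T / (2 * pi)) \<le> ln T" using T by (subst ln_le_cancel_iff) auto
  then have \<omega>T: "\<omega> \<le> ln T / 2" by (simp add: \<omega>_def)
  have \<sigma>: "\<bar>\<sigma>\<bar> = 1" using p by auto
  have cp: "cis (pi * of_int (2 * (\<nu>1 + int k) + p)) = of_real \<sigma>" for k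
  proof -
    have "pi * of_int (2 * (\<nu>1 + int k) + p) = 2 * pi * of_int (\<nu>1 + int k) + pi * of_int p" by (simp add: algebra_simps)
    then have "cis (pi * of_int (2 * (\<nu>1 + int k) + p)) = cis (2 * pi * of_int (\<nu>1 + int k)) * cis (pi * of_int p)"
      by (simp only: cis_mult)
    also have "cis (2 * pi * of_int (\<nu>1 + int k)) = 1" by (rule cis_multiple_2pi) simp
    finally show ?thesis using p by auto
  qed
  have "16 \<le> T / (2 * pi)" using T pi_less_4 pi_approx by (simp add: field_simps)
  then have P4: "P \<ge> 4" unfolding P_def by (intro real_le_rsqrt) auto
  have NP: "real N \<le> P" "P < real N + 1" using P4 unfolding N_def by linarith+
  have N4: "N \<ge> 4" using P4 unfolding N_def by linarith
  have PT: "P \<le> sqrt T" unfolding P_def using \<open>T / (2 * pi) \<le> T / 1\<close> by simp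
  have lnP: "ln P = \<omega>" unfolding P_def \<omega>_def using T by (simp add: ln_sqrt)
  have HX: "H + 4 \<le> 5 * h" "H + 4 \<le> sqrt T" using H h by linarith+
  have sT: "sqrt T \<le> T / 4"
  proof -
    have "4 \<le> sqrt T" using T by (intro real_le_rsqrt) simp
    then have "4 * sqrt T \<le> sqrt T * sqrt T" using T by (intro mult_right_mono) auto
    then show ?thesis using T by simp
  qed
  have K3: "real K \<le> 3 * h * ln T"
  proof -
    have "H * \<omega> / (2 * pi) \<le> h * (ln T / 2) / 1"
      using H \<omega>T \<omega>0 pi_gt3 h lnT by (intro frac_le mult_mono) auto
    moreover have "1 * 1 \<le> h * ln T" using h lnT by (intro mult_mono) auto
    ultimately show ?thesis using K(2) by (simp add: abs_le_iff)
  qed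
  have Gx: "\<bar>G k \<tau>' - x k \<tau>'\<bar> \<le> E" if k: "k < K" and t': "\<bar>\<tau>'\<bar> \<le> pi" for k \<tau>'
  proof -
    have b: "\<bar>G k \<tau>' - T\<bar> \<le> H + 4" using g(2)[OF k t'] by (simp add: G_def)
    have a: "\<bar>t0 - T\<bar> \<le> H + 4" using g(3,4) H by (simp add: t0_def)
    have "\<bar>(RS_theta (G k \<tau>') - RS_theta t0) - ln (T / (2 * pi)) / 2 * (G k \<tau>' - t0)\<bar> \<le> 3 * (H + 4) / T * \<bar>G k \<tau>' - t0\<bar>"
      by (rule RS_theta_linear[OF T _ _ a b]) (use H HX sT in auto)
    also have "\<dots> \<le> 3 * (H + 4) / T * (2 * (H + 4))"
      using a b H T by (intro mult_left_mono) auto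
    also have "\<dots> = E" by (simp add: E_def power2_eq_square field_simps)
    finally have "\<bar>(RS_theta (G k \<tau>') - RS_theta t0) - \<omega> * (G k \<tau>' - t0)\<bar> \<le> E" unfolding \<omega>_def .
    moreover have "RS_theta (G k \<tau>') - RS_theta t0 = 2 * pi * real k + \<tau>'"
      using g(1)[OF k t'] g(1)[of 0 0] K(1) by (simp add: G_def t0_def algebra_simps)
    moreover have "2 * pi * real k + \<tau>' = \<omega> * (x k \<tau>' - t0)" using \<omega>0 by (simp add: x_def)
    ultimately have "\<bar>\<omega> * (x k \<tau>' - G k \<tau>')\<bar> \<le> E" by (simp add: algebra_simps)
    then have "\<omega> * \<bar>G k \<tau>' - x k \<tau>'\<bar> \<le> E" using \<omega>0 by (simp add: abs_mult abs_minus_commute)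
    moreover have "1 * \<bar>G k \<tau>' - x k \<tau>'\<bar> \<le> \<omega> * \<bar>G k \<tau>' - x k \<tau>'\<bar>" using \<omega>1 by (intro mult_right_mono) auto
    ultimately show ?thesis by simp
  qed
  have ZY: "norm (hardy_Z (G k \<tau>') - of_real (2 * \<sigma> * Re (Y \<tau>' (G k \<tau>')))) \<le> Cz * m" if k: "k < K" and t': "\<bar>\<tau>'\<bar> \<le> pi" for k \<tau>'
  proof -
    have near: "\<bar>G k \<tau>' - T\<bar> \<le> sqrt T" using g(2)[OF k t'] HX by (simp add: G_def)
    have "exp (\<i> * of_real (RS_theta (G k \<tau>'))) = of_real \<sigma> * cis \<tau>'"
      unfolding cis_conv_exp[symmetric] G_def g(1)[OF k t'] cis_mult[symmetric] cp ..
    moreover have "(\<Sum>n=1..N. of_nat n powr (- (1/2 + \<i> * of_real (G k \<tau>')))) = (\<Sum>n=1..N. complex_of_real (real n powr (- 1/2)) * cis (- (G k \<tau>' * ln (real n))))"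
      by (intro sum.cong refl of_nat_powr_imaginary(2)) auto
    ultimately have "exp (\<i> * of_real (RS_theta (G k \<tau>'))) * (\<Sum>n=1..N. of_nat n powr (- (1/2 + \<i> * of_real (G k \<tau>')))) = of_real \<sigma> * Y \<tau>' (G k \<tau>')"
      by (simp add: Y_def sum_distrib_left mult_ac)
    then have "2 * Re (exp (\<i> * of_real (RS_theta (G k \<tau>'))) * (\<Sum>n=1..N. of_nat n powr (- (1/2 + \<i> * of_real (G k \<tau>'))))) = 2 * \<sigma> * Re (Y \<tau>' (G k \<tau>'))"
      by simp
    then show ?thesis using Cz(2)[OF near] unfolding RS_main_def N_def P_def m_def by simp
  qed
  have S1: "(\<Sum>n=1..N. real n powr (- 1/2)) \<le> 2 * T powr (1/4)"
  proof -
    have "(\<Sum>n=1..N. real n powr (- 1/2)) \<le> 2 * sqrt (real N)" by (rule sum_inverse_sqrt_le)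
    also have "sqrt (real N) \<le> sqrt (sqrt T)" using NP PT by simp
    also have "sqrt (sqrt T) = T powr (1/4)" using T by (simp add: powr_half_sqrt[symmetric] powr_powr)
    finally show ?thesis by simp
  qed
  have YL: "norm (Y \<tau>' a - Y \<tau>' b) \<le> 2 * T powr (1/4) * (ln T * \<bar>a - b\<bar>)" for \<tau>' a b
  proof -
    have "norm (Y \<tau>' a - Y \<tau>' b) \<le> (\<Sum>n=1..N. real n powr (- 1/2) * (ln T * \<bar>a - b\<bar>))"
      unfolding Y_def sum_subtractf[symmetric]
    proof (rule order.trans[OF norm_sum], rule sum_mono)
      fix n assume n: "n \<in> {1..N}"
      define y where "y = (\<lambda>t. complex_of_real (real n powr (- 1/2)) * (cis \<tau>' * cis (- (t * ln (real n)))))"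
      have "y a - y b = complex_of_real (real n powr (- 1/2)) * (cis \<tau>' * (cis (- (a * ln (real n))) - cis (- (b * ln (real n)))))"
        by (simp add: y_def right_diff_distrib)
      also have "norm \<dots> = real n powr (- 1/2) * norm (cis (- (a * ln (real n))) - cis (- (b * ln (real n))))"
        by (simp add: norm_mult)
      also have "\<dots> \<le> real n powr (- 1/2) * \<bar>- (a * ln (real n)) - - (b * ln (real n))\<bar>"
        by (intro mult_left_mono norm_cis_diff_le) auto
      also have "\<bar>- (a * ln (real n)) - - (b * ln (real n))\<bar> = ln (real n) * \<bar>a - b\<bar>"
      proof -
        have "- (a * ln (real n)) - - (b * ln (real n)) = - (ln (real n) * (a - b))" by (simp add: algebra_simps)
        then show ?thesis using n by (simp add: abs_mult)
      qed
      also have "real n powr (- 1/2) * (ln (real n) * \<bar>a - b\<bar>) \<le> real n powr (- 1/2) * (ln T * \<bar>a - b\<bar>)"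
      proof (intro mult_left_mono mult_right_mono)
        have "real n \<le> sqrt T" using n NP PT by auto
        also have "\<dots> \<le> T" using sT T by simp
        finally show "ln (real n) \<le> ln T" using n by (intro ln_mono) auto
      qed auto
      finally show "norm (complex_of_real (real n powr (- 1/2)) * (cis \<tau>' * cis (- (a * ln (real n)))) - complex_of_real (real n powr (- 1/2)) * (cis \<tau>' * cis (- (b * ln (real n)))))
        \<le> real n powr (- 1/2) * (ln T * \<bar>a - b\<bar>)" unfolding y_def .
    qed
    also have "\<dots> = (\<Sum>n=1..N. real n powr (- 1/2)) * (ln T * \<bar>a - b\<bar>)" by (simp add: sum_distrib_right)
    also have "\<dots> \<le> 2 * T powr (1/4) * (ln T * \<bar>a - b\<bar>)" using lnT by (intro mult_right_mono S1) auto
    finally show ?thesis .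
  qed
  define z where "z = (\<lambda>k \<tau>'. hardy_Z (G k \<tau>'))"
  define a where "a = (\<lambda>k \<tau>'. complex_of_real (2 * \<sigma> * Re (Y \<tau>' (x k \<tau>'))))"
  define \<delta> where "\<delta> = Cz * m + 2 * (2 * T powr (1/4) * (ln T * E))"
  have Zx: "norm (z k \<tau>' - a k \<tau>') \<le> \<delta>" if k: "k < K" and t': "\<bar>\<tau>'\<bar> \<le> pi" for k \<tau>'
  proof -
    define b where "b = complex_of_real (2 * \<sigma> * Re (Y \<tau>' (G k \<tau>')))"
    have "norm (b - a k \<tau>') = 2 * \<bar>Re (Y \<tau>' (G k \<tau>') - Y \<tau>' (x k \<tau>'))\<bar>"
      unfolding a_def b_def of_real_diff[symmetric] norm_of_real using \<sigma> by (simp add: abs_mult flip: right_diff_distrib)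
    also have "\<dots> \<le> 2 * norm (Y \<tau>' (G k \<tau>') - Y \<tau>' (x k \<tau>'))" by (intro mult_left_mono abs_Re_le_cmod) auto
    also have "\<dots> \<le> 2 * (2 * T powr (1/4) * (ln T * \<bar>G k \<tau>' - x k \<tau>'\<bar>))" by (intro mult_left_mono YL) auto
    also have "\<dots> \<le> 2 * (2 * T powr (1/4) * (ln T * E))" using Gx[OF k t'] lnT by (intro mult_left_mono) auto
    finally have "norm (b - a k \<tau>') \<le> 2 * (2 * T powr (1/4) * (ln T * E))" .
    moreover have "norm (z k \<tau>' - b) \<le> Cz * m" using ZY[OF k t'] by (simp add: z_def b_def)
    ultimately show ?thesis unfolding \<delta>_def using norm_triangle_ineq[of "z k \<tau>' - b" "b - a k \<tau>'"] by simp
  qed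
  define V where "V = (\<Sum>k<K. Y \<tau> (x k \<tau>) - Y 0 (x k 0))"
  define S where "S = (\<Sum>k<K. z k \<tau> - z k 0)"
  have SV: "norm (S - of_real (2 * \<sigma> * Re V)) \<le> real K * (2 * \<delta>)"
  proof -
    have "complex_of_real (2 * \<sigma> * Re V) = (\<Sum>k<K. a k \<tau> - a k 0)"
      by (simp add: V_def a_def sum_distrib_left sum_subtractf right_diff_distrib)
    then have "S - of_real (2 * \<sigma> * Re V) = (\<Sum>k<K. (z k \<tau> - a k \<tau>) - (z k 0 - a k 0))"
      unfolding S_def by (simp add: sum_subtractf)
    also have "norm \<dots> \<le> (\<Sum>k<K. 2 * \<delta>)"
    proof (rule order.trans[OF norm_sum], rule sum_mono)
      fix k assume "k \<in> {..<K}"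
      then have k: "k < K" by simp
      show "norm ((z k \<tau> - a k \<tau>) - (z k 0 - a k 0)) \<le> 2 * \<delta>"
        using Zx[OF k \<tau>] Zx[OF k, of 0] norm_triangle_ineq4[of "z k \<tau> - a k \<tau>" "z k 0 - a k 0"] by simp
    qed
    finally show ?thesis by simp
  qed
  define f where "f = (\<lambda>n. complex_of_real (real n powr (- 1/2)) * gram_phase_sum \<omega> t0 K \<tau> (ln (real n)))"
  have Vf: "V = (\<Sum>n=1..N. f n)"
    unfolding V_def Y_def f_def gram_phase_sum_def x_def sum_subtractf[symmetric] sum_distrib_left
    by (subst sum.swap) (simp add: right_diff_distrib)
  have split: "(\<Sum>n=1..N. f n) = f 1 + (\<Sum>n=2..<N-1. f n) + f (N - 1) + f N"
  proof -
    obtain q where q: "N = q + 4" using N4 le_Suc_ex[of 4 N] by (auto simp: add.commute)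
    have "{1..N} = insert 1 (insert (N - 1) (insert N {2..<N-1}))" unfolding q by auto
    then show ?thesis unfolding q by simp
  qed
  have f1: "f 1 = of_nat K * (cis \<tau> - 1)" using gram_phase_sum_one[OF \<omega>0] by (simp add: f_def)
  \<comment> \<open>The last two terms use the trivial bound \<open>2 * K\<close> for the phase sum;
    \<open>n \<ge> sqrt T / 9\<close> makes the coefficient at most
    \<open>3 * T powr (-1/4)\<close>.\<close>
  have fl: "norm (f n) \<le> 6 * real K * m" if n: "n \<ge> N - 1" for n
  proof -
    have "real n \<ge> P / 2"
    proof -
      have "real n \<ge> real N - 1" using n by linarith
      then show ?thesis using NP P4 by linarith
    qed
    moreover have "P / 2 \<ge> sqrt T / 9"
    proof -
      have "sqrt (2 * pi) \<le> 3" using pi_less_4 by (intro real_le_lsqrt) auto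
      then have "sqrt T / (9/2) \<le> sqrt T / sqrt (2 * pi)" using T by (intro divide_left_mono) auto
      then have "sqrt T / (9/2) / 2 \<le> sqrt T / sqrt (2 * pi) / 2" by (intro divide_right_mono) auto
      then show ?thesis unfolding P_def real_sqrt_divide by simp
    qed
    ultimately have "real n \<ge> sqrt T / 9" by linarith
    then have "real n powr (- 1/2) \<le> (sqrt T / 9) powr (- 1/2)" using T by (intro powr_mono2') auto
    also have "\<dots> = 3 * m"
    proof -
      have "(sqrt T / 9) powr (- 1/2) = sqrt T powr (- 1/2) / 9 powr (- 1/2)" using T by (simp add: powr_divide)
      also have "sqrt T powr (- 1/2) = m" using T by (simp add: m_def powr_half_sqrt[symmetric] powr_powr)
      also have "(9::real) powr (- 1/2) = 1 / 3" by (simp add: powr_minus_divide powr_half_sqrt)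
      finally show ?thesis by simp
    qed
    finally have "norm (f n) \<le> (3 * m) * (2 * real K)"
      unfolding f_def norm_mult using gram_phase_sum_trivial m0 by (intro mult_mono) auto
    then show ?thesis by (simp add: mult_ac)
  qed
  have mid: "norm (\<Sum>n=2..<N-1. f n) \<le> 2 * W"
  proof -
    \<comment> \<open>One step past the last point of the progression. It is the same for all
      \<open>n\<close>, so the middle terms combine into a difference of two values of
      \<open>gram_weight_sum\<close>.\<close>
    define t1 where "t1 = t0 + 2 * pi * real K / \<omega>"
    define w where "w = gram_weight_sum \<tau> T N"
    have "(\<Sum>n=2..<N-1. f n) = w t1 - w t0"
      unfolding w_def gram_weight_sum_def sum_subtractf[symmetric]
    proof (rule sum.cong[OF refl])
      fix n assume n: "n \<in> {2..<N-1}"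
      have "ln (real n) > 0" using n by simp
      moreover have "ln (real n) < \<omega>" unfolding lnP[symmetric] using n NP P4 by (subst ln_less_cancel_iff) auto
      ultimately have "f n = of_real (real n powr (- 1/2)) * (gram_weight \<tau> (1 - ln (real n) / \<omega>) * (cis (- (t1 * ln (real n))) - cis (- (t0 * ln (real n)))))"
        unfolding f_def t1_def by (subst gram_phase_sum_weight[OF \<omega>0]) auto
      moreover have "of_nat n powr (- (\<i> * of_real t)) = cis (- (t * ln (real n)))" for t
        using n by (intro of_nat_powr_imaginary(1)) auto
      ultimately show "f n = gram_weight \<tau> (1 - ln (real n) / (ln (T / (2 * pi)) / 2)) * (of_real (real n powr (- 1/2)) * of_nat n powr (- (\<i> * of_real t1)))
        - gram_weight \<tau> (1 - ln (real n) / (ln (T / (2 * pi)) / 2)) * (of_real (real n powr (- 1/2)) * of_nat n powr (- (\<i> * of_real t0)))"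
        unfolding \<omega>_def[symmetric] by (simp add: algebra_simps)
    qed
    moreover have "norm (w t1) \<le> W"
      unfolding w_def
    proof (rule W)
      show "real N \<le> sqrt (T / (2 * pi))" using NP by (simp add: P_def)
      show "T \<le> t1" using g(3) \<omega>0 by (simp add: t1_def t0_def add_increasing2)
      have "2 * pi * real K / \<omega> \<le> 2 * pi * (H * \<omega> / (2 * pi) + 2) / \<omega>"
        using K(2) \<omega>0 by (intro divide_right_mono mult_left_mono) auto
      also have "\<dots> = H + 4 * pi / \<omega>" using \<omega>0 by (simp add: field_simps)
      also have "4 * pi / \<omega> \<le> 4 * pi / 1" using \<omega>1 by (intro divide_left_mono) auto
      also have "4 * pi \<le> 16" using pi_less_4 by simp
      finally have "t1 \<le> T + H + (H + 16)" using g(4) by (simp add: t1_def t0_def)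
      then show "t1 \<le> 2 * T" using HX sT T by simp
    qed
    moreover have "norm (w t0) \<le> W"
      unfolding w_def by (rule W) (use NP g(3,4) HX sT T in \<open>auto simp: P_def t0_def\<close>)
    ultimately show ?thesis using norm_triangle_ineq4[of "w t1" "w t0"] by simp
  qed
  define main where "main = \<sigma> * (- (1 / pi) * H * ln (T / (2 * pi)) * (sin (\<tau> / 2))\<^sup>2)"
  have cs: "cos \<tau> - 1 = - 2 * (sin (\<tau> / 2))\<^sup>2" using cos_double_sin[of "\<tau> / 2"] by simp
  have "2 * \<sigma> * Re V - main = 2 * \<sigma> * (Re (f 1) + Re (\<Sum>n=2..<N-1. f n) + Re (f (N - 1)) + Re (f N)) - main"
    unfolding Vf split by simp
  also have "\<dots> = (2 * \<sigma> * Re (f 1) - main) + 2 * \<sigma> * (Re (\<Sum>n=2..<N-1. f n) + Re (f (N - 1)) + Re (f N))"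
    by (simp add: algebra_simps)
  \<comment> \<open>\<open>Re (f 1)\<close> is \<open>- 2 * K\<close> times the squared sine; with
    \<open>H * \<omega> / (2 * pi)\<close> in place of \<open>K\<close> it would give
    \<open>main\<close> exactly.\<close>
  also have "2 * \<sigma> * Re (f 1) - main = - (4 * \<sigma> * (sin (\<tau> / 2))\<^sup>2 * (real K - H * \<omega> / (2 * pi)))"
  proof -
    have "Re (f 1) = real K * (cos \<tau> - 1)" unfolding f1 by simp
    moreover have "main = - (4 * \<sigma> * (sin (\<tau> / 2))\<^sup>2 * (H * \<omega> / (2 * pi)))" unfolding main_def \<omega>_def by simp
    ultimately show ?thesis unfolding cs by (simp add: algebra_simps)
  qed
  finally have dec: "2 * \<sigma> * Re V - main = - (4 * \<sigma> * (sin (\<tau> / 2))\<^sup>2 * (real K - H * \<omega> / (2 * pi))) + 2 * \<sigma> * (Re (\<Sum>n=2..<N-1. f n) + Re (f (N - 1)) + Re (f N))" .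
  have d1: "\<bar>4 * \<sigma> * (sin (\<tau> / 2))\<^sup>2 * (real K - H * \<omega> / (2 * pi))\<bar> \<le> 8"
  proof -
    have "\<bar>4 * \<sigma> * (sin (\<tau> / 2))\<^sup>2 * (real K - H * \<omega> / (2 * pi))\<bar> = 4 * (sin (\<tau> / 2))\<^sup>2 * \<bar>real K - H * \<omega> / (2 * pi)\<bar>"
      using \<sigma> by (simp add: abs_mult)
    also have "\<dots> \<le> 4 * 1 * 2" using K(2) by (intro mult_mono) (auto simp: abs_square_le_1)
    finally show ?thesis by simp
  qed
  have d2: "\<bar>Re (\<Sum>n=2..<N-1. f n) + Re (f (N - 1)) + Re (f N)\<bar> \<le> 2 * W + 12 * real K * m"
    using abs_Re_le_cmod[of "\<Sum>n=2..<N-1. f n"] abs_Re_le_cmod[of "f (N-1)"] abs_Re_le_cmod[of "f N"] mid fl[of "N - 1"] fl[of N]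
    by linarith
  have Vm: "\<bar>2 * \<sigma> * Re V - main\<bar> \<le> 8 + 2 * (2 * W + 12 * real K * m)"
  proof -
    have "\<bar>- a + b\<bar> \<le> 8 + 2 * w" if "\<bar>b\<bar> = 2 * \<bar>c\<bar>" "\<bar>a\<bar> \<le> 8" "\<bar>c\<bar> \<le> w" for a b c w :: real
      using that by linarith
    from this[OF _ d1 d2] show ?thesis unfolding dec using \<sigma> by (simp add: abs_mult)
  qed
  have "norm (S - of_real main) \<le> norm (S - of_real (2 * \<sigma> * Re V)) + norm (complex_of_real (2 * \<sigma> * Re V) - of_real main)"
    using norm_triangle_ineq[of "S - of_real (2 * \<sigma> * Re V)" "complex_of_real (2 * \<sigma> * Re V) - of_real main"] by simp
  also have "norm (complex_of_real (2 * \<sigma> * Re V) - of_real main) = \<bar>2 * \<sigma> * Re V - main\<bar>"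
    unfolding of_real_diff[symmetric] norm_of_real ..
  finally have tot: "norm (S - of_real main) \<le> real K * (2 * \<delta>) + (8 + 2 * (2 * W + 12 * real K * m))"
    using SV Vm by linarith
  have hm: "h * m \<le> 1"
  proof -
    have "h * m \<le> T powr (1/4) * m" using h m0 by (intro mult_right_mono) auto
    also have "\<dots> = 1" using T by (simp add: m_def flip: powr_add)
    finally show ?thesis .
  qed
  have Km: "real K * m \<le> 3 * ln T"
  proof -
    have "real K * m \<le> 3 * h * ln T * m" using K3 m0 by (intro mult_right_mono) auto
    also have "\<dots> = 3 * ln T * (h * m)" by simp
    also have "\<dots> \<le> 3 * ln T * 1" using hm lnT by (intro mult_left_mono) auto
    finally show ?thesis by simp
  qed
  \<comment> \<open>The constant is 3 from the bound for \<open>K\<close>, times 6 from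
    \<open>E\<close>, times 25 from \<open>(H + 4)^2 \<le> (5 * h)^2\<close>.\<close>
  have KE: "real K * (T powr (1/4) * (ln T * E)) \<le> 450 * ln T"
  proof -
    have "E \<le> 6 * (5 * h)^2 / T" unfolding E_def using HX H T by (intro divide_right_mono mult_left_mono power_mono) auto
    then have "real K * (T powr (1/4) * (ln T * E)) \<le> (3 * h * ln T) * (T powr (1/4) * (ln T * (6 * (5 * h)^2 / T)))"
      using K3 lnT H T by (intro mult_mono) (auto simp: E_def)
    also have "\<dots> = 450 * ln T * (h ^ 3 / T * ln T * T powr (1/4))" by (simp add: power2_eq_square power3_eq_cube)
    also have "\<dots> \<le> 450 * ln T * 1" using h(4) lnT by (intro mult_left_mono) auto
    finally show ?thesis by simp
  qed
  have "real K * (2 * \<delta>) = 2 * Cz * (real K * m) + 8 * (real K * (T powr (1/4) * (ln T * E)))"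
    unfolding \<delta>_def by (simp add: algebra_simps)
  also have "\<dots> \<le> 2 * Cz * (3 * ln T) + 8 * (450 * ln T)" using Km KE Cz(1) by (intro add_mono mult_left_mono) auto
  finally have Kd: "real K * (2 * \<delta>) \<le> 2 * Cz * (3 * ln T) + 8 * (450 * ln T)" .
  \<comment> \<open>3680 is 3600 from the linearisation, 72 from the last two terms and 8 from the
    error in \<open>K\<close>.\<close>
  have "norm (S - of_real main) \<le> (6 * Cz + 3680) * ln T + 4 * W"
    using tot Kd Km lnT by (simp add: algebra_simps)
  then show ?thesis unfolding S_def main_def z_def G_def .
qed

text \<open>The admissible indices form a block of consecutive integers, whose number
  \<open>K\<close> is \<open>H * \<omega> / (2 * pi)\<close> up to 2: one unit for rounding at the
  ends, one for the linearisation of theta.\<close>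

lemma gram_sum_estimate:
  fixes p :: int
  assumes idx: "\<And>j::int. RS_theta T \<le> pi * of_int j \<Longrightarrow> RS_theta 200 + pi \<le> pi * of_int j"
      "\<And>j::int. \<nu>0 \<le> j \<and> T \<le> gram_pt j 0 \<and> gram_pt j 0 \<le> T + H \<longleftrightarrow>
      RS_theta T \<le> pi * of_int j \<and> pi * of_int j \<le> RS_theta (T + H)"
    and T: "T \<ge> 400" and h: "1 \<le> h" "5 * h \<le> sqrt T" "h \<le> T powr (1/4)" "h ^ 3 / T * ln T * T powr (1/4) \<le> 1"
    and H: "0 < H" "H \<le> h" and \<tau>: "\<bar>\<tau>\<bar> \<le> pi" and \<omega>1: "ln (T / (2 * pi)) / 2 \<ge> 1"
    and p: "p = 0 \<and> \<sigma> = 1 \<or> p = 1 \<and> \<sigma> = (-1::real)"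
    and Cz: "Cz > 0" "\<And>t. \<bar>t - T\<bar> \<le> sqrt T \<Longrightarrow>
     norm (hardy_Z t - of_real (RS_main T t)) \<le> Cz * T powr (- 1/4)"
    and W: "\<And>N t. real N \<le> sqrt (T / (2 * pi)) \<Longrightarrow> T \<le> t \<Longrightarrow> t \<le> 2 * T \<Longrightarrow>
    norm (gram_weight_sum \<tau> T N t) \<le> W"
  shows "norm ((\<Sum>\<nu> | \<nu>0 \<le> 2 * \<nu> + p \<and> T \<le> gram_pt (2 * \<nu> + p) 0 \<and> gram_pt (2 * \<nu> + p) 0 \<le> T + H.
        hardy_Z (gram_pt (2 * \<nu> + p) \<tau>) - hardy_Z (gram_pt (2 * \<nu> + p) 0))
      - of_real (\<sigma> * (- (1 / pi) * H * ln (T / (2 * pi)) * (sin (\<tau> / 2))\<^sup>2)))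
      \<le> (6 * Cz + 3680) * ln T + 4 * W"
proof -
  define \<omega> where "\<omega> = ln (T / (2 * pi)) / 2"
  define main where "main = \<sigma> * (- (1 / pi) * H * ln (T / (2 * pi)) * (sin (\<tau> / 2))\<^sup>2)"
  \<comment> \<open>The real values of \<nu> at which \<open>pi * (2 * \<nu> + p)\<close> meets
    theta at the ends of the interval.\<close>
  define a b where "a = (RS_theta T / pi - of_int p) / 2" and "b = (RS_theta (T + H) / pi - of_int p) / 2"
  define \<nu>1 \<nu>2 where "\<nu>1 = \<lceil>a\<rceil>" and "\<nu>2 = \<lfloor>b\<rfloor>"
  define K where "K = nat (\<nu>2 - \<nu>1 + 1)"
  define F where "F = (\<lambda>\<nu>. hardy_Z (gram_pt (2 * \<nu> + p) \<tau>) - hardy_Z (gram_pt (2 * \<nu> + p) 0))"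
  have lnT: "ln T \<ge> 1" using T exp_le by (subst ln_ge_iff) auto
  have HX: "H + 4 \<le> sqrt T" using H h by linarith
  have sT: "sqrt T \<le> T / 2"
  proof -
    have "2 \<le> sqrt T" using T by (intro real_le_rsqrt) simp
    then have "2 * sqrt T \<le> sqrt T * sqrt T" using T by (intro mult_right_mono) auto
    then show ?thesis using T by simp
  qed
  have mem: "RS_theta T \<le> pi * of_int (2 * \<nu> + p) \<and> pi * of_int (2 * \<nu> + p) \<le> RS_theta (T + H) \<longleftrightarrow> \<nu> \<in> {\<nu>1..\<nu>2}" for \<nu>
  proof -
    have "RS_theta T \<le> pi * of_int (2 * \<nu> + p) \<longleftrightarrow> a \<le> of_int \<nu>" by (simp add: a_def field_simps)
    moreover have "pi * of_int (2 * \<nu> + p) \<le> RS_theta (T + H) \<longleftrightarrow> of_int \<nu> \<le> b" by (simp add: b_def field_simps)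
    ultimately show ?thesis by (simp add: \<nu>1_def \<nu>2_def ceiling_le_iff le_floor_iff)
  qed
  have set: "{\<nu>. \<nu>0 \<le> 2 * \<nu> + p \<and> T \<le> gram_pt (2 * \<nu> + p) 0 \<and> gram_pt (2 * \<nu> + p) 0 \<le> T + H} = {\<nu>1..\<nu>2}"
    unfolding idx(2) mem by auto
  have bij: "bij_betw (\<lambda>k. \<nu>1 + int k) {..<K} {\<nu>1..\<nu>2}"
    by (rule bij_betwI[where g = "\<lambda>\<nu>. nat (\<nu> - \<nu>1)"]) (auto simp: K_def)
  have sumK: "(\<Sum>\<nu>\<in>{\<nu>1..\<nu>2}. F \<nu>) = (\<Sum>k<K. F (\<nu>1 + int k))"
    using sum.reindex_bij_betw[OF bij, of F] by simp
  have Kb: "\<bar>real K - H * \<omega> / (2 * pi)\<bar> \<le> 2"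
  proof -
    have ab: "b - a = (RS_theta (T + H) - RS_theta T) / (2 * pi)" by (simp add: a_def b_def field_simps)
    have "b - a \<ge> 0" unfolding ab using RS_theta_increment[of T "T + H"] T H by simp
    then have "\<nu>2 - \<nu>1 + 1 \<ge> 0" unfolding \<nu>1_def \<nu>2_def by linarith
    then have "real K = of_int (\<nu>2 - \<nu>1 + 1)" by (simp add: K_def)
    then have 1: "\<bar>real K - (b - a)\<bar> \<le> 1" unfolding \<nu>1_def \<nu>2_def by simp linarith
    have "\<bar>(RS_theta (T + H) - RS_theta T) - ln (T / (2 * pi)) / 2 * (T + H - T)\<bar> \<le> 3 * (H + 4) / T * \<bar>T + H - T\<bar>"
      by (rule RS_theta_linear[OF T]) (use H HX sT in auto)
    also have "\<dots> \<le> 3 * (H + 4) / T * (H + 4)" using H T by (intro mult_left_mono) auto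
    also have "\<dots> = 3 * (H + 4)^2 / T" by (simp add: power2_eq_square)
    also have "\<dots> \<le> 3 * (sqrt T)^2 / T" using HX H T by (intro divide_right_mono mult_left_mono power_mono) auto
    also have "\<dots> = 3" using T by simp
    finally have "\<bar>(RS_theta (T + H) - RS_theta T) - \<omega> * H\<bar> \<le> 3" by (simp add: \<omega>_def)
    then have "\<bar>(RS_theta (T + H) - RS_theta T) - \<omega> * H\<bar> / (2 * pi) \<le> 3 / (2 * pi)" by (intro divide_right_mono) auto
    also have "\<dots> \<le> 1" using pi_gt3 by simp
    also have "\<bar>(RS_theta (T + H) - RS_theta T) - \<omega> * H\<bar> / (2 * pi) = \<bar>(b - a) - H * \<omega> / (2 * pi)\<bar>"
    proof -
      have "((RS_theta (T + H) - RS_theta T) - \<omega> * H) / (2 * pi) = (b - a) - H * \<omega> / (2 * pi)"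
        unfolding ab by (simp add: diff_divide_distrib mult.commute)
      then show ?thesis by (metis abs_divide abs_of_nonneg pi_ge_zero mult_nonneg_nonneg zero_le_numeral)
    qed
    finally show ?thesis using 1 by linarith
  qed
  have W0: "W \<ge> 0" using order.trans[OF norm_ge_zero W[of 0 T]] T by simp
  have "norm ((\<Sum>k<K. F (\<nu>1 + int k)) - of_real main) \<le> (6 * Cz + 3680) * ln T + 4 * W"
  proof (cases "K = 0")
    \<comment> \<open>Without any Gram point the sum is 0; then
      \<open>H * \<omega> / (2 * pi)\<close> is at most 2 and the main term is itself
      bounded.\<close>
    case True
    have "\<bar>main\<bar> = 4 * \<bar>H * \<omega> / (2 * pi)\<bar> * (sin (\<tau> / 2))\<^sup>2"
    proof -
      have "main = \<sigma> * (- (4 * (H * \<omega> / (2 * pi)) * (sin (\<tau> / 2))\<^sup>2))" by (simp add: main_def \<omega>_def)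
      then show ?thesis using p by (auto simp: abs_mult)
    qed
    also have "\<dots> \<le> 4 * 2 * 1" using Kb True by (intro mult_mono) (auto simp: abs_square_le_1)
    also have "\<dots> \<le> (6 * Cz + 3680) * 1" using Cz(1) by simp
    also have "\<dots> \<le> (6 * Cz + 3680) * ln T + 4 * W" using lnT W0 Cz(1) by (intro add_increasing2 mult_left_mono) auto
    finally show ?thesis using True by (simp only: sum.empty lessThan_0) simp
  next
    case False
    have kS: "RS_theta T \<le> pi * of_int (2 * (\<nu>1 + int k) + p)" "pi * of_int (2 * (\<nu>1 + int k) + p) \<le> RS_theta (T + H)" if "k < K" for k
      using mem[of "\<nu>1 + int k"] that by (auto simp: K_def)
    have gS: "T \<le> gram_pt (2 * (\<nu>1 + int k) + p) 0" "gram_pt (2 * (\<nu>1 + int k) + p) 0 \<le> T + H" if "k < K" for k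
      using kS[OF that] idx(2)[of "2 * (\<nu>1 + int k) + p"] by auto
    show ?thesis unfolding F_def main_def
    proof (rule gram_sum_main_estimate[OF T h H \<tau> \<omega>_def _ p Cz W _ Kb])
      show "\<omega> \<ge> 1" using \<omega>1 by (simp add: \<omega>_def)
      show "1 \<le> K" using False by simp
      show "T \<le> gram_pt (2 * \<nu>1 + p) 0" "gram_pt (2 * \<nu>1 + p) 0 \<le> T + H" using gS[of 0] False by auto
      fix k \<tau>' assume k: "k < K" and t': "\<bar>\<tau>'\<bar> \<le> pi"
      have j: "RS_theta 200 + pi \<le> pi * of_int (2 * (\<nu>1 + int k) + p)" using idx(1) kS[OF k] by blast
      show "RS_theta (gram_pt (2 * (\<nu>1 + int k) + p) \<tau>') = pi * of_int (2 * (\<nu>1 + int k) + p) + \<tau>'"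
        using gram_pt_shift(2)[OF j t'] .
      show "\<bar>gram_pt (2 * (\<nu>1 + int k) + p) \<tau>' - T\<bar> \<le> H + 4"
        using gram_pt_shift(3)[OF j t'] gS[OF k] t' pi_less_4 by linarith
    qed
  qed
  then have "norm ((\<Sum>\<nu>\<in>{\<nu>1..\<nu>2}. F \<nu>) - of_real main) \<le> (6 * Cz + 3680) * ln T + 4 * W"
    unfolding sumK .
  then show ?thesis unfolding set F_def main_def .
qed

text \<open>All constants are fixed before \<open>T\<close>, \<open>H\<close>, \<tau> and the
  parity, which gives the uniformity; what remains is that the growth conditions on the interval
  length hold for large \<open>T\<close>.\<close>

lemma gram_sum_uniform:
  fixes \<nu>0 :: int
  assumes \<epsilon>: "\<epsilon> < 1/100" and \<Delta>: "0 < \<Delta>" "\<Delta> \<le> 1/6" and A: "0 < A" and hyp: "exp_sum_hyp A \<Delta>"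
  shows "\<exists>C. \<forall>\<^sub>F T in at_top. \<forall>H\<in>{0<..T powr (1/6 + \<epsilon>)}. \<forall>\<tau>\<in>{-pi..pi}. \<forall>(p::int) \<sigma>::real.
    p = 0 \<and> \<sigma> = 1 \<or> p = 1 \<and> \<sigma> = -1 \<longrightarrow>
    norm ((\<Sum>\<nu> | \<nu>0 \<le> 2 * \<nu> + p \<and> T \<le> gram_pt (2 * \<nu> + p) 0 \<and> gram_pt (2 * \<nu> + p) 0 \<le> T + H.
        hardy_Z (gram_pt (2 * \<nu> + p) \<tau>) - hardy_Z (gram_pt (2 * \<nu> + p) 0))
      - of_real (\<sigma> * (- (1 / pi) * H * ln (T / (2 * pi)) * (sin (\<tau> / 2))\<^sup>2))) \<le> C * (T powr \<Delta> * ln T)"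
proof -
  from weighted_exp_sum_bound[OF hyp A \<Delta>] obtain Cw where Cw1: "Cw > 0" and Cw2: "\<forall>T\<ge>100. \<forall>\<tau> N t.
    \<bar>\<tau>\<bar> \<le> pi \<longrightarrow> real N \<le> sqrt (T / (2 * pi)) \<longrightarrow> T \<le> t \<longrightarrow> t \<le> 2 * T \<longrightarrow>
    norm (gram_weight_sum \<tau> T N t) \<le> Cw * (T powr \<Delta> * ln T)"
    by (elim exE conjE)
  from hardy_Z_approx obtain Cz where Cz1: "Cz > 0" and Cz2: "\<forall>T\<ge>400. \<forall>t. \<bar>t - T\<bar> \<le> sqrt T \<longrightarrow>
     norm (hardy_Z t - of_real (RS_main T t)) \<le> Cz * T powr (- 1/4)"
    by (elim exE conjE)
  from gram_index_set[of \<nu>0] obtain T1 where T1: "\<forall>T\<ge>T1. \<forall>H>0. \<forall>j::int.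
     (RS_theta T \<le> pi * of_int j \<longrightarrow> RS_theta 200 + pi \<le> pi * of_int j) \<and>
     (\<nu>0 \<le> j \<and> T \<le> gram_pt j 0 \<and> gram_pt j 0 \<le> T + H \<longleftrightarrow>
      RS_theta T \<le> pi * of_int j \<and> pi * of_int j \<le> RS_theta (T + H))"
    by (elim exE conjE)
  \<comment> \<open>An upper bound for every admissible \<open>H\<close>. The exponent is below 1/4,
    and three times it is below 3/4, which are the two conditions of the estimate with room for the
    logarithm.\<close>
  define h where "h = (\<lambda>T::real. T powr (1/6 + 1/100))"
  define C where "C = 6 * Cz + 3680 + 4 * Cw"
  note Cw = Cw1 Cw2[rule_format] and Cz = Cz1 Cz2[rule_format]
  have "\<forall>\<^sub>F T::real in at_top. T \<ge> 400" "\<forall>\<^sub>F T in at_top. T \<ge> T1"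
    by (rule eventually_ge_at_top)+
  moreover have "\<forall>\<^sub>F T in at_top. 1 \<le> h T" "\<forall>\<^sub>F T in at_top. 5 * h T \<le> sqrt T"
    "\<forall>\<^sub>F T in at_top. h T \<le> T powr (1/4)"
    "\<forall>\<^sub>F T in at_top. h T ^ 3 / T * ln T * T powr (1/4) \<le> 1"
    "\<forall>\<^sub>F T::real in at_top. 1 \<le> ln (T / (2 * pi)) / 2"
    unfolding h_def by real_asymp+
  ultimately have ev: "\<forall>\<^sub>F T in at_top. T \<ge> 400 \<and> T \<ge> T1 \<and> 1 \<le> h T \<and> 5 * h T \<le> sqrt T \<and> h T \<le> T powr (1/4) \<and>
      h T ^ 3 / T * ln T * T powr (1/4) \<le> 1 \<and> 1 \<le> ln (T / (2 * pi)) / 2"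
    by eventually_elim blast
  show ?thesis
  proof (intro exI[of _ C] eventually_mono[OF ev] ballI allI impI, elim conjE)
    fix T H \<tau> \<sigma> :: real and p :: int
    assume elim: "T \<ge> 400" "T \<ge> T1" "1 \<le> h T" "5 * h T \<le> sqrt T" "h T \<le> T powr (1/4)"
        "h T ^ 3 / T * ln T * T powr (1/4) \<le> 1" "1 \<le> ln (T / (2 * pi)) / 2"
      and H: "H \<in> {0 <.. T powr (1 / 6 + \<epsilon>)}" and \<tau>: "\<tau> \<in> {- pi .. pi}" and p: "p = 0 \<and> \<sigma> = 1 \<or> p = 1 \<and> \<sigma> = -1"
    have "T powr (1/6 + \<epsilon>) \<le> h T" unfolding h_def using \<epsilon> elim(1) by (intro powr_mono) auto
    then have H': "0 < H" "H \<le> h T" using H by auto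
    have \<tau>': "\<bar>\<tau>\<bar> \<le> pi" using \<tau> by auto
    have lnT: "ln T \<ge> 1" using elim(1) exp_le by (subst ln_ge_iff) auto
    have TD: "T powr \<Delta> \<ge> 1" using elim(1) \<Delta> by (simp add: ge_one_powr_ge_zero)
    have T100: "T \<ge> 100" using elim(1) by simp
    have idx: "RS_theta T \<le> pi * of_int j \<Longrightarrow> RS_theta 200 + pi \<le> pi * of_int j"
      "\<nu>0 \<le> j \<and> T \<le> gram_pt j 0 \<and> gram_pt j 0 \<le> T + H \<longleftrightarrow>
        RS_theta T \<le> pi * of_int j \<and> pi * of_int j \<le> RS_theta (T + H)" for j
      using T1[rule_format, OF elim(2) H'(1), of j] by blast+
    have "norm ((\<Sum>\<nu> | \<nu>0 \<le> 2 * \<nu> + p \<and> T \<le> gram_pt (2 * \<nu> + p) 0 \<and> gram_pt (2 * \<nu> + p) 0 \<le> T + H.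
      hardy_Z (gram_pt (2 * \<nu> + p) \<tau>) - hardy_Z (gram_pt (2 * \<nu> + p) 0))
      - of_real (\<sigma> * (- (1 / pi) * H * ln (T / (2 * pi)) * (sin (\<tau> / 2))\<^sup>2))) \<le> (6 * Cz + 3680) * ln T + 4 * (Cw * (T powr \<Delta> * ln T))"
      by (rule gram_sum_estimate[OF idx elim(1) elim(3-6) H' \<tau>' elim(7) p Cz(1) Cz(2)[OF elim(1)] Cw(2)[OF T100 \<tau>']])
    also have "(6 * Cz + 3680) * ln T \<le> (6 * Cz + 3680) * (T powr \<Delta> * ln T)"
      using TD lnT Cz(1) by (intro mult_left_mono) auto
    finally show "norm ((\<Sum>\<nu> | \<nu>0 \<le> 2 * \<nu> + p \<and> T \<le> gram_pt (2 * \<nu> + p) 0 \<and> gram_pt (2 * \<nu> + p) 0 \<le> T + H.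
      hardy_Z (gram_pt (2 * \<nu> + p) \<tau>) - hardy_Z (gram_pt (2 * \<nu> + p) 0))
      - of_real (\<sigma> * (- (1 / pi) * H * ln (T / (2 * pi)) * (sin (\<tau> / 2))\<^sup>2))) \<le> C * (T powr \<Delta> * ln T)"
      by (simp add: C_def algebra_simps)
  qed
qed

theorem theorem2:
  shows "\<forall>\<^sub>F \<epsilon> :: real in at_right 0.
    \<forall>(\<Delta> :: real) (A :: real) (\<nu>0 :: int).
      0 < \<Delta> \<and> \<Delta> \<le> 1 / 6 \<and> 0 < A \<and>
      (\<forall>(t :: real) (a :: real) (b :: real).
         0 < t \<and> 1 \<le> a \<and> a < b \<and> b \<le> 2 * a \<and> b \<le> sqrt (t / (2 * pi)) \<longrightarrow>
         cmod (\<Sum>n | a \<le> real n \<and> real n < b. of_nat n powr (\<i> * of_real t))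
           < A * sqrt a * t powr \<Delta>)
      \<longrightarrow>
      (\<exists>C :: real. \<forall>\<^sub>F T :: real in at_top.
         \<forall>H \<in> {0 <.. T powr (1 / 6 + \<epsilon>)}. \<forall>\<tau> \<in> {- pi .. pi}.
           cmod ((\<Sum>\<nu> :: int | \<nu>0 \<le> 2 * \<nu> \<and> T \<le> gram_pt (2 * \<nu>) 0 \<and> gram_pt (2 * \<nu>) 0 \<le> T + H.
                    hardy_Z (gram_pt (2 * \<nu>) \<tau>) - hardy_Z (gram_pt (2 * \<nu>) 0))
                 - of_real (- (1 / pi) * H * ln (T / (2 * pi)) * (sin (\<tau> / 2))\<^sup>2))
             \<le> C * (T powr \<Delta> * ln T) \<and>
           cmod ((\<Sum>\<nu> :: int | \<nu>0 \<le> 2 * \<nu> + 1 \<and> T \<le> gram_pt (2 * \<nu> + 1) 0 \<and> gram_pt (2 * \<nu> + 1) 0 \<le> T + H.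
                    hardy_Z (gram_pt (2 * \<nu> + 1) \<tau>) - hardy_Z (gram_pt (2 * \<nu> + 1) 0))
                 - of_real (1 / pi * H * ln (T / (2 * pi)) * (sin (\<tau> / 2))\<^sup>2))
             \<le> C * (T powr \<Delta> * ln T))"
\<comment> \<open>Every \<epsilon> between 0 and 1/100 is admissible; the bound is the one under
  which the growth conditions were checked.\<close>
proof (rule eventually_at_rightI[of 0 "1/100"], intro allI impI, elim conjE, goal_cases)
  case (1 \<epsilon> \<Delta> A \<nu>0)
  show ?case
  proof (rule ex_forward[OF gram_sum_uniform[of \<epsilon> \<Delta> A \<nu>0]], goal_cases)
    case 5
    from 1(5) show ?case unfolding exp_sum_hyp_def .
  next
    case (6 C)
    show ?case
    proof (rule eventually_mono[OF 6], intro ballI conjI, goal_cases)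
      case (1 T H \<tau>)
      from 1(1)[rule_format, OF 1(2,3), of 0 1] show ?case by simp
    next
      case (2 T H \<tau>)
      from 2(1)[rule_format, OF 2(2,3), of 1 "-1"] show ?case by simp
    qed
  qed (use 1 in auto)
qed simp

end
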